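(* Let $N=5$ and let $m_1,m_2,a_1,a_2>0$. Then there exists a pair of real-valued functions $(w,\xi)\in M$ such that (1) $S(w,\xi)=m=\inf_{(u,v)\in M}S(u,v)$; (2) $(w,\xi)$ is a ground state solution of the elliptic system $$-\Delta u+m_1^2u=2a_1m_1uv,\qquad -\Delta v+m_2^2v=2a_2m_2u^2\qquad\text{in }\mathbb{R}^N.$$
   Context: All functions are real-valued. For $(u,v)\in H^1(\mathbb{R}^N)\times H^1(\mathbb{R}^N)$ (integrals over $\mathbb{R}^N$): $$S(u,v)=a_2m_2\int|\nabla u|^2dx+\frac{a_1m_1}{2}\int|\nabla v|^2dx+a_2m_2m_1^2\int u^2dx+\frac{a_1m_1m_2^2}{2}\int v^2dx-2a_1a_2m_1m_2\int vu^2dx,$$ $$Q(u,v)=2a_2m_2\int|\nabla u|^2dx+a_1m_1\int|\nabla v|^2dx+2a_2m_2m_1^2\int u^2dx+a_1m_1m_2^2\int v^2dx-6a_1a_2m_1m_2\int vu^2dx,$$ $$M=\{(u,v)\in H^1(\mathbb{R}^N)\times H^1(\mathbb{R}^N)\setminus\{(0,0)\}:\ Q(u,v)=0\},\qquad m=\inf_{(u,v)\in M}S(u,v).$$ A pair $(u,v)\in H^1\times H^1$ is a solution of the elliptic system if it satisfies it weakly (tested against $C_0^\infty(\mathbb{R}^N)\times C_0^\infty(\mathbb{R}^N)$), equivalently if it is a critical point of $S$, i.e. $S'[(u,v)](u_1,v_1)=0$ for all $(u_1,v_1)\in H^1\times H^1$. A ground state solution is a nontrivial solution $(u,v)\ne(0,0)$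 such that $S(u,v)\le S(u^*,v^* )$ for every nontrivial critical point $(u^*,v^* )\in H^1\times H^1$ of $S$. *)

theory Defs
  imports "HOL-Analysis.Analysis"
begin

fun Ck :: "nat \<Rightarrow> ('a::euclidean_space \<Rightarrow> real) \<Rightarrow> bool" where
  "Ck 0 f \<longleftrightarrow> continuous_on UNIV f"
| "Ck (Suc k) f \<longleftrightarrow> f differentiable_on UNIV \<and>
     (\<forall>b\<in>Basis. Ck k (\<lambda>x. frechet_derivative f (at x) b))"

definition test_functions :: "('a::euclidean_space \<Rightarrow> real) set" where
  "test_functions = {\<phi>. (\<forall>k. Ck k \<phi>) \<and> compact (closure {x. \<phi> x \<noteq> 0})}"

definition gradient :: "('a::euclidean_space \<Rightarrow> real) \<Rightarrow> 'a \<Rightarrow> 'a" where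
  "gradient \<phi> x = (\<Sum>b\<in>Basis. frechet_derivative \<phi> (at x) b *\<^sub>R b)"

definition square_integrable :: "('a::euclidean_space \<Rightarrow> 'b::euclidean_space) \<Rightarrow> bool" where
  "square_integrable f \<longleftrightarrow>
     f \<in> borel_measurable lebesgue \<and> integrable lebesgue (\<lambda>x. (norm (f x))\<^sup>2)"

definition has_weak_gradient :: "('a::euclidean_space \<Rightarrow> real) \<Rightarrow> ('a \<Rightarrow> 'a) \<Rightarrow> bool" where
  "has_weak_gradient u G \<longleftrightarrow>
     (\<forall>\<phi>\<in>test_functions. \<forall>b\<in>Basis.
        (LINT x|lebesgue. u x * (gradient \<phi> x \<bullet> b)) = - (LINT x|lebesgue. (G x \<bullet> b) * \<phi> x))"

text \<open>Elements of \<open>H1\<close> are representatives: functions that agree almost everywhere are not identified.\<close>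

definition H1 :: "('a::euclidean_space \<Rightarrow> real) set" where
  "H1 = {u. square_integrable u \<and> (\<exists>G. square_integrable G \<and> has_weak_gradient u G)}"

text \<open>For \<open>u \<in> H1\<close> the weak gradient is unique up to a null set, so the integrals below do not
  depend on the choice made here.\<close>

definition weak_gradient :: "('a::euclidean_space \<Rightarrow> real) \<Rightarrow> 'a \<Rightarrow> 'a" where
  "weak_gradient u = (SOME G. square_integrable G \<and> has_weak_gradient u G)"

text \<open>\<open>(u, v) \<noteq> (0, 0)\<close> as an element of \<open>H1 \<times> H1\<close>, i.e. modulo null sets.\<close>

definition nontrivial :: "('a::euclidean_space \<Rightarrow> real) \<Rightarrow> ('a \<Rightarrow> real) \<Rightarrow> bool" where
  "nontrivial u v \<longleftrightarrow> \<not> (AE x in lebesgue. u x = 0 \<and> v x = 0)"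

definition S_functional ::
  "real \<Rightarrow> real \<Rightarrow> real \<Rightarrow> real \<Rightarrow> ('a::euclidean_space \<Rightarrow> real) \<Rightarrow> ('a \<Rightarrow> real) \<Rightarrow> real" where
  "S_functional m1 m2 a1 a2 u v =
     a2 * m2 * (LINT x|lebesgue. (norm (weak_gradient u x))\<^sup>2)
     + a1 * m1 / 2 * (LINT x|lebesgue. (norm (weak_gradient v x))\<^sup>2)
     + a2 * m2 * m1\<^sup>2 * (LINT x|lebesgue. (u x)\<^sup>2)
     + a1 * m1 * m2\<^sup>2 / 2 * (LINT x|lebesgue. (v x)\<^sup>2)
     - 2 * a1 * a2 * m1 * m2 * (LINT x|lebesgue. v x * (u x)\<^sup>2)"

definition Q_functional ::
  "real \<Rightarrow> real \<Rightarrow> real \<Rightarrow> real \<Rightarrow> ('a::euclidean_space \<Rightarrow> real) \<Rightarrow> ('a \<Rightarrow> real) \<Rightarrow> real" where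
  "Q_functional m1 m2 a1 a2 u v =
     2 * a2 * m2 * (LINT x|lebesgue. (norm (weak_gradient u x))\<^sup>2)
     + a1 * m1 * (LINT x|lebesgue. (norm (weak_gradient v x))\<^sup>2)
     + 2 * a2 * m2 * m1\<^sup>2 * (LINT x|lebesgue. (u x)\<^sup>2)
     + a1 * m1 * m2\<^sup>2 * (LINT x|lebesgue. (v x)\<^sup>2)
     - 6 * a1 * a2 * m1 * m2 * (LINT x|lebesgue. v x * (u x)\<^sup>2)"

definition M_set ::
  "real \<Rightarrow> real \<Rightarrow> real \<Rightarrow> real \<Rightarrow> (('a::euclidean_space \<Rightarrow> real) \<times> ('a \<Rightarrow> real)) set" where
  "M_set m1 m2 a1 a2 =
     {(u, v). u \<in> H1 \<and> v \<in> H1 \<and> nontrivial u v \<and> Q_functional m1 m2 a1 a2 u v = 0}"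

definition weak_solution ::
  "real \<Rightarrow> real \<Rightarrow> real \<Rightarrow> real \<Rightarrow> ('a::euclidean_space \<Rightarrow> real) \<Rightarrow> ('a \<Rightarrow> real) \<Rightarrow> bool" where
  "weak_solution m1 m2 a1 a2 u v \<longleftrightarrow> u \<in> H1 \<and> v \<in> H1 \<and>
     (\<forall>\<phi>\<in>test_functions. \<forall>\<psi>\<in>test_functions.
        (LINT x|lebesgue. weak_gradient u x \<bullet> gradient \<phi> x) + m1\<^sup>2 * (LINT x|lebesgue. u x * \<phi> x)
          = 2 * a1 * m1 * (LINT x|lebesgue. u x * v x * \<phi> x) \<and>
        (LINT x|lebesgue. weak_gradient v x \<bullet> gradient \<psi> x) + m2\<^sup>2 * (LINT x|lebesgue. v x * \<psi> x)
          = 2 * a2 * m2 * (LINT x|lebesgue. (u x)\<^sup>2 * \<psi> x))"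

text \<open>\<open>S'[(u, v)](u1, v1)\<close> is the derivative at \<open>t = 0\<close> of \<open>S\<close> along the line
  \<open>(u, v) + t (u1, v1)\<close>.\<close>

definition critical_point ::
  "real \<Rightarrow> real \<Rightarrow> real \<Rightarrow> real \<Rightarrow> ('a::euclidean_space \<Rightarrow> real) \<Rightarrow> ('a \<Rightarrow> real) \<Rightarrow> bool" where
  "critical_point m1 m2 a1 a2 u v \<longleftrightarrow> u \<in> H1 \<and> v \<in> H1 \<and>
     (\<forall>u1\<in>H1. \<forall>v1\<in>H1.
        ((\<lambda>t. S_functional m1 m2 a1 a2 (\<lambda>x. u x + t * u1 x) (\<lambda>x. v x + t * v1 x))
           has_real_derivative 0) (at 0))"

definition ground_state ::
  "real \<Rightarrow> real \<Rightarrow> real \<Rightarrow> real \<Rightarrow> ('a::euclidean_space \<Rightarrow> real) \<Rightarrow> ('a \<Rightarrow> real) \<Rightarrow> bool" where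
  "ground_state m1 m2 a1 a2 u v \<longleftrightarrow>
     weak_solution m1 m2 a1 a2 u v \<and> nontrivial u v \<and>
     (\<forall>(u' :: 'a \<Rightarrow> real) (v' :: 'a \<Rightarrow> real).
        critical_point m1 m2 a1 a2 u' v' \<and> nontrivial u' v' \<longrightarrow>
        S_functional m1 m2 a1 a2 u v \<le> S_functional m1 m2 a1 a2 u' v')"

end

theory Submission
  imports Defs "HOL-Library.Diagonal_Subsequence"
begin

text \<open>
Write \<open>A\<close> for the quadratic part of \<open>S\<close> and \<open>B = \<integral> v u\<^sup>2\<close>, so that \<open>S = A - 2cB\<close> and \<open>Q = 2A - 6cB\<close>
with \<open>c = a1 a2 m1 m2\<close>.  On \<open>M\<close> one has \<open>S = A/3\<close>, and a nontrivial critical point lies in \<open>M\<close>, by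
differentiating \<open>S\<close> along \<open>(u, v)\<close> itself.  By homogeneity it suffices to maximize \<open>B / A\<^sup>3\<^sup>/\<^sup>2\<close>; a
maximizer, suitably rescaled, minimizes \<open>S\<close> on \<open>M\<close>, and its Euler--Lagrange equation is the system.

Let \<open>P\<^sub>j\<close> average over cubes of side \<open>64\<^sup>-\<^sup>j\<close>.  The translation estimate
\<open>\<parallel>u(\<sqdot> + h) - u\<parallel>\<^sub>2 \<le> \<bar>h\<bar> \<parallel>\<nabla>u\<parallel>\<^sub>2\<close> bounds \<open>P\<^sub>j\<^sub>+\<^sub>1 u - P\<^sub>j u\<close> in \<open>L\<^sup>2\<close> and in \<open>L\<^sup>\<infinity>\<close>; in dimension 5 interpolation gives
\<open>\<parallel>u - P\<^sub>j u\<parallel>\<^sub>3\<^sup>3 \<le> C 8\<^sup>-\<^sup>j \<parallel>\<nabla>u\<parallel>\<^sub>2\<^sup>3\<close>.  This replaces Sobolev's inequality and also Rellich's theorem, because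
\<open>P\<^sub>j u\<close> converges pointwise when \<open>u\<close> converges weakly.  It shows that a maximizing sequence has averages
\<open>P\<^sub>j v\<close> bounded away from 0 at some point; translating that point to the origin produces a nonzero
weak limit \<open>U\<close>.  Expanding \<open>B(U\<^sub>n + t\<Phi>) \<le> \<beta> A(U\<^sub>n + t\<Phi>)\<^sup>3\<^sup>/\<^sup>2\<close>, letting \<open>n \<rightarrow> \<infinity>\<close> and then \<open>t \<rightarrow> 0\<close> yields
\<open>B'(U)\<Phi> = 3\<beta>\<langle>U, \<Phi>\<rangle>\<close>, and \<open>\<Phi> = U\<close> together with \<open>A(U) \<le> 1\<close> and \<open>B(U) \<le> \<beta> A(U)\<^sup>3\<^sup>/\<^sup>2\<close> forces \<open>A(U) = 1\<close> and \<open>B(U) = \<beta>\<close>.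
\<close>

section \<open>The space of square integrable functions\<close>

text \<open>At scale r the difference of consecutive averages is of order r^(1 - N/2) in sup norm
  and of order r in L2, so its cubic integral is of order r^(3 - N/2). This decays exactly for N <
  6, where the cubic term is subcritical. N = 5 leaves r^(1/2), and the ratio 64 turns it into the
  factor 1/8 that outweighs the 4 lost at each addition of cubes. The obstacle is translation
  invariance: mass of a maximizing sequence may escape, so \<open>B\<close> is not weakly continuous
  along it. The limit of its values is never computed from the weak limit; it is the supremum by
  choice. Only terms with a fixed argument pass to the weak limit, that argument supplying the
  dominating function. Loss of mass is excluded by degrees alone: the limit equation is linear in
  A(U), the inequality has power 3/2. The given notions integrate over \<open>lebesgue\<close>. The
  analysis runs over \<open>lborel\<close>, where translations, affine substitutions and Tonelli's
  theorem apply directly, and is transferred by Borel representatives at the end.\<close>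

definition L2 :: "'a measure \<Rightarrow> ('a \<Rightarrow> 'b::euclidean_space) \<Rightarrow> bool" where
  "L2 M f \<longleftrightarrow> f \<in> borel_measurable M \<and> integrable M (\<lambda>x. (norm (f x))\<^sup>2)"

abbreviation nsq :: "'a measure \<Rightarrow> ('a \<Rightarrow> 'b::euclidean_space) \<Rightarrow> real" where
  "nsq M f \<equiv> LINT x|M. (norm (f x))\<^sup>2"

abbreviation ip :: "'a measure \<Rightarrow> ('a \<Rightarrow> 'b::euclidean_space) \<Rightarrow> ('a \<Rightarrow> 'b) \<Rightarrow> real" where
  "ip M f g \<equiv> LINT x|M. f x \<bullet> g x"

lemma L2_measurable: "L2 M f \<Longrightarrow> f \<in> borel_measurable M"
  by (simp add: L2_def)

lemma nsq_nonneg: "nsq M f \<ge> 0"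
  by simp

lemma L2_inner:
  fixes f g :: "'a \<Rightarrow> 'b::euclidean_space"
  assumes "L2 M f" "L2 M g"
  shows "integrable M (\<lambda>x. f x \<bullet> g x)"
proof (rule Bochner_Integration.integrable_bound)
  show "integrable M (\<lambda>x. (norm (f x))\<^sup>2 + (norm (g x))\<^sup>2)"
    using assms by (auto simp: L2_def)
  show "(\<lambda>x. f x \<bullet> g x) \<in> borel_measurable M"
    using assms[THEN L2_measurable] by measurable
  show "AE x in M. norm (f x \<bullet> g x) \<le> norm ((norm (f x))\<^sup>2 + (norm (g x))\<^sup>2)"
  proof (rule AE_I2)
    fix x
    have "\<bar>f x \<bullet> g x\<bar> \<le> norm (f x) * norm (g x)" by (rule Cauchy_Schwarz_ineq2)
    also have "\<dots> \<le> (norm (f x))\<^sup>2 + (norm (g x))\<^sup>2"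
      using sum_squares_bound[of "norm (f x)" "norm (g x)"]
        mult_nonneg_nonneg[OF norm_ge_zero[of "f x"] norm_ge_zero[of "g x"]]
      by linarith
    finally show "norm (f x \<bullet> g x) \<le> norm ((norm (f x))\<^sup>2 + (norm (g x))\<^sup>2)" by simp
  qed
qed

lemma norm_add_scaleR_sq:
  fixes a b :: "'b::real_inner"
  shows "(norm (a + c *\<^sub>R b))\<^sup>2 = (norm a)\<^sup>2 + 2 * c * (a \<bullet> b) + c\<^sup>2 * (norm b)\<^sup>2"
  unfolding power2_norm_eq_inner
  by (simp add: inner_add_left inner_add_right inner_commute[of b a] power2_eq_square algebra_simps)

lemma
  fixes f g :: "'a \<Rightarrow> 'b::euclidean_space"
  assumes f: "L2 M f" and g: "L2 M g"
  shows L2_add_scaleR: "L2 M (\<lambda>x. f x + c *\<^sub>R g x)"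
    and nsq_add_scaleR: "nsq M (\<lambda>x. f x + c *\<^sub>R g x) = nsq M f + 2 * c * ip M f g + c\<^sup>2 * nsq M g"
proof -
  note m = f[THEN L2_measurable] g[THEN L2_measurable]
  have i: "integrable M (\<lambda>x. (norm (f x))\<^sup>2)" "integrable M (\<lambda>x. (norm (g x))\<^sup>2)"
    "integrable M (\<lambda>x. f x \<bullet> g x)"
    using f g L2_inner[OF f g] by (auto simp: L2_def)
  show "L2 M (\<lambda>x. f x + c *\<^sub>R g x)"
    unfolding L2_def norm_add_scaleR_sq using i m by auto
  show "nsq M (\<lambda>x. f x + c *\<^sub>R g x) = nsq M f + 2 * c * ip M f g + c\<^sup>2 * nsq M g"
    unfolding norm_add_scaleR_sq using i by simp
qed

lemma L2_zero [simp]: "L2 M (\<lambda>x. 0)"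
  by (simp add: L2_def)

lemma L2_scaleR: "L2 M f \<Longrightarrow> L2 M (\<lambda>x. c *\<^sub>R f x)"
  using L2_add_scaleR[OF L2_zero, of M f c] by simp

lemma L2_add: "L2 M f \<Longrightarrow> L2 M g \<Longrightarrow> L2 M (\<lambda>x. f x + g x)"
  using L2_add_scaleR[of M f g 1] by simp

lemma L2_diff: "L2 M f \<Longrightarrow> L2 M g \<Longrightarrow> L2 M (\<lambda>x. f x - g x)"
  using L2_add_scaleR[of M f g "-1"] by simp

lemma nsq_add: "L2 M f \<Longrightarrow> L2 M g \<Longrightarrow> nsq M (\<lambda>x. f x + g x) = nsq M f + 2 * ip M f g + nsq M g"
  using nsq_add_scaleR[of M f g 1] by simp

lemma nsq_diff: "L2 M f \<Longrightarrow> L2 M g \<Longrightarrow> nsq M (\<lambda>x. f x - g x) = nsq M f - 2 * ip M f g + nsq M g"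
  using nsq_add_scaleR[of M f g "-1"] by simp

lemma nsq_scaleR: "nsq M (\<lambda>x. c *\<^sub>R f x) = c\<^sup>2 * nsq M f"
  by (simp add: power_mult_distrib)

text \<open>A quadratic without constant term that is never negative is minimal at 0, so its slope
  there vanishes. In \<open>L2_dense\<close> this turns minimality of a norm into
  orthogonality.\<close>

lemma nonneg_quadratic_linear_part:
  fixes b c :: real
  assumes "\<And>t. 0 \<le> 2 * t * b + t\<^sup>2 * c"
  shows "b = 0"
proof (rule ccontr)
  assume "b \<noteq> 0"
  \<comment> \<open>A step against the sign of \<open>b\<close>. The denominator is positive for
    every \<open>c\<close> and makes the linear gain at least twice the quadratic cost.\<close>
  define t where "t = - b / (\<bar>c\<bar> + 1)"
  have c: "\<bar>c\<bar> + 1 > 0" by simp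
  have "t\<^sup>2 * c \<le> t\<^sup>2 * (\<bar>c\<bar> + 1)" by (intro mult_left_mono) auto
  also have "\<dots> = b\<^sup>2 / (\<bar>c\<bar> + 1)" using c by (simp add: t_def power2_eq_square)
  finally have "0 \<le> 2 * t * b + b\<^sup>2 / (\<bar>c\<bar> + 1)" using assms[of t] by linarith
  also have "\<dots> = - (b\<^sup>2 / (\<bar>c\<bar> + 1))" by (simp add: t_def power2_eq_square)
  finally show False using \<open>b \<noteq> 0\<close> c by (simp add: divide_le_0_iff)
qed

text \<open>The squared norm of f + c g is a nonnegative quadratic in c; for positive
  \<open>nsq M g\<close> it is evaluated at its minimizer.\<close>

lemma ip_Cauchy_Schwarz:
  assumes f: "L2 M f" and g: "L2 M g"
  shows "(ip M f g)\<^sup>2 \<le> nsq M f * nsq M g"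
proof -
  have q: "0 \<le> nsq M f + 2 * c * ip M f g + c\<^sup>2 * nsq M g" for c
    using nsq_nonneg[of M "\<lambda>x. f x + c *\<^sub>R g x"] nsq_add_scaleR[OF f g, of c] by linarith
  show ?thesis
  proof (cases "nsq M g = 0")
    case True
    have "ip M f g = 0"
    proof (rule ccontr)
      assume "ip M f g \<noteq> 0"
      \<comment> \<open>With \<open>nsq M g = 0\<close> the expression is affine in c, and a nonzero
        slope would let it reach the value -1.\<close>
      then have "nsq M f + 2 * (- (nsq M f + 1) / (2 * ip M f g)) * ip M f g = - 1"
        by (simp add: field_simps)
      with q[of "- (nsq M f + 1) / (2 * ip M f g)"] True show False by simp
    qed
    with True show ?thesis by simp
  next
    case False
    then have g0: "nsq M g > 0" using nsq_nonneg[of M g] by linarith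
    have "0 \<le> nsq M g * (nsq M f + 2 * (- ip M f g / nsq M g) * ip M f g + (- ip M f g / nsq M g)\<^sup>2 * nsq M g)"
      by (rule mult_nonneg_nonneg[OF less_imp_le[OF g0] q])
    also have "\<dots> = nsq M f * nsq M g - (ip M f g)\<^sup>2"
      using g0 by (simp add: field_simps power2_eq_square)
    finally show ?thesis by simp
  qed
qed

lemma ip_abs_le: "L2 M f \<Longrightarrow> L2 M g \<Longrightarrow> \<bar>ip M f g\<bar> \<le> sqrt (nsq M f) * sqrt (nsq M g)"
  using ip_Cauchy_Schwarz[of M f g] by (metis real_sqrt_le_mono real_sqrt_abs real_sqrt_mult)

lemma nsq_add_le:
  assumes f: "L2 M f" and g: "L2 M g"
  shows "nsq M (\<lambda>x. f x + g x) \<le> 2 * nsq M f + 2 * nsq M g"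
  using nsq_add[OF f g] nsq_diff[OF f g] nsq_nonneg[of M "\<lambda>x. f x - g x"] by linarith

lemma tendsto_ip_left:
  assumes "\<And>n. L2 M (F n)" "L2 M f" "L2 M g" "(\<lambda>n. nsq M (\<lambda>x. F n x - f x)) \<longlonglongrightarrow> 0"
  shows "(\<lambda>n. ip M (F n) g) \<longlonglongrightarrow> ip M f g"
proof (rule LIM_zero_cancel, rule tendsto_rabs_zero_cancel, rule tendsto_sandwich[OF _ _ tendsto_const])
  show "(\<lambda>n. sqrt (nsq M (\<lambda>x. F n x - f x)) * sqrt (nsq M g)) \<longlonglongrightarrow> 0"
    by (rule tendsto_eq_intros assms refl | simp)+
  have "\<bar>ip M (F n) g - ip M f g\<bar> \<le> sqrt (nsq M (\<lambda>x. F n x - f x)) * sqrt (nsq M g)" for n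
  proof -
    have "ip M (F n) g - ip M f g = ip M (\<lambda>x. F n x - f x) g"
      using L2_inner[OF assms(1,3), of n] L2_inner[OF assms(2,3)] by (simp add: inner_diff_left)
    then show ?thesis using ip_abs_le[OF L2_diff[OF assms(1,2)] assms(3)] by simp
  qed
  then show "\<forall>\<^sub>F n in sequentially. \<bar>ip M (F n) g - ip M f g\<bar> \<le> sqrt (nsq M (\<lambda>x. F n x - f x)) * sqrt (nsq M g)"
    by simp
qed auto

lemma tendsto_nsq:
  assumes "\<And>n. L2 M (F n)" "L2 M f" "(\<lambda>n. nsq M (\<lambda>x. F n x - f x)) \<longlonglongrightarrow> 0"
  shows "(\<lambda>n. nsq M (F n)) \<longlonglongrightarrow> nsq M f"
proof -
  have "nsq M (F n) = 2 * ip M (F n) f + nsq M (\<lambda>x. F n x - f x) - nsq M f" for n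
    using nsq_diff[OF assms(1,2), of n] by simp
  moreover have "(\<lambda>n. 2 * ip M (F n) f + nsq M (\<lambda>x. F n x - f x) - nsq M f) \<longlonglongrightarrow> 2 * ip M f f + 0 - nsq M f"
    by (intro tendsto_intros tendsto_ip_left assms)
  ultimately show ?thesis by (simp add: power2_norm_eq_inner)
qed

section \<open>Completeness of L2\<close>

lemma nsq_eq_nn_integral:
  "L2 M f \<Longrightarrow> (\<integral>\<^sup>+x. ennreal ((norm (f x))\<^sup>2) \<partial>M) = ennreal (nsq M f)"
  by (rule nn_integral_eq_integral) (auto simp: L2_def)

text \<open>One extended integral estimate yields both integrability and the bound, so Fatou's lemma
  and Tonelli's theorem can be used before integrability is known.\<close>

lemma L2_nn_integralI:
  assumes [measurable]: "f \<in> borel_measurable M" and le: "(\<integral>\<^sup>+x. ennreal ((norm (f x))\<^sup>2) \<partial>M) \<le> ennreal C" and "C \<ge> 0"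
  shows "L2 M f" "nsq M f \<le> C"
proof -
  have "integrable M (\<lambda>x. (norm (f x))\<^sup>2)"
    using le by (intro integrableI_nonneg) (auto simp: le_less_trans)
  then show *: "L2 M f" by (simp add: L2_def)
  from le show "nsq M f \<le> C"
    unfolding nsq_eq_nn_integral[OF *] using \<open>C \<ge> 0\<close> by simp
qed

text \<open>Riesz-Fischer: a rapidly Cauchy subsequence converges almost everywhere, and Fatou's
  lemma carries the Cauchy estimate over to its pointwise limit.\<close>

lemma L2_complete:
  fixes F :: "nat \<Rightarrow> 'a \<Rightarrow> 'b::euclidean_space"
  assumes F: "\<And>n. L2 M (F n)"
    and Cauchy: "\<And>e. e > 0 \<Longrightarrow> \<exists>N. \<forall>m\<ge>N. \<forall>n\<ge>N. nsq M (\<lambda>x. F m x - F n x) \<le> e"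
  obtains f where "L2 M f" "(\<lambda>n. nsq M (\<lambda>x. F n x - f x)) \<longlonglongrightarrow> 0"
proof -
  note [measurable] = F[THEN L2_measurable]
  have "\<exists>N. \<forall>m\<ge>N. \<forall>n\<ge>N. nsq M (\<lambda>x. F m x - F n x) \<le> (1/8)^k" for k :: nat
    by (rule Cauchy) simp
  then obtain N where N: "\<And>k m n. m \<ge> N k \<Longrightarrow> n \<ge> N k \<Longrightarrow> nsq M (\<lambda>x. F m x - F n x) \<le> (1/8)^k"
    by metis
  \<comment> \<open>Summing the \<open>N i\<close> dominates each of them, and adding
    \<open>k\<close> makes the indices strictly increasing.\<close>
  define r where "r k = k + (\<Sum>i\<le>k. N i)" for k
  have rN: "r k \<ge> N k" for k
    using member_le_sum[of k "{..k}" N] by (simp add: r_def)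
  have r_mono: "r k < r (Suc k)" for k by (simp add: r_def)
  have r_ge: "r k \<ge> k" for k by (simp add: r_def)
  have r_le: "r 0 \<le> r k" for k using member_le_sum[of 0 "{..k}" N] by (simp add: r_def)
  define D where "D k x = norm (F (r (Suc k)) x - F (r k) x)" for k x
  have [measurable]: "D k \<in> borel_measurable M" for k unfolding D_def by measurable
  have "nsq M (\<lambda>x. F (r (Suc k)) x - F (r k) x) \<le> (1/8)^k" for k
    by (rule N) (use rN[of k] r_mono[of k] in auto)
  then have D: "(\<integral>\<^sup>+x. ennreal ((D k x)\<^sup>2) \<partial>M) \<le> ennreal ((1/8)^k)" for k
    unfolding D_def using nsq_eq_nn_integral[OF L2_diff[OF F F], of "r (Suc k)" "r k"]
    by (simp add: ennreal_leI)
  \<comment> \<open>The weight 4^k is chosen between two needs: against the bound (1/8)^k the series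
    still converges, and boundedness of its terms gives the geometric decay (1/2)^k of
    \<open>D k x\<close> at almost every point.\<close>
  have "(\<integral>\<^sup>+x. (\<Sum>k. ennreal (4^k * (D k x)\<^sup>2)) \<partial>M) = (\<Sum>k. (\<integral>\<^sup>+x. ennreal (4^k * (D k x)\<^sup>2) \<partial>M))"
    by (rule nn_integral_suminf) measurable
  also have "\<dots> \<le> (\<Sum>k. ennreal ((1/2)^k))"
  proof (rule suminf_le)
    fix k
    have "(\<integral>\<^sup>+x. ennreal (4^k * (D k x)\<^sup>2) \<partial>M) = ennreal (4^k) * (\<integral>\<^sup>+x. ennreal ((D k x)\<^sup>2) \<partial>M)"
      by (simp add: ennreal_mult nn_integral_cmult)
    also have "\<dots> \<le> ennreal (4^k) * ennreal ((1/8)^k)"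
      by (intro mult_left_mono D) simp
    also have "\<dots> = ennreal ((1/2)^k)"
      by (simp add: ennreal_mult[symmetric] power_mult_distrib[symmetric])
    finally show "(\<integral>\<^sup>+x. ennreal (4^k * (D k x)\<^sup>2) \<partial>M) \<le> ennreal ((1/2)^k)" .
  qed auto
  also have "\<dots> = ennreal (\<Sum>k. (1/2)^k)"
    by (rule suminf_ennreal2) (auto intro: summable_geometric)
  finally have "(\<integral>\<^sup>+x. (\<Sum>k. ennreal (4^k * (D k x)\<^sup>2)) \<partial>M) \<noteq> \<infinity>"
    by (auto simp: top_unique)
  then have "AE x in M. (\<Sum>k. ennreal (4^k * (D k x)\<^sup>2)) \<noteq> \<infinity>"
    by (intro nn_integral_PInf_AE) measurable
  then have conv: "AE x in M. convergent (\<lambda>k. F (r k) x)"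
  proof eventually_elim
    case (elim x)
    have s: "summable (\<lambda>k. 4^k * (D k x)\<^sup>2)"
      by (rule summable_suminf_not_top) (use elim in auto)
    then have "Bseq (\<lambda>k. 4^k * (D k x)\<^sup>2)"
      using convergent_imp_Bseq summable_LIMSEQ_zero convergentI by blast
    then obtain c where c: "c > 0" "\<And>k. norm (4^k * (D k x)\<^sup>2) \<le> c"
      by (auto elim: BseqE)
    have "D k x \<le> sqrt c * (1/2)^k" for k
    proof -
      have "(2^k * D k x)\<^sup>2 = 4^k * (D k x)\<^sup>2"
        using power_mult[of "2::real" 2 k] power_even_eq[of "2::real" k] by (simp add: power_mult_distrib)
      then have "(2^k * D k x)\<^sup>2 \<le> c" using c(2)[of k] by simp
      then have "2^k * D k x \<le> sqrt c" by (rule real_le_rsqrt)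
      then show ?thesis by (simp add: field_simps)
    qed
    then have "summable (\<lambda>k. D k x)"
      by (intro summable_comparison_test[OF exI[of _ 0] summable_mult[OF summable_geometric[of "1/2::real"]], of _ "sqrt c"])
        (auto simp: D_def)
    then have "summable (\<lambda>k. F (r (Suc k)) x - F (r k) x)"
      unfolding D_def by (rule summable_norm_cancel)
    then have "convergent (\<lambda>n. \<Sum>k<n. F (r (Suc k)) x - F (r k) x)"
      by (simp add: summable_iff_convergent)
    then have "convergent (\<lambda>n. F (r n) x - F (r 0) x)"
      by (simp only: sum_lessThan_telescope[of "\<lambda>k. F (r k) x"])
    from convergent_add[OF this convergent_const[of "F (r 0) x"]]
    have "convergent (\<lambda>n. (F (r n) x - F (r 0) x) + F (r 0) x)" .
    then show ?case by simp
  qed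
  define f where "f x = lim (\<lambda>k. F (r k) x)" for x
  have fm [measurable]: "f \<in> borel_measurable M" unfolding f_def by measurable
  have lim: "AE x in M. (\<lambda>k. F (r k) x) \<longlonglongrightarrow> f x"
    using conv by eventually_elim (simp add: f_def convergent_LIMSEQ_iff)
  \<comment> \<open>Fatou's lemma in \<open>k\<close> with \<open>n\<close> fixed. It is used twice:
    with bound 1 to see that the limit lies in \<open>L2\<close>, and with small bounds for
    convergence.\<close>
  have key: "L2 M (\<lambda>x. F n x - f x) \<and> nsq M (\<lambda>x. F n x - f x) \<le> e"
    if "\<And>k. k \<ge> K \<Longrightarrow> nsq M (\<lambda>x. F n x - F (r k) x) \<le> e" "e \<ge> 0" for n e K
  proof -
    have "(\<integral>\<^sup>+x. ennreal ((norm (F n x - f x))\<^sup>2) \<partial>M)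
        = (\<integral>\<^sup>+x. liminf (\<lambda>k. ennreal ((norm (F n x - F (r k) x))\<^sup>2)) \<partial>M)"
    proof (rule nn_integral_cong_AE, use lim in eventually_elim)
      case (elim x)
      have "(\<lambda>k. ennreal ((norm (F n x - F (r k) x))\<^sup>2)) \<longlonglongrightarrow> ennreal ((norm (F n x - f x))\<^sup>2)"
        by (intro tendsto_ennrealI tendsto_intros elim)
      from lim_imp_Liminf[OF sequentially_bot this] show ?case by (rule sym)
    qed
    also have "\<dots> \<le> liminf (\<lambda>k. \<integral>\<^sup>+x. ennreal ((norm (F n x - F (r k) x))\<^sup>2) \<partial>M)"
      by (rule nn_integral_liminf) measurable
    also have "\<dots> \<le> limsup (\<lambda>k. \<integral>\<^sup>+x. ennreal ((norm (F n x - F (r k) x))\<^sup>2) \<partial>M)"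
      by (rule Liminf_le_Limsup) simp
    also have "\<dots> \<le> ennreal e"
    proof (rule Limsup_bounded)
      show "\<forall>\<^sub>F k in sequentially. (\<integral>\<^sup>+x. ennreal ((norm (F n x - F (r k) x))\<^sup>2) \<partial>M) \<le> ennreal e"
        using eventually_ge_at_top[of K]
        by eventually_elim (simp only: nsq_eq_nn_integral[OF L2_diff[OF F F]] ennreal_leI that)
    qed
    finally show ?thesis
      using L2_nn_integralI[of "\<lambda>x. F n x - f x" M e] \<open>e \<ge> 0\<close> by simp
  qed
  have "L2 M (\<lambda>x. F (N 0) x - f x)"
    using key[of 0 "N 0" 1] rN[of 0] r_le N[of 0 "N 0"] order_trans[OF rN[of 0] r_le] by auto
  from L2_diff[OF F[of "N 0"] this] have "L2 M f" by simp
  moreover have "(\<lambda>n. nsq M (\<lambda>x. F n x - f x)) \<longlonglongrightarrow> 0"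
  proof (rule LIMSEQ_I)
    fix e :: real assume "e > 0"
    then obtain K where K: "\<forall>m\<ge>K. \<forall>n\<ge>K. nsq M (\<lambda>x. F m x - F n x) \<le> e/2"
      using Cauchy[of "e/2"] by auto
    have "nsq M (\<lambda>x. F n x - f x) \<le> e/2" if "n \<ge> K" for n
    proof -
      have "nsq M (\<lambda>x. F n x - F (r k) x) \<le> e/2" if "k \<ge> K" for k
        using K \<open>n \<ge> K\<close> order_trans[OF that r_ge] by blast
      then show ?thesis using key[of K n "e/2"] \<open>e > 0\<close> by simp
    qed
    then have "nsq M (\<lambda>x. F n x - f x) < e" if "n \<ge> K" for n
      using \<open>e > 0\<close> that by fastforce
    then show "\<exists>K. \<forall>n\<ge>K. norm (nsq M (\<lambda>x. F n x - f x) - 0) < e"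
      by (intro exI[of _ K]) simp
  qed
  ultimately show ?thesis by (rule that)
qed

section \<open>Projection, density and weak compactness\<close>

lemma nsq_parallelogram:
  assumes f: "L2 M f" and g: "L2 M g"
  shows "nsq M (\<lambda>x. f x - g x) = 2 * nsq M f + 2 * nsq M g - 4 * nsq M (\<lambda>x. (1/2) *\<^sub>R (f x + g x))"
proof -
  have "nsq M (\<lambda>x. (1/2) *\<^sub>R (f x + g x)) = nsq M (\<lambda>x. f x + g x) / 4"
    unfolding nsq_scaleR by (simp add: power2_eq_square)
  with nsq_add[OF f g] nsq_diff[OF f g] show ?thesis by linarith
qed

text \<open>Near-minimal elements form a Cauchy sequence: the minimal values \<open>d n\<close>
  increase to a limit, and the parallelogram law bounds the distance of two elements by their excess
  over the value at the midpoint. A constant family gives an orthogonal projection; a decreasing one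
  gives the strong limit needed for weak compactness.\<close>

lemma L2_nested_midpoint_convex:
  fixes K :: "nat \<Rightarrow> ('a \<Rightarrow> 'b::euclidean_space) set"
  assumes anti: "\<And>m n. m \<le> n \<Longrightarrow> K n \<subseteq> K m"
    and L2: "\<And>n F. F \<in> K n \<Longrightarrow> L2 M F"
    and mid: "\<And>n F G. F \<in> K n \<Longrightarrow> G \<in> K n \<Longrightarrow> (\<lambda>x. (1/2) *\<^sub>R (F x + G x)) \<in> K n"
    and bound: "\<And>n. \<exists>F\<in>K n. nsq M F \<le> C"
  obtains W f where "\<And>n. W n \<in> K n" "L2 M f" "(\<lambda>n. nsq M (\<lambda>x. W n x - f x)) \<longlonglongrightarrow> 0"
    "\<And>G. (\<And>n. G \<in> K n) \<Longrightarrow> nsq M f \<le> nsq M G"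
proof -
  define d where "d n = (INF F\<in>K n. nsq M F)" for n
  have ne: "K n \<noteq> {}" for n using bound by blast
  have bdd: "bdd_below (nsq M ` K n)" for n by (rule bdd_belowI[of _ 0]) auto
  have d_le: "d n \<le> nsq M F" if "F \<in> K n" for n F
    unfolding d_def by (rule cINF_lower[OF bdd that])
  have "d m \<le> d n" if "m \<le> n" for m n
    unfolding d_def by (rule cINF_superset_mono[OF ne bdd anti[OF that]]) simp
  then have "incseq d" by (rule monoI)
  moreover have "d n \<le> C" for n
    using bound[of n] d_le by (meson order_trans)
  ultimately obtain l where l: "d \<longlonglongrightarrow> l" "\<And>n. d n \<le> l"
    using incseq_convergent[of d C] by auto
  have "\<exists>F\<in>K n. nsq M F < d n + 1 / real (Suc n)" for n
    using cINF_less_iff[OF ne bdd, of n "d n + 1 / real (Suc n)"] unfolding d_def by simp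
  then obtain W where W: "\<And>n. W n \<in> K n" "\<And>n. nsq M (W n) < d n + 1 / real (Suc n)"
    by metis
  note WL = L2[OF W(1)]
  \<comment> \<open>Both norms are below l + 1/(k + 1) and the midpoint lies in \<open>K k\<close>,
    so the parallelogram law leaves four times the gap to \<open>d k\<close> plus the slack.\<close>
  have dist: "nsq M (\<lambda>x. W m x - W n x) \<le> 4 * (l - d k) + 4 * (1 / real (Suc k))" if "k \<le> m" "k \<le> n" for k m n
  proof -
    have "d k \<le> nsq M (\<lambda>x. (1/2) *\<^sub>R (W m x + W n x))"
      using W(1)[of m] W(1)[of n] anti that by (intro d_le mid) auto
    moreover have "1 / real (Suc m) \<le> 1 / real (Suc k)" "1 / real (Suc n) \<le> 1 / real (Suc k)"
      using that by (auto intro!: divide_left_mono)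
    moreover have "d m \<le> l" "d n \<le> l" by (rule l(2))+
    ultimately show ?thesis
      using nsq_parallelogram[OF WL WL, of m n] W(2)[of m] W(2)[of n]
      by argo
  qed
  have lim0: "(\<lambda>k. 4 * (l - d k) + 4 * (1 / real (Suc k))) \<longlonglongrightarrow> 4 * (l - l) + 4 * 0"
    by (intro tendsto_intros l lim_1_over_n[THEN LIMSEQ_Suc])
  have "\<exists>N. \<forall>m\<ge>N. \<forall>n\<ge>N. nsq M (\<lambda>x. W m x - W n x) \<le> e" if "e > 0" for e
  proof -
    have "\<forall>\<^sub>F k in sequentially. 4 * (l - d k) + 4 * (1 / real (Suc k)) < e"
      using order_tendstoD(2)[OF lim0, of e] that by simp
    then obtain k where "4 * (l - d k) + 4 * (1 / real (Suc k)) < e"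
      by (auto dest!: eventually_happens)
    then show ?thesis using dist[of k] by (meson less_imp_le order_trans)
  qed
  from L2_complete[of M W, OF WL this] obtain f where
    f: "L2 M f" "(\<lambda>n. nsq M (\<lambda>x. W n x - f x)) \<longlonglongrightarrow> 0" .
  show ?thesis
  proof (rule that[OF W(1) f])
    fix G assume G: "\<And>n. G \<in> K n"
    have "(\<lambda>n. nsq M G + 1 / real (Suc n)) \<longlonglongrightarrow> nsq M G + 0"
      by (intro tendsto_intros lim_1_over_n[THEN LIMSEQ_Suc])
    moreover have "nsq M (W n) \<le> nsq M G + 1 / real (Suc n)" for n
      using W(2)[of n] d_le[OF G, of n] by linarith
    ultimately show "nsq M f \<le> nsq M G"
      using LIMSEQ_le[OF tendsto_nsq[of M W, OF WL f]] by auto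
  qed
qed

text \<open>The residuals g - \<phi> with \<phi> in \<open>D\<close> form a midpoint convex set. The
  limit of a minimizing sequence in it is orthogonal to \<open>D\<close>, hence zero, so residuals
  get arbitrarily small.\<close>

lemma L2_dense:
  fixes D :: "('a \<Rightarrow> 'b::euclidean_space) set"
  assumes L2: "\<And>\<phi>. \<phi> \<in> D \<Longrightarrow> L2 M \<phi>" and zero: "(\<lambda>x. 0) \<in> D"
    and lin: "\<And>\<phi> \<psi> c. \<phi> \<in> D \<Longrightarrow> \<psi> \<in> D \<Longrightarrow> (\<lambda>x. \<phi> x + c *\<^sub>R \<psi> x) \<in> D"
    and orth: "\<And>g. L2 M g \<Longrightarrow> (\<And>\<phi>. \<phi> \<in> D \<Longrightarrow> ip M g \<phi> = 0) \<Longrightarrow> nsq M g = 0"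
    and g: "L2 M g" and e: "e > 0"
  obtains \<phi> where "\<phi> \<in> D" "nsq M (\<lambda>x. g x - \<phi> x) < e"
proof -
  define K where "K = {(\<lambda>x. g x - \<phi> x) | \<phi>. \<phi> \<in> D}"
  have KI: "F \<in> K" if "(\<lambda>x. g x - F x) \<in> D" for F
    unfolding K_def using that by (intro CollectI exI[of _ "\<lambda>x. g x - F x"]) auto
  have sc: "(\<lambda>x. c *\<^sub>R \<phi> x) \<in> D" if "\<phi> \<in> D" for c \<phi>
    using lin[OF zero that, of c] by simp
  have add: "(\<lambda>x. F x + c *\<^sub>R \<phi> x) \<in> K" if F: "F \<in> K" and "\<phi> \<in> D" for F c \<phi>
  proof -
    from F obtain \<psi> where \<psi>: "\<psi> \<in> D" "F = (\<lambda>x. g x - \<psi> x)" by (auto simp: K_def)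
    have "(\<lambda>x. \<psi> x + (- c) *\<^sub>R \<phi> x) \<in> D" by (rule lin) fact+
    then show ?thesis by (intro KI) (simp add: \<psi>(2) algebra_simps)
  qed
  have KL: "L2 M F" if "F \<in> K" for F
    using that g L2 by (auto simp: K_def intro: L2_diff)
  have mid: "(\<lambda>x. (1/2) *\<^sub>R (F x + G x)) \<in> K" if F: "F \<in> K" and G: "G \<in> K" for F G
  proof -
    from F G obtain \<phi> \<psi> where *: "\<phi> \<in> D" "F = (\<lambda>x. g x - \<phi> x)" "\<psi> \<in> D" "G = (\<lambda>x. g x - \<psi> x)"
      by (auto simp: K_def)
    have "(\<lambda>x. (1/2) *\<^sub>R \<phi> x + (1/2) *\<^sub>R \<psi> x) \<in> D" by (intro lin sc *)
    moreover have "g x - (1/2) *\<^sub>R (F x + G x) = (1/2) *\<^sub>R \<phi> x + (1/2) *\<^sub>R \<psi> x" for x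
    proof -
      have "(1/2) *\<^sub>R (F x + G x) = (1/2) *\<^sub>R g x + (1/2) *\<^sub>R g x - ((1/2) *\<^sub>R \<phi> x + (1/2) *\<^sub>R \<psi> x)"
        by (simp add: * algebra_simps)
      also have "(1/2) *\<^sub>R g x + (1/2) *\<^sub>R g x = g x" by (simp flip: scaleR_add_left)
      finally show ?thesis by simp
    qed
    ultimately show ?thesis by (intro KI) simp
  qed
  have "g \<in> K" by (rule KI) (simp add: zero)
  then have "\<exists>F\<in>K. nsq M F \<le> nsq M g" by blast
  obtain W f where W: "\<And>n::nat. W n \<in> K" and f: "L2 M f"
    and lim: "(\<lambda>n. nsq M (\<lambda>x. W n x - f x)) \<longlonglongrightarrow> 0"
    and min': "\<And>G. (\<And>n::nat. G \<in> K) \<Longrightarrow> nsq M f \<le> nsq M G"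
    by (rule L2_nested_midpoint_convex[of "\<lambda>_. K" M "nsq M g"])
      (use KL mid \<open>\<exists>F\<in>K. nsq M F \<le> nsq M g\<close> in auto)
  have min: "nsq M f \<le> nsq M G" if "G \<in> K" for G by (rule min') (rule that)
  \<comment> \<open>\<open>D\<close> is not assumed closed, so \<open>f\<close> need not be a
    residual. The perturbation is therefore applied to \<open>W n\<close>, and minimality passes to
    the limit.\<close>
  have "ip M f \<phi> = 0" if \<phi>: "\<phi> \<in> D" for \<phi>
  proof (rule nonneg_quadratic_linear_part)
    fix t
    have W': "L2 M (\<lambda>x. W n x + t *\<^sub>R \<phi> x)" for n by (intro KL add W \<phi>)
    have "(\<lambda>n. nsq M (\<lambda>x. W n x + t *\<^sub>R \<phi> x)) \<longlonglongrightarrow> nsq M (\<lambda>x. f x + t *\<^sub>R \<phi> x)"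
      by (rule tendsto_nsq[OF W' L2_add_scaleR[OF f L2[OF \<phi>]]]) (use lim in simp)
    then have "nsq M f \<le> nsq M (\<lambda>x. f x + t *\<^sub>R \<phi> x)"
      by (rule LIMSEQ_le_const) (use min add W \<phi> in blast)
    then show "0 \<le> 2 * t * ip M f \<phi> + t\<^sup>2 * nsq M \<phi>"
      unfolding nsq_add_scaleR[OF f L2[OF \<phi>]] by simp
  qed
  then have "nsq M f = 0" using orth f by blast
  then have "(\<lambda>n. nsq M (W n)) \<longlonglongrightarrow> 0"
    using tendsto_nsq[of M W, OF KL[OF W] f lim] by simp
  then have "\<forall>\<^sub>F n in sequentially. nsq M (W n) < e"
    using e by (simp add: order_tendstoD(2))
  then obtain n where n: "nsq M (W n) < e" by (auto dest!: eventually_happens)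
  obtain \<phi> where "\<phi> \<in> D" "W n = (\<lambda>x. g x - \<phi> x)" using W[of n] by (auto simp: K_def)
  with n show ?thesis by (intro that[of \<phi>]) simp_all
qed

lemma ip_diff_left: "L2 M f \<Longrightarrow> L2 M g \<Longrightarrow> L2 M h \<Longrightarrow> ip M (\<lambda>x. f x - g x) h = ip M f h - ip M g h"
  using L2_inner[of M f h] L2_inner[of M g h] by (simp add: inner_diff_left)

lemma ip_add_right: "L2 M f \<Longrightarrow> L2 M g \<Longrightarrow> L2 M h \<Longrightarrow> ip M f (\<lambda>x. g x + c *\<^sub>R h x) = ip M f g + c * ip M f h"
  using L2_inner[of M f h] L2_inner[of M f g] by (simp add: inner_add_right)

text \<open>Diagonal extraction makes the pairings with the countable family \<open>Z\<close>
  converge, and density extends this to all of L2. The function representing the limit functional is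
  then found as a strong limit of elements \<open>W n\<close>, each obeying every linear bound that
  holds on the tail of the sequence from \<open>n\<close> on.\<close>

theorem L2_weakly_sequentially_compact:
  fixes F :: "nat \<Rightarrow> 'a \<Rightarrow> 'b::euclidean_space" and Z :: "nat \<Rightarrow> 'a \<Rightarrow> 'b"
  assumes F: "\<And>n. L2 M (F n)" and C: "\<And>n. nsq M (F n) \<le> C"
    and Z: "\<And>i. L2 M (Z i)"
    and sep: "\<And>g. L2 M g \<Longrightarrow> (\<And>i. ip M g (Z i) = 0) \<Longrightarrow> nsq M g = 0"
  obtains r f where "strict_mono r" "L2 M f" "\<And>g. L2 M g \<Longrightarrow> (\<lambda>n. ip M (F (r n)) g) \<longlonglongrightarrow> ip M f g"
proof -
  have C0: "C \<ge> 0" using C[of 0] nsq_nonneg[of M "F 0"] by linarith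
  have bnd: "\<bar>ip M (F n) g\<bar> \<le> sqrt C * sqrt (nsq M g)" if "L2 M g" for n g
    by (rule order_trans[OF ip_abs_le[OF F that] mult_right_mono[OF real_sqrt_le_mono[OF C]]]) simp
  interpret subseqs "\<lambda>i s. convergent (\<lambda>n. ip M (F (s n)) (Z i))"
  proof
    fix i and s :: "nat \<Rightarrow> nat"
    have "bounded (range (\<lambda>n. ip M (F (s n)) (Z i)))"
      unfolding bounded_iff using bnd[OF Z] by auto
    from bounded_imp_convergent_subsequence[OF this]
    show "\<exists>r'. strict_mono r' \<and> convergent (\<lambda>n. ip M (F ((s \<circ> r') n)) (Z i))"
      by (auto simp: o_def convergent_def)
  qed
  define r where "r = diagseq"
  have r: "strict_mono r" unfolding r_def by (rule subseq_diagseq)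
  have convZ: "convergent (\<lambda>n. ip M (F (r n)) (Z i))" for i
  proof -
    have "convergent (\<lambda>n. ip M (F ((diagseq \<circ> ((+) (Suc i))) n)) (Z i))"
    proof (rule diagseq_holds)
      fix q s :: "nat \<Rightarrow> nat" and n
      assume "strict_mono q" "convergent (\<lambda>k. ip M (F (s k)) (Z n))"
      from convergent_subseq_convergent[OF this(2,1)]
      show "convergent (\<lambda>k. ip M (F ((s \<circ> q) k)) (Z n))" by (simp add: o_def)
    qed
    then show ?thesis
      using convergent_ignore_initial_segment[of "\<lambda>n. ip M (F (diagseq n)) (Z i)" "Suc i"]
      by (simp only: r_def o_def add.commute[of "Suc i"])
  qed
  \<comment> \<open>A linear space containing every \<open>Z i\<close>, so the separation hypothesis
    makes it dense.\<close>
  define D where "D = {g. L2 M g \<and> convergent (\<lambda>n. ip M (F (r n)) g)}"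
  have conv: "convergent (\<lambda>n. ip M (F (r n)) g)" if g: "L2 M g" for g
  proof (rule Cauchy_convergent, rule CauchyI)
    fix e :: real assume "e > 0"
    \<comment> \<open>Chosen so that \<open>sqrt C * sqrt e'\<close> is at most e/4; the added 1
      keeps the denominator positive for C = 0.\<close>
    define e' where "e' = (e / (4 * (sqrt C + 1)))\<^sup>2"
    have sC: "sqrt C \<ge> 0" using C0 by simp
    have "sqrt C + 1 > 0" using sC by linarith
    then have "e / (4 * (sqrt C + 1)) > 0" using \<open>e > 0\<close> by simp
    then have "e' > 0" unfolding e'_def by (rule zero_less_power)
    have Dorth: "nsq M g = 0" if "L2 M g" and "\<And>\<phi>. \<phi> \<in> D \<Longrightarrow> ip M g \<phi> = 0" for g
    proof (rule sep[OF that(1)])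
      fix i show "ip M g (Z i) = 0" by (rule that(2)) (simp add: D_def Z convZ)
    qed
    have Dlin: "(\<lambda>x. \<phi> x + c *\<^sub>R \<psi> x) \<in> D" if "\<phi> \<in> D" "\<psi> \<in> D" for \<phi> \<psi> c
    proof -
      have \<phi>: "L2 M \<phi>" "convergent (\<lambda>n. ip M (F (r n)) \<phi>)"
        and \<psi>: "L2 M \<psi>" "convergent (\<lambda>n. ip M (F (r n)) \<psi>)"
        using that by (auto simp: D_def)
      have "convergent (\<lambda>n. ip M (F (r n)) \<phi> + c * ip M (F (r n)) \<psi>)"
        by (intro convergent_add convergent_mult convergent_const \<phi> \<psi>)
      then show ?thesis
        by (simp only: D_def mem_Collect_eq ip_add_right[OF F \<phi>(1) \<psi>(1)] L2_add_scaleR[OF \<phi>(1) \<psi>(1)])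
    qed
    have D0: "(\<lambda>x. 0) \<in> D" by (simp add: D_def convergent_const)
    have DL: "L2 M \<phi>" if "\<phi> \<in> D" for \<phi> using that by (simp add: D_def)
    obtain \<phi> where \<phi>: "\<phi> \<in> D" "nsq M (\<lambda>x. g x - \<phi> x) < e'"
      by (rule L2_dense[OF DL D0 Dlin Dorth g \<open>e' > 0\<close>])
    then have L: "L2 M \<phi>" and "convergent (\<lambda>n. ip M (F (r n)) \<phi>)" by (auto simp: D_def)
    then have "Cauchy (\<lambda>n. ip M (F (r n)) \<phi>)" by (simp add: Cauchy_convergent_iff)
    with \<open>e > 0\<close> obtain N where N: "\<And>m n. m \<ge> N \<Longrightarrow> n \<ge> N \<Longrightarrow> norm (ip M (F (r m)) \<phi> - ip M (F (r n)) \<phi>) < e/2"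
      using CauchyD[OF \<open>Cauchy (\<lambda>n. ip M (F (r n)) \<phi>)\<close>, of "e/2"] by auto
    have near: "\<bar>ip M (F n) g - ip M (F n) \<phi>\<bar> \<le> e/4" for n
    proof -
      have "ip M (F n) g - ip M (F n) \<phi> = ip M (F n) (\<lambda>x. g x - \<phi> x)"
        using ip_diff_left[OF g L F] by (simp add: inner_commute)
      then have "\<bar>ip M (F n) g - ip M (F n) \<phi>\<bar> \<le> sqrt C * sqrt (nsq M (\<lambda>x. g x - \<phi> x))"
        using bnd[OF L2_diff[OF g L]] by simp
      also have "\<dots> \<le> sqrt C * sqrt e'" using \<phi>(2) sC by (intro mult_left_mono) auto
      also have "\<dots> = sqrt C * (e / (4 * (sqrt C + 1)))" using \<open>e > 0\<close> sC by (simp add: e'_def)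
      also have "\<dots> \<le> (sqrt C + 1) * (e / (4 * (sqrt C + 1)))" using \<open>e > 0\<close> sC by (intro mult_right_mono) auto
      also have "\<dots> = e/4" 
      proof -
        have "s * (e / (4 * s)) = e / 4" if "s > 0" for s :: real using that by simp
        from this[OF \<open>sqrt C + 1 > 0\<close>] show ?thesis .
      qed
      finally show ?thesis .
    qed
    show "\<exists>N. \<forall>m\<ge>N. \<forall>n\<ge>N. norm (ip M (F (r m)) g - ip M (F (r n)) g) < e"
    proof (intro exI allI impI)
      fix m n assume "m \<ge> N" "n \<ge> N"
      with N[of m n] near[of "r m"] near[of "r n"] \<open>e > 0\<close>
      show "norm (ip M (F (r m)) g - ip M (F (r n)) g) < e" unfolding real_norm_def by linarith
    qed
  qed
  \<comment> \<open>The dual description of the closed convex hull of the tail avoids explicit convex combinations.\<close>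
  define K where "K n = {W. L2 M W \<and> (\<forall>g c. L2 M g \<longrightarrow> (\<forall>k\<ge>n. ip M (F (r k)) g \<le> c) \<longrightarrow> ip M W g \<le> c)}" for n
  have FK: "F (r n) \<in> K n" for n by (auto simp: K_def F)
  have "K n \<subseteq> K m" if "m \<le> n" for m n
  proof
    fix W assume W: "W \<in> K n"
    show "W \<in> K m" unfolding K_def
    proof (intro CollectI conjI allI impI)
      show "L2 M W" using W by (simp add: K_def)
      fix g c assume "L2 M g" "\<forall>k\<ge>m. ip M (F (r k)) g \<le> c"
      then show "ip M W g \<le> c" using W that unfolding K_def by simp
    qed
  qed
  moreover have "L2 M W" if "W \<in> K n" for n W using that by (simp add: K_def)
  moreover have "(\<lambda>x. (1/2) *\<^sub>R (V x + W x)) \<in> K n" if V: "V \<in> K n" and W: "W \<in> K n" for n V W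
    unfolding K_def
  proof (intro CollectI conjI allI impI)
    have L: "L2 M V" "L2 M W" using V W by (auto simp: K_def)
    then show "L2 M (\<lambda>x. (1/2) *\<^sub>R (V x + W x))" by (intro L2_scaleR L2_add)
    fix g c assume g: "L2 M g" and c: "\<forall>k\<ge>n. ip M (F (r k)) g \<le> c"
    have "ip M (\<lambda>x. (1/2) *\<^sub>R (V x + W x)) g = (ip M V g + ip M W g) / 2"
      using L2_inner[OF L(1) g] L2_inner[OF L(2) g] by (simp add: inner_add_left)
    moreover have "ip M V g \<le> c" "ip M W g \<le> c" using V W g c by (auto simp: K_def)
    ultimately show "ip M (\<lambda>x. (1/2) *\<^sub>R (V x + W x)) g \<le> c" by simp
  qed
  moreover have "\<exists>W\<in>K n. nsq M W \<le> C" for n using FK C by blast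
  ultimately have "\<exists>W f. (\<forall>n. W n \<in> K n) \<and> L2 M f \<and> (\<lambda>n. nsq M (\<lambda>x. W n x - f x)) \<longlonglongrightarrow> 0"
  proof (rule L2_nested_midpoint_convex[of K M C])
    fix W f assume "\<And>n. W n \<in> K n" "L2 M f" "(\<lambda>n. nsq M (\<lambda>x. W n x - f x)) \<longlonglongrightarrow> 0"
    then show ?thesis by (intro exI[of _ W] exI[of _ f]) simp
  qed
  then obtain W f where W: "\<And>n. W n \<in> K n" and f: "L2 M f"
    and lim: "(\<lambda>n. nsq M (\<lambda>x. W n x - f x)) \<longlonglongrightarrow> 0"
    by (elim exE conjE) (rule that, rule spec)
  have WL: "L2 M (W n)" for n using W[of n] by (simp add: K_def)
  \<comment> \<open>Membership of \<open>W n\<close> in \<open>K n\<close> transfers an eventual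
    upper bound on the pairings; strong convergence passes it to \<open>f\<close>.\<close>
  have le: "ip M f g \<le> l" if g: "L2 M g" and l: "(\<lambda>n. ip M (F (r n)) g) \<longlonglongrightarrow> l" for g l
  proof (rule field_le_epsilon)
    fix e :: real assume "e > 0"
    then obtain N where N: "\<And>k. k \<ge> N \<Longrightarrow> ip M (F (r k)) g < l + e"
      using order_tendstoD(2)[OF l, of "l + e"] by (auto simp: eventually_sequentially)
    have "ip M (W n) g \<le> l + e" if "n \<ge> N" for n
    proof -
      have "\<forall>k\<ge>n. ip M (F (r k)) g \<le> l + e"
        using N that by (meson less_imp_le order_trans)
      with W[of n] g show ?thesis by (simp add: K_def)
    qed
    then show "ip M f g \<le> l + e"
      by (intro LIMSEQ_le_const2[OF tendsto_ip_left[of M W, OF WL f g lim]]) blast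
  qed
  show ?thesis
  proof (rule that[OF r f])
    fix g :: "'a \<Rightarrow> 'b" assume g: "L2 M g"
    from conv[OF g] obtain l where l: "(\<lambda>n. ip M (F (r n)) g) \<longlonglongrightarrow> l" by (auto simp: convergent_def)
    \<comment> \<open>The one-sided bound applied to the negative of \<open>g\<close> is the missing
      lower bound.\<close>
    have "(\<lambda>n. ip M (F (r n)) (\<lambda>x. - g x)) \<longlonglongrightarrow> - l" using tendsto_minus[OF l] by simp
    from le[OF _ this] have "l \<le> ip M f g" using L2_scaleR[OF g, of "-1"] by simp
    with le[OF g l] l show "(\<lambda>n. ip M (F (r n)) g) \<longlonglongrightarrow> ip M f g" by simp
  qed
qed

section \<open>Test functions\<close>

lemma Ck_SucI:
  assumes "\<And>x. (f has_derivative D x) (at x)" "\<And>b. b \<in> Basis \<Longrightarrow> Ck k (\<lambda>x. D x b)"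
  shows "Ck (Suc k) f"
proof -
  have "frechet_derivative f (at x) = D x" for x
    using frechet_derivative_at[OF assms(1)] by simp
  with assms show ?thesis
    by (auto simp: differentiable_on_def differentiable_def)
qed

lemma Ck_Suc_has_derivative:
  "Ck (Suc k) f \<Longrightarrow> (f has_derivative frechet_derivative f (at x)) (at x)"
  by (simp add: differentiable_on_def frechet_derivative_works[symmetric])

lemma Ck_SucD: "Ck (Suc k) f \<Longrightarrow> Ck k f"
proof (induction k arbitrary: f)
  case 0
  then show ?case by (simp add: differentiable_imp_continuous_on)
next
  case (Suc k)
  then show ?case by (metis Ck.simps(2))
qed

lemma Ck_const: "Ck k (\<lambda>x. c)"
proof (induction k arbitrary: c)
  case (Suc k)
  then show ?case by (intro Ck_SucI[where D = "\<lambda>x h. 0"]) auto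
qed simp

lemma Ck_add: "Ck k f \<Longrightarrow> Ck k g \<Longrightarrow> Ck k (\<lambda>x. f x + g x)"
proof (induction k arbitrary: f g)
  case (Suc k)
  show ?case
  proof (rule Ck_SucI)
    show "((\<lambda>x. f x + g x) has_derivative
        (\<lambda>h. frechet_derivative f (at x) h + frechet_derivative g (at x) h)) (at x)" for x
      by (intro has_derivative_add Ck_Suc_has_derivative[OF Suc.prems(1)] Ck_Suc_has_derivative[OF Suc.prems(2)])
    show "Ck k (\<lambda>x. frechet_derivative f (at x) b + frechet_derivative g (at x) b)" if "b \<in> Basis" for b
      using Suc.prems that by (intro Suc.IH) simp_all
  qed
qed (simp add: continuous_on_add)

lemma Ck_mult: "Ck k f \<Longrightarrow> Ck k g \<Longrightarrow> Ck k (\<lambda>x. f x * g x)"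
proof (induction k arbitrary: f g)
  case (Suc k)
  show ?case
  proof (rule Ck_SucI)
    show "((\<lambda>x. f x * g x) has_derivative
        (\<lambda>h. f x * frechet_derivative g (at x) h + frechet_derivative f (at x) h * g x)) (at x)" for x
      by (intro has_derivative_mult Ck_Suc_has_derivative[OF Suc.prems(1)] Ck_Suc_has_derivative[OF Suc.prems(2)])
    show "Ck k (\<lambda>x. f x * frechet_derivative g (at x) b + frechet_derivative f (at x) b * g x)"
      if "b \<in> Basis" for b
      using Suc.prems[THEN Ck_SucD] Suc.prems that by (intro Ck_add Suc.IH) simp_all
  qed
qed (simp add: continuous_on_mult)

lemma Ck_prod: "(\<And>i. i \<in> I \<Longrightarrow> Ck k (f i)) \<Longrightarrow> Ck k (\<lambda>x. \<Prod>i\<in>I. f i x)"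
  by (induction I rule: infinite_finite_induct) (auto intro: Ck_const Ck_mult)

lemma Ck_translate: "Ck k f \<Longrightarrow> Ck k (\<lambda>x. f (x + s))"
proof (induction k arbitrary: f)
  case 0
  then show ?case
    by (auto intro!: continuous_on_compose2[of UNIV f] continuous_intros)
next
  case (Suc k)
  show ?case
  proof (rule Ck_SucI)
    show "((\<lambda>x. f (x + s)) has_derivative (\<lambda>h. frechet_derivative f (at (x + s)) h)) (at x)" for x
      by (rule has_derivative_compose[OF _ Ck_Suc_has_derivative[OF Suc.prems], of "\<lambda>x. x + s" "\<lambda>h. h", simplified])
        (auto intro!: derivative_eq_intros)
    show "Ck k (\<lambda>x. frechet_derivative f (at (x + s)) b)" if "b \<in> Basis" for b
      using Suc.prems that by (intro Suc.IH) simp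
  qed
qed

text \<open>The classical smooth function exp(-1/t), extended by 0 and multiplied by a polynomial in
  1/t. The polynomial factor closes the family under differentiation.\<close>

definition flat :: "real poly \<Rightarrow> real \<Rightarrow> real" where
  "flat p t = (if t > 0 then poly p (1 / t) * exp (- (1 / t)) else 0)"

lemma poly_times_exp_minus_tendsto_0:
  "((\<lambda>s. poly p s * exp (- s)) \<longlongrightarrow> (0::real)) at_top"
proof -
  have "((\<lambda>s. \<Sum>i\<le>degree p. coeff p i * (s ^ i / exp s)) \<longlongrightarrow> (\<Sum>i\<le>degree p. coeff p i * 0)) at_top"
    by (intro tendsto_intros tendsto_power_div_exp_0)
  then show ?thesis
    by (simp add: poly_altdef sum_distrib_right exp_minus divide_inverse mult.assoc)
qed

text \<open>This is the difference quotient at 0. The factor 1/t is absorbed by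
  \<open>pCons 0 p\<close>, and the substitution s = 1/t reduces the right limit to a polynomial
  times exp(-s) at infinity.\<close>

lemma flat_over_tendsto_0: "((\<lambda>t. flat p t / t) \<longlongrightarrow> 0) (at 0)"
proof (rule filterlim_split_at)
  have "\<forall>\<^sub>F t in at_left 0. flat p t / t = 0"
    by (auto simp: flat_def eventually_at_left_field intro!: exI[of _ "-1"])
  then show "((\<lambda>t. flat p t / t) \<longlongrightarrow> 0) (at_left 0)"
    by (rule tendsto_eventually)
  have "((\<lambda>t. poly (pCons 0 p) (inverse t) * exp (- inverse t)) \<longlongrightarrow> 0) (at_right (0::real))"
    by (rule filterlim_compose[OF poly_times_exp_minus_tendsto_0 filterlim_inverse_at_top_right])
  moreover have "\<forall>\<^sub>F t in at_right 0. poly (pCons 0 p) (inverse t) * exp (- inverse t) = flat p t / t"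
    by (auto simp: flat_def eventually_at_right_field inverse_eq_divide intro!: exI[of _ 1])
  ultimately show "((\<lambda>t. flat p t / t) \<longlongrightarrow> 0) (at_right 0)"
    by (rule Lim_transform_eventually)
qed

text \<open>For positive t the product and chain rules give t^(-2) (p - p')(1/t) exp(-1/t); the two
  leading \<open>pCons 0\<close> encode the factor t^(-2).\<close>

lemma flat_has_derivative:
  "(flat p has_real_derivative flat (pCons 0 (pCons 0 (p - pderiv p))) t) (at t)"
proof -
  consider "t < 0" | "t = 0" | "t > 0" by linarith
  then show ?thesis
  proof cases
    case 1
    have "((\<lambda>t. 0) has_real_derivative 0) (at t)" by simp
    moreover have "\<forall>\<^sub>F x in nhds t. flat p x = 0"
    proof -
      have "\<forall>\<^sub>F x in nhds t. x \<in> {..<0}" using 1 by (intro eventually_nhds_in_open) auto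
      then show ?thesis by eventually_elim (simp add: flat_def)
    qed
    ultimately have "(flat p has_real_derivative 0) (at t)" by (subst DERIV_cong_ev[OF refl _ refl])
    with 1 show ?thesis by (simp add: flat_def)
  next
    case 2
    then show ?thesis using flat_over_tendsto_0[of p] by (simp add: DERIV_def flat_def)
  next
    case 3
    have "((\<lambda>t. poly p (1 / t) * exp (- (1 / t))) has_real_derivative
        flat (pCons 0 (pCons 0 (p - pderiv p))) t) (at t)"
    proof -
      have p: "((\<lambda>t. poly p (1 / t)) has_real_derivative poly (pderiv p) (1 / t) * (- (1 / t\<^sup>2))) (at t)"
        using 3 by (intro DERIV_chain2[OF poly_DERIV]) (auto intro!: derivative_eq_intros simp: power2_eq_square)
      have e: "((\<lambda>t. exp (- (1 / t))) has_real_derivative exp (- (1 / t)) * (1 / t\<^sup>2)) (at t)"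
        using 3 by (auto intro!: derivative_eq_intros simp: power2_eq_square)
      have "poly (pderiv p) (1 / t) * (- (1 / t\<^sup>2)) * exp (- (1 / t)) + exp (- (1 / t)) * (1 / t\<^sup>2) * poly p (1 / t)
          = flat (pCons 0 (pCons 0 (p - pderiv p))) t"
        using 3 by (simp add: flat_def power2_eq_square field_simps)
      with DERIV_mult[OF p e] show ?thesis by simp
    qed
    moreover have "\<forall>\<^sub>F x in nhds t. flat p x = poly p (1 / x) * exp (- (1 / x))"
    proof -
      have "\<forall>\<^sub>F x in nhds t. x \<in> {0<..}" using 3 by (intro eventually_nhds_in_open) auto
      then show ?thesis by eventually_elim (simp add: flat_def)
    qed
    ultimately show ?thesis by (subst DERIV_cong_ev[OF refl _ refl])
  qed
qed

lemma Ck_flat: "Ck k (\<lambda>x::'a::euclidean_space. flat p (c * (x \<bullet> b) + d))"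
proof (induction k arbitrary: p)
  case 0
  have "isCont (flat p) t" for t by (rule DERIV_isCont[OF flat_has_derivative])
  then have "continuous_on UNIV (flat p)" by (simp add: continuous_on_eq_continuous_at)
  then show ?case
    by (auto intro!: continuous_on_compose2[of UNIV "flat p"] continuous_intros)
next
  case (Suc k)
  show ?case
  proof (rule Ck_SucI)
    fix x :: 'a
    have "((\<lambda>x. c * (x \<bullet> b) + d) has_derivative (\<lambda>h. c * (h \<bullet> b))) (at x)"
      by (auto intro!: derivative_eq_intros)
    from has_derivative_compose[OF this flat_has_derivative[unfolded has_field_derivative_def]]
    show "((\<lambda>x. flat p (c * (x \<bullet> b) + d)) has_derivative
      (\<lambda>h. flat (pCons 0 (pCons 0 (p - pderiv p))) (c * (x \<bullet> b) + d) * (c * (h \<bullet> b)))) (at x)" .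
  next
    fix i :: 'a
    show "Ck k (\<lambda>x. flat (pCons 0 (pCons 0 (p - pderiv p))) (c * (x \<bullet> b) + d) * (c * (i \<bullet> b)))"
      by (intro Ck_mult Ck_const Suc.IH)
  qed
qed

text \<open>A product of one-dimensional profiles, positive exactly on the open box when
  \<open>n\<close> is positive. Larger \<open>n\<close> steepens the profiles, so the functions tend
  to the indicator of the box.\<close>

definition bump :: "'a::euclidean_space \<Rightarrow> 'a \<Rightarrow> nat \<Rightarrow> 'a \<Rightarrow> real" where
  "bump a b n x = (\<Prod>i\<in>Basis. flat 1 (real n * (x \<bullet> i - a \<bullet> i)) * flat 1 (real n * (b \<bullet> i - x \<bullet> i)))"

lemma flat_1: "flat 1 t = (if t > 0 then exp (- (1 / t)) else 0)"
  by (simp add: flat_def)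

lemma flat_1_bounds: "0 \<le> flat 1 t" "flat 1 t \<le> 1"
  by (auto simp: flat_1)

lemma flat_1_mult_bounds: "0 \<le> flat 1 s * flat 1 t" "flat 1 s * flat 1 t \<le> 1"
  using flat_1_bounds by (auto intro!: mult_le_one)

lemma bump_bounds: "0 \<le> bump a b n x" "bump a b n x \<le> 1"
  unfolding bump_def using flat_1_mult_bounds by (auto intro!: prod_nonneg prod_le_1)

lemma bump_outside: "x \<notin> box a b \<Longrightarrow> bump a b n x = 0"
proof -
  assume "x \<notin> box a b"
  then obtain i where i: "i \<in> Basis" "x \<bullet> i - a \<bullet> i \<le> 0 \<or> b \<bullet> i - x \<bullet> i \<le> 0"
    by (auto simp: mem_box not_less)
  then have "flat 1 (real n * (x \<bullet> i - a \<bullet> i)) * flat 1 (real n * (b \<bullet> i - x \<bullet> i)) = 0"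
    by (auto simp: flat_1 zero_less_mult_iff)
  with i show ?thesis unfolding bump_def by (intro prod_zero) auto
qed

lemma bump_tendsto: "(\<lambda>n. bump a b n x) \<longlonglongrightarrow> indicat_real (box a b) x"
proof (cases "x \<in> box a b")
  case True
  have 1: "(\<lambda>n. flat 1 (real n * t)) \<longlonglongrightarrow> 1" if "t > 0" for t
  proof (rule Lim_transform_eventually)
    have "(\<lambda>n. exp (- (1 / t * (1 / real n)))) \<longlonglongrightarrow> exp (- (1 / t * 0))"
      by (intro tendsto_intros lim_1_over_n)
    then show "(\<lambda>n. exp (- (1 / t * (1 / real n)))) \<longlonglongrightarrow> 1" by simp
    show "\<forall>\<^sub>F n in sequentially. exp (- (1 / t * (1 / real n))) = flat 1 (real n * t)"
      using eventually_gt_at_top[of 0] by eventually_elim (use that in \<open>simp add: flat_1 mult.commute\<close>)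
  qed
  have "(\<lambda>n. bump a b n x) \<longlonglongrightarrow> (\<Prod>i\<in>(Basis::'a set). 1 * 1)"
    unfolding bump_def using True by (intro tendsto_prod tendsto_mult 1) (auto simp: mem_box)
  with True show ?thesis by simp
qed (simp add: bump_outside)

section \<open>Support, bounds and derivatives of test functions\<close>

lemma test_functionsI:
  assumes "\<And>k. Ck k \<phi>" "\<And>x. norm x > R \<Longrightarrow> \<phi> x = 0"
  shows "\<phi> \<in> test_functions"
proof -
  have "{x. \<phi> x \<noteq> 0} \<subseteq> cball 0 R"
  proof
    fix x assume "x \<in> {x. \<phi> x \<noteq> 0}"
    then show "x \<in> cball 0 R" using assms(2)[of x] by (cases "norm x > R") auto
  qed
  then have "bounded {x. \<phi> x \<noteq> 0}" using bounded_subset by blast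
  with assms(1) show ?thesis by (simp add: test_functions_def)
qed

lemma test_functions_Ck: "\<phi> \<in> test_functions \<Longrightarrow> Ck k \<phi>"
  by (simp add: test_functions_def)

lemma test_functions_support:
  assumes "\<phi> \<in> test_functions" obtains R where "R > 0" "\<And>x. norm x \<ge> R \<Longrightarrow> \<phi> x = 0"
proof -
  have "bounded {x. \<phi> x \<noteq> 0}" using assms by (simp add: test_functions_def)
  then obtain R where "R > 0" "\<forall>x\<in>{x. \<phi> x \<noteq> 0}. norm x < R" unfolding bounded_pos_less by blast
  with that[of R] show ?thesis by fastforce
qed

lemma bump_test_function: "bump a b n \<in> test_functions"
proof -
  obtain R where R: "\<forall>x\<in>box a b. norm x \<le> R" using bounded_box[of a b] by (auto simp: bounded_iff)
  show ?thesis
  proof (rule test_functionsI)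
    show "bump a b n x = 0" if "norm x > R" for x
      using R that by (intro bump_outside) fastforce
    have "bump a b n = (\<lambda>x. \<Prod>i\<in>Basis. flat 1 (real n * (x \<bullet> i) + (- real n * (a \<bullet> i))) *
        flat 1 ((- real n) * (x \<bullet> i) + real n * (b \<bullet> i)))"
      by (auto simp: bump_def algebra_simps intro!: prod.cong)
    then show "Ck k (bump a b n)" for k
      by (simp only:) (intro Ck_prod Ck_mult Ck_flat)
  qed
qed

lemma test_functions_zero: "(\<lambda>x. 0) \<in> test_functions"
  by (rule test_functionsI[of _ 0]) (auto intro: Ck_const)

lemma test_functions_linear:
  assumes "\<phi> \<in> test_functions" "\<psi> \<in> test_functions"
  shows "(\<lambda>x. \<phi> x + c * \<psi> x) \<in> test_functions"
proof -
  obtain R R' where "\<And>x. norm x \<ge> R \<Longrightarrow> \<phi> x = 0" "\<And>x. norm x \<ge> R' \<Longrightarrow> \<psi> x = 0"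
    using test_functions_support[OF assms(1)] test_functions_support[OF assms(2)] by metis
  then show ?thesis
    by (intro test_functionsI[of _ "max R R'"]
        Ck_add[OF test_functions_Ck[OF assms(1)] Ck_mult[OF Ck_const test_functions_Ck[OF assms(2)]]]) auto
qed

lemma test_functions_mult:
  assumes "\<phi> \<in> test_functions" "\<psi> \<in> test_functions"
  shows "(\<lambda>x. \<phi> x * \<psi> x) \<in> test_functions"
proof -
  obtain R where "\<And>x. norm x \<ge> R \<Longrightarrow> \<phi> x = 0"
    using test_functions_support[OF assms(1)] by metis
  then show ?thesis
    by (intro test_functionsI[of _ R] Ck_mult[OF test_functions_Ck[OF assms(1)] test_functions_Ck[OF assms(2)]]) auto
qed

lemma test_functions_translate:
  assumes "\<phi> \<in> test_functions"
  shows "(\<lambda>x. \<phi> (x + s)) \<in> test_functions"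
proof -
  obtain R where R: "\<And>x. norm x \<ge> R \<Longrightarrow> \<phi> x = 0"
    using test_functions_support assms by metis
  show ?thesis
  proof (rule test_functionsI[OF Ck_translate[OF test_functions_Ck[OF assms]]])
    show "\<phi> (x + s) = 0" if "norm x > R + norm s" for x
      using norm_triangle_ineq[of "x + s" "- s"] that by (intro R) simp
  qed
qed

lemma test_functions_has_derivative:
  "\<phi> \<in> test_functions \<Longrightarrow> (\<phi> has_derivative frechet_derivative \<phi> (at x)) (at x)"
  by (rule Ck_Suc_has_derivative[OF test_functions_Ck[of _ "Suc 0"]])

lemma test_functions_partial:
  assumes "\<phi> \<in> test_functions" "b \<in> Basis"
  shows "(\<lambda>x. frechet_derivative \<phi> (at x) b) \<in> test_functions"
proof -
  obtain R where R: "\<And>x. norm x \<ge> R \<Longrightarrow> \<phi> x = 0"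
    using test_functions_support assms by metis
  show ?thesis
  proof (rule test_functionsI)
    show "Ck k (\<lambda>x. frechet_derivative \<phi> (at x) b)" for k
      using test_functions_Ck[OF assms(1), of "Suc k"] assms(2) by simp
    fix x :: 'a assume "norm x > R"
    \<comment> \<open>The strict inequality places the point in an open set on which the function
      vanishes, so its derivative vanishes there too.\<close>
    then have "x \<in> - cball 0 R" by simp
    have "((\<lambda>x. 0) has_derivative (\<lambda>h. 0)) (at x)" by simp
    then have "(\<phi> has_derivative (\<lambda>h. 0)) (at x)"
      by (rule has_derivative_transform_within_open[OF _ _ \<open>x \<in> - cball 0 R\<close>]) (auto simp: R)
    from frechet_derivative_at[OF this] show "frechet_derivative \<phi> (at x) b = 0" by metis
  qed
qed

lemma frechet_derivative_gradient:
  assumes "\<phi> \<in> test_functions"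
  shows "frechet_derivative \<phi> (at x) h = gradient \<phi> x \<bullet> h"
proof -
  interpret bounded_linear "frechet_derivative \<phi> (at x)"
    using test_functions_has_derivative[OF assms] by (rule has_derivative_bounded_linear)
  have "frechet_derivative \<phi> (at x) h = frechet_derivative \<phi> (at x) (\<Sum>b\<in>Basis. (h \<bullet> b) *\<^sub>R b)"
    by (simp add: euclidean_representation)
  also have "\<dots> = gradient \<phi> x \<bullet> h"
    unfolding sum scaleR gradient_def inner_sum_left by (intro sum.cong) (auto simp: inner_commute)
  finally show ?thesis .
qed

lemma gradient_inner_test_function:
  assumes "\<phi> \<in> test_functions" "b \<in> Basis"
  shows "(\<lambda>x. gradient \<phi> x \<bullet> b) \<in> test_functions"
  using test_functions_partial[OF assms] frechet_derivative_gradient[OF assms(1)] by simp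

lemma test_functions_continuous: "\<phi> \<in> test_functions \<Longrightarrow> continuous_on UNIV \<phi>"
  using test_functions_Ck[of \<phi> 0] by simp

lemma test_functions_measurable: "\<phi> \<in> test_functions \<Longrightarrow> \<phi> \<in> borel_measurable borel"
  by (intro borel_measurable_continuous_onI test_functions_continuous)

lemma test_functions_bounded:
  assumes "\<phi> \<in> test_functions" obtains B where "B > 0" "\<And>x. \<bar>\<phi> x\<bar> \<le> B"
proof -
  obtain R where R: "\<And>x. norm x \<ge> R \<Longrightarrow> \<phi> x = 0"
    using test_functions_support assms by metis
  have "compact (\<phi> ` cball 0 R)"
    using test_functions_continuous[OF assms] by (intro compact_continuous_image) (auto intro: continuous_on_subset)
  then obtain B where B: "B > 0" "\<forall>x\<in>cball 0 R. \<bar>\<phi> x\<bar> \<le> B"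
    using compact_imp_bounded[of "\<phi> ` cball 0 R"] by (auto simp: bounded_pos)
  have "\<bar>\<phi> x\<bar> \<le> B" for x
    using B R[of x] by (cases "norm x \<ge> R") auto
  with B(1) show ?thesis by (rule that)
qed

lemma test_functions_dominated:
  assumes "\<phi> \<in> test_functions" obtains R B where "R > 0" "B > 0" "\<And>x. \<bar>\<phi> x\<bar> \<le> B * indicator (cball 0 R) x"
proof -
  obtain R B where "R > 0" "\<And>x. norm x \<ge> R \<Longrightarrow> \<phi> x = 0" "B > 0" "\<And>x. \<bar>\<phi> x\<bar> \<le> B"
    using test_functions_support test_functions_bounded assms by metis
  then have "\<bar>\<phi> x\<bar> \<le> B * indicator (cball 0 R) x" for x
    by (cases "norm x \<le> R") auto
  with \<open>R > 0\<close> \<open>B > 0\<close> show ?thesis by (rule that)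
qed

lemma integrable_indicator_cball [simp]: "integrable lborel (indicat_real (cball (a::'a::euclidean_space) R))"
  by (intro integrable_real_indicator emeasure_bounded_finite) auto

lemma test_functions_L2:
  assumes "\<phi> \<in> test_functions"
  shows "L2 lborel \<phi>"
proof -
  note [measurable] = test_functions_measurable[OF assms]
  obtain R B where RB: "R > 0" "B > 0" "\<And>x. \<bar>\<phi> x\<bar> \<le> B * indicator (cball 0 R) x"
    using test_functions_dominated[OF assms] by metis
  have "integrable lborel (\<lambda>x. (\<phi> x)\<^sup>2)"
  proof (rule Bochner_Integration.integrable_bound)
    show "integrable lborel (\<lambda>x. B\<^sup>2 * indicat_real (cball (0::'a) R) x)" by simp
    show "(\<lambda>x. (\<phi> x)\<^sup>2) \<in> borel_measurable lborel" by measurable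
    show "AE x in lborel. norm ((\<phi> x)\<^sup>2) \<le> norm (B\<^sup>2 * indicat_real (cball 0 R) x)"
    proof (rule AE_I2)
      fix x
      have "(\<phi> x)\<^sup>2 \<le> (B * indicator (cball 0 R) x)\<^sup>2"
        using power_mono[OF RB(3), of x 2] by simp
      then show "norm ((\<phi> x)\<^sup>2) \<le> norm (B\<^sup>2 * indicat_real (cball 0 R) x)"
        by (cases "x \<in> cball 0 R") (simp_all add: power_mult_distrib)
    qed
  qed
  then show ?thesis by (simp add: L2_def)
qed

lemma gradient_L2:
  fixes \<phi> :: "'a::euclidean_space \<Rightarrow> real"
  assumes "\<phi> \<in> test_functions"
  shows "L2 lborel (gradient \<phi>)"
proof -
  have *: "L2 lborel (\<lambda>x. frechet_derivative \<phi> (at x) b)" if "b \<in> Basis" for b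
    by (rule test_functions_L2[OF test_functions_partial[OF assms that]])
  have [measurable]: "(\<lambda>x. frechet_derivative \<phi> (at x) b) \<in> borel_measurable borel" if "b \<in> Basis" for b
    by (rule test_functions_measurable[OF test_functions_partial[OF assms that]])
  have "gradient \<phi> \<in> borel_measurable borel"
    unfolding gradient_def[abs_def] by measurable
  moreover have "(norm (gradient \<phi> x))\<^sup>2 = (\<Sum>b\<in>Basis. (frechet_derivative \<phi> (at x) b)\<^sup>2)" for x
    unfolding frechet_derivative_gradient[OF assms] power2_norm_eq_inner
    by (subst euclidean_inner) (simp add: power2_eq_square)
  ultimately show ?thesis using * by (auto simp: L2_def)
qed

lemma test_functions_Lipschitz:
  fixes \<phi> :: "'a::euclidean_space \<Rightarrow> real"
  assumes "\<phi> \<in> test_functions"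
  obtains L where "L > 0" "\<And>x y. \<bar>\<phi> x - \<phi> y\<bar> \<le> L * norm (x - y)"
proof -
  have "\<exists>B. B > 0 \<and> (\<forall>x. \<bar>frechet_derivative \<phi> (at x) b\<bar> \<le> B)" if "b \<in> Basis" for b
    using test_functions_bounded[OF test_functions_partial[OF assms that]] by metis
  then obtain B where B: "\<And>b. b \<in> Basis \<Longrightarrow> B b > 0" "\<And>b x. b \<in> Basis \<Longrightarrow> \<bar>frechet_derivative \<phi> (at x) b\<bar> \<le> B b"
    by metis
  define L where "L = (\<Sum>b\<in>(Basis::'a set). B b)"
  have "L > 0" unfolding L_def using B(1) by (intro sum_pos) auto
  moreover have "\<bar>\<phi> x - \<phi> y\<bar> \<le> L * norm (x - y)" for x y
  proof -
    have "norm (\<phi> x - \<phi> y) \<le> L * norm (x - y)"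
    proof (rule differentiable_bound[of UNIV \<phi> "\<lambda>x. frechet_derivative \<phi> (at x)"])
      show "convex (UNIV :: 'a set)" "x \<in> UNIV" "y \<in> UNIV" by simp_all
      fix z :: 'a
      show "(\<phi> has_derivative frechet_derivative \<phi> (at z)) (at z within UNIV)"
        by (rule test_functions_has_derivative[OF assms])
      show "onorm (frechet_derivative \<phi> (at z)) \<le> L"
      proof (rule onorm_le)
        fix h
        have "\<bar>frechet_derivative \<phi> (at z) h\<bar> = \<bar>\<Sum>b\<in>Basis. frechet_derivative \<phi> (at z) b * (h \<bullet> b)\<bar>"
          unfolding frechet_derivative_gradient[OF assms] by (subst euclidean_inner) simp
        also have "\<dots> \<le> (\<Sum>b\<in>Basis. B b * norm h)"
          by (intro order_trans[OF sum_abs] sum_mono)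
            (auto simp: abs_mult Basis_le_norm intro!: mult_mono B less_imp_le[OF B(1)])
        finally show "norm (frechet_derivative \<phi> (at z) h) \<le> L * norm h"
          by (simp add: L_def sum_distrib_right)
      qed
    qed
    then show ?thesis by simp
  qed
  ultimately show ?thesis by (rule that)
qed

text \<open>Dominated convergence for difference quotients, with the Lipschitz constant of \<phi> as
  bound. Local integrability of \<open>u\<close> is enough because all translates live in one ball;
  this admits both L2 functions and the constant 1.\<close>

lemma has_derivative_integral_translate:
  fixes \<phi> u :: "'a::euclidean_space \<Rightarrow> real"
  assumes \<phi>: "\<phi> \<in> test_functions"
    and u [measurable]: "u \<in> borel_measurable borel"
    and loc: "\<And>R. integrable lborel (\<lambda>x. indicator (cball 0 R) x * u x)"
  shows "((\<lambda>s. LBINT x. u x * \<phi> (x + s *\<^sub>R h)) has_real_derivative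
    (LBINT x. u x * (gradient \<phi> (x + s *\<^sub>R h) \<bullet> h))) (at s)"
proof -
  note [measurable] = test_functions_measurable[OF \<phi>]
  obtain R where R: "R > 0" "\<And>x. norm x \<ge> R \<Longrightarrow> \<phi> x = 0" using test_functions_support[OF \<phi>] by metis
  obtain L where L: "L > 0" "\<And>x y. \<bar>\<phi> x - \<phi> y\<bar> \<le> L * norm (x - y)"
    using test_functions_Lipschitz[OF \<phi>] by metis
  have intg: "integrable lborel (\<lambda>x. u x * \<phi> (x + s *\<^sub>R h))" for s
  proof -
    obtain R B where RB: "R > 0" "B > 0" "\<And>x. \<bar>\<phi> (x + s *\<^sub>R h)\<bar> \<le> B * indicator (cball 0 R) x"
      using test_functions_dominated[OF test_functions_translate[OF \<phi>]] by metis
    show ?thesis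
    proof (rule Bochner_Integration.integrable_bound)
      show "integrable lborel (\<lambda>x. B * (indicator (cball 0 R) x * u x))" using loc by simp
      show "AE x in lborel. norm (u x * \<phi> (x + s *\<^sub>R h)) \<le> norm (B * (indicator (cball 0 R) x * u x))"
        using RB mult_left_mono[OF RB(3) abs_ge_zero]
        by (auto intro!: AE_I2 simp: abs_mult mult_ac)
      show "(\<lambda>x. u x * \<phi> (x + s *\<^sub>R h)) \<in> borel_measurable lborel" by measurable
    qed
  qed
  show ?thesis
    unfolding DERIV_def tendsto_at_iff_sequentially o_def
  proof (intro allI impI)
    fix X :: "nat \<Rightarrow> real" assume X: "\<forall>i. X i \<in> UNIV - {0}" "X \<longlonglongrightarrow> 0"
    obtain K where K: "K > 0" "\<And>n. \<bar>X n\<bar> \<le> K"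
      using convergent_imp_Bseq[OF convergentI[OF X(2)]] by (auto elim: BseqE)
    \<comment> \<open>This ball contains the supports of all translates by \<open>s\<close> and by
      \<open>s + X n\<close>, as \<open>K\<close> bounds the sequence \<open>X\<close>.\<close>
    define R' where "R' = R + (\<bar>s\<bar> + K) * norm h"
    define q where "q n x = (\<phi> (x + (s + X n) *\<^sub>R h) - \<phi> (x + s *\<^sub>R h)) / X n" for n x
    have "(\<lambda>n. LBINT x. u x * q n x) \<longlonglongrightarrow> (LBINT x. u x * (gradient \<phi> (x + s *\<^sub>R h) \<bullet> h))"
    proof (rule integral_dominated_convergence)
      show "integrable lborel (\<lambda>x. L * norm h * \<bar>indicator (cball 0 R') x * u x\<bar>)"
        using loc by (intro integrable_mult_right integrable_abs)
      have [measurable]: "gradient \<phi> \<in> borel_measurable borel"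
        using L2_measurable[OF gradient_L2[OF \<phi>]] by simp
      show "(\<lambda>x. u x * (gradient \<phi> (x + s *\<^sub>R h) \<bullet> h)) \<in> borel_measurable lborel" by measurable
      show "(\<lambda>x. u x * q n x) \<in> borel_measurable lborel" for n unfolding q_def by measurable
      show "AE x in lborel. norm (u x * q n x) \<le> L * norm h * \<bar>indicator (cball 0 R') x * u x\<bar>" for n
      proof (rule AE_I2)
        fix x
        have X0: "\<bar>X n\<bar> > 0" using X(1) by simp
        show "norm (u x * q n x) \<le> L * norm h * \<bar>indicator (cball 0 R') x * u x\<bar>"
        proof (cases "norm x \<le> R'")
          case True
          have "\<bar>q n x\<bar> \<le> L * norm (X n *\<^sub>R h) / \<bar>X n\<bar>"
            using L(2)[of "x + (s + X n) *\<^sub>R h" "x + s *\<^sub>R h"] X0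
            unfolding q_def abs_divide by (intro divide_right_mono) (auto simp: algebra_simps)
          also have "\<dots> = L * norm h" using X0 by simp
          finally show ?thesis using True by (simp add: abs_mult mult_right_mono mult.commute[of "\<bar>u x\<bar>"])
        next
          case False
          have "norm x \<le> norm (x + c *\<^sub>R h) + \<bar>c\<bar> * norm h" for c
            using norm_triangle_ineq4[of "x + c *\<^sub>R h" "c *\<^sub>R h"] by simp
          moreover have "\<bar>s\<bar> * norm h \<le> (\<bar>s\<bar> + K) * norm h" "\<bar>s + X n\<bar> * norm h \<le> (\<bar>s\<bar> + K) * norm h"
            using K(1) K(2)[of n] by (auto intro!: mult_right_mono)
          ultimately have "norm (x + s *\<^sub>R h) \<ge> R" "norm (x + (s + X n) *\<^sub>R h) \<ge> R"
            using False unfolding R'_def by (smt (verit))+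
          then show ?thesis using L(1) by (simp add: q_def R(2))
        qed
      qed
      show "AE x in lborel. (\<lambda>n. u x * q n x) \<longlonglongrightarrow> u x * (gradient \<phi> (x + s *\<^sub>R h) \<bullet> h)"
      proof (intro AE_I2 tendsto_intros)
        fix x
        have "((\<lambda>t. x + t *\<^sub>R h) has_derivative (\<lambda>t. t *\<^sub>R h)) (at s)"
          by (auto intro!: derivative_eq_intros)
        from has_derivative_compose[OF this test_functions_has_derivative[OF \<phi>]]
        have "((\<lambda>t. \<phi> (x + t *\<^sub>R h)) has_real_derivative gradient \<phi> (x + s *\<^sub>R h) \<bullet> h) (at s)"
          by (simp add: has_field_derivative_def frechet_derivative_gradient[OF \<phi>] mult.commute[of _ "_ \<bullet> _"])
        then show "(\<lambda>n. q n x) \<longlonglongrightarrow> gradient \<phi> (x + s *\<^sub>R h) \<bullet> h"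
          using X unfolding DERIV_def tendsto_at_iff_sequentially o_def q_def by blast
      qed
    qed
    moreover have "((LBINT x. u x * \<phi> (x + (s + X n) *\<^sub>R h)) - (LBINT x. u x * \<phi> (x + s *\<^sub>R h))) / X n
        = (LBINT x. u x * q n x)" for n
    proof -
      have "u x * q n x = (u x * \<phi> (x + (s + X n) *\<^sub>R h) - u x * \<phi> (x + s *\<^sub>R h)) / X n" for x
        by (simp add: q_def right_diff_distrib)
      then show ?thesis using intg[of s] intg[of "s + X n"] by simp
    qed
    ultimately show "(\<lambda>n. ((LBINT x. u x * \<phi> (x + (s + X n) *\<^sub>R h)) - (LBINT x. u x * \<phi> (x + s *\<^sub>R h))) / X n)
        \<longlonglongrightarrow> (LBINT x. u x * (gradient \<phi> (x + s *\<^sub>R h) \<bullet> h))" by simp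
  qed
qed

section \<open>Weak gradients and translations\<close>

definition rational_points :: "'a::euclidean_space set" where
  "rational_points = {x. \<forall>i\<in>Basis. x \<bullet> i \<in> \<rat>}"

lemma countable_rational_points: "countable (rational_points :: 'a::euclidean_space set)"
proof (rule countable_subset)
  show "rational_points \<subseteq> (\<lambda>f. \<Sum>i\<in>Basis. f i *\<^sub>R i) ` (Pi\<^sub>E (Basis :: 'a set) (\<lambda>_. \<rat>))"
  proof
    fix x :: 'a assume "x \<in> rational_points"
    then have "restrict (\<lambda>i. x \<bullet> i) Basis \<in> Pi\<^sub>E Basis (\<lambda>_. \<rat>)" by (auto simp: rational_points_def)
    moreover have "x = (\<Sum>i\<in>Basis. restrict (\<lambda>i. x \<bullet> i) Basis i *\<^sub>R i)"
      by (simp add: euclidean_representation cong: sum.cong)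
    ultimately show "x \<in> (\<lambda>f. \<Sum>i\<in>Basis. f i *\<^sub>R i) ` (Pi\<^sub>E (Basis :: 'a set) (\<lambda>_. \<rat>))" by blast
  qed
  show "countable ((\<lambda>f. \<Sum>i\<in>Basis. f i *\<^sub>R i) ` (Pi\<^sub>E (Basis :: 'a set) (\<lambda>_. \<rat>)))"
    by (intro countable_image countable_PiE) (auto simp: countable_rat)
qed

text \<open>Rational corners make the family countable, as weak compactness requires; boxes are
  stable under intersection, as uniqueness of measures requires.\<close>

definition rational_boxes :: "'a::euclidean_space set set" where
  "rational_boxes = (\<lambda>(a, b). box a b) ` (rational_points \<times> rational_points)"

lemma borel_eq_rational_boxes: "borel = sigma UNIV (rational_boxes :: 'a::euclidean_space set set)"
proof (rule borel_eq_countable_basis)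
  show "countable (rational_boxes :: 'a set set)"
    unfolding rational_boxes_def by (intro countable_image countable_SIGMA countable_rational_points)
  show "topological_basis (rational_boxes :: 'a set set)"
  proof (rule topological_basisI)
    fix S :: "'a set" and x assume "open S" "x \<in> S"
    then obtain e where e: "e > 0" "ball x e \<subseteq> S" by (auto elim: openE)
    from Topology_Euclidean_Space.rational_boxes[OF e(1), of x] obtain a b where
      "a \<in> rational_points" "b \<in> rational_points" "x \<in> box a b" "box a b \<subseteq> ball x e"
      by (auto simp: rational_points_def)
    with e(2) show "\<exists>B\<in>rational_boxes. x \<in> B \<and> B \<subseteq> S"
      unfolding rational_boxes_def by (intro bexI[of _ "box a b"]) auto
  qed (auto simp: rational_boxes_def open_box)
qed

lemma Int_stable_rational_boxes: "Int_stable rational_boxes"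
proof (rule Int_stableI)
  fix A B :: "'a set" assume "A \<in> rational_boxes" "B \<in> rational_boxes"
  then obtain a b c d where *: "A = box a b" "B = box c d"
    "a \<in> rational_points" "b \<in> rational_points" "c \<in> rational_points" "d \<in> rational_points"
    by (auto simp: rational_boxes_def)
  have "A \<inter> B = box (\<Sum>i\<in>Basis. max (a \<bullet> i) (c \<bullet> i) *\<^sub>R i) (\<Sum>i\<in>Basis. min (b \<bullet> i) (d \<bullet> i) *\<^sub>R i)"
    unfolding * by (rule box_Int_box)
  moreover have "(\<Sum>i\<in>Basis. max (a \<bullet> i) (c \<bullet> i) *\<^sub>R i) \<in> rational_points"
    "(\<Sum>i\<in>Basis. min (b \<bullet> i) (d \<bullet> i) *\<^sub>R i) \<in> rational_points"
    using * by (auto simp: rational_points_def max_def min_def)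
  ultimately show "A \<inter> B \<in> rational_boxes" unfolding rational_boxes_def by blast
qed

lemma L2_indicator_box: "L2 lborel (\<lambda>x. indicat_real (box a b) x *\<^sub>R e)"
proof -
  have "integrable lborel (\<lambda>x. (norm e)\<^sup>2 * indicat_real (box a b) x)"
    by (intro integrable_mult_right integrable_real_indicator emeasure_bounded_finite bounded_box) auto
  moreover have "(\<lambda>x. (norm (indicat_real (box a b) x *\<^sub>R e))\<^sup>2) = (\<lambda>x. (norm e)\<^sup>2 * indicat_real (box a b) x)"
    by (auto simp: indicator_def)
  ultimately show ?thesis unfolding L2_def by simp
qed

lemma inner_square_le: "(a \<bullet> h)\<^sup>2 \<le> (norm h)\<^sup>2 * (norm a)\<^sup>2"
  using Cauchy_Schwarz_ineq[of a h] by (simp add: power2_norm_eq_inner mult.commute)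

lemma L2_inner_const:
  assumes f: "L2 M f"
  shows "L2 M (\<lambda>x. f x \<bullet> h)"
proof -
  have [measurable]: "f \<in> borel_measurable M" using f by (simp add: L2_def)
  have "integrable M (\<lambda>x. (f x \<bullet> h)\<^sup>2)"
  proof (rule Bochner_Integration.integrable_bound)
    show "integrable M (\<lambda>x. (norm h)\<^sup>2 * (norm (f x))\<^sup>2)" using f by (simp add: L2_def)
    show "(\<lambda>x. (f x \<bullet> h)\<^sup>2) \<in> borel_measurable M" by measurable
    show "AE x in M. norm ((f x \<bullet> h)\<^sup>2) \<le> norm ((norm h)\<^sup>2 * (norm (f x))\<^sup>2)"
      using inner_square_le by (intro AE_I2) simp
  qed
  then show ?thesis by (simp add: L2_def)
qed

text \<open>The positive and the negative part of \<open>g\<close> are densities of two measures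
  that agree on an intersection-stable generator, so the parts coincide almost everywhere, which
  forces both to vanish.\<close>

lemma rational_boxes_separate_real:
  fixes g :: "'a::euclidean_space \<Rightarrow> real"
  assumes g: "L2 lborel g"
    and 0: "\<And>a b. a \<in> rational_points \<Longrightarrow> b \<in> rational_points \<Longrightarrow> (LBINT x. indicator (box a b) x * g x) = 0"
  shows "AE x in lborel. g x = 0"
proof -
  have [measurable]: "g \<in> borel_measurable borel" using g by (simp add: L2_def)
  \<comment> \<open>\<open>ennreal\<close> sends negative numbers to 0, so \<open>N 1\<close> has
    the positive part of \<open>g\<close> as density and \<open>N (-1)\<close> the negative
    part.\<close>
  define N where "N s = density lborel (\<lambda>x. ennreal (s * g x))" for s
  have int: "integrable lborel (\<lambda>x. indicator (box a b) x * g x)" for a b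
    using L2_inner[OF L2_indicator_box[of a b "1::real"] g] by simp
  have em: "emeasure (N s) (box a b) = ennreal (LBINT x. indicator (box a b) x * max 0 (s * g x))"
    and int': "integrable lborel (\<lambda>x. indicator (box a b) x * max 0 (s * g x))" for s a b
  proof -
    have "integrable lborel (\<lambda>x. max 0 (s * (indicator (box a b) x * g x)))"
      by (intro integrable_max integrable_zero integrable_mult_right int)
    moreover have "(\<lambda>x. max 0 (s * (indicator (box a b) x * g x))) = (\<lambda>x. indicator (box a b) x * max 0 (s * g x))"
      by (auto simp: indicator_def)
    ultimately show *: "integrable lborel (\<lambda>x. indicator (box a b) x * max 0 (s * g x))"
      by simp
    have "emeasure (N s) (box a b) = (\<integral>\<^sup>+x. ennreal (indicator (box a b) x * max 0 (s * g x)) \<partial>lborel)"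
      unfolding N_def by (subst emeasure_density) (auto intro!: nn_integral_cong simp: indicator_def max_def ennreal_neg)
    with * show "emeasure (N s) (box a b) = ennreal (LBINT x. indicator (box a b) x * max 0 (s * g x))"
      by (simp add: nn_integral_eq_integral)
  qed
  have "N 1 = N (-1)"
  proof (rule measure_eqI_generator_eq[OF Int_stable_rational_boxes])
    show "rational_boxes \<subseteq> Pow UNIV" by simp
    show "sets (N 1) = sigma_sets UNIV rational_boxes" "sets (N (-1)) = sigma_sets UNIV rational_boxes"
      by (simp_all add: N_def borel_eq_rational_boxes)
    show "emeasure (N 1) X = emeasure (N (-1)) X" if X: "X \<in> rational_boxes" for X
    proof -
      obtain a b where ab: "X = box a b" "a \<in> rational_points" "b \<in> rational_points"
        using X by (auto simp: rational_boxes_def)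
      have "(LBINT x. indicator X x * max 0 (1 * g x)) - (LBINT x. indicator X x * max 0 (-1 * g x))
          = (LBINT x. indicator X x * max 0 (1 * g x) - indicator X x * max 0 (-1 * g x))"
        using int'[of a b 1] int'[of a b "-1"] ab(1) by simp
      also have "\<dots> = (LBINT x. indicator (box a b) x * g x)"
        unfolding ab(1) by (intro Bochner_Integration.integral_cong) (auto simp: indicator_def)
      finally show ?thesis using 0[OF ab(2,3)] em[of 1 a b] em[of "-1" a b] ab(1) by simp
    qed
    show "range (\<lambda>n. box (- (real n *\<^sub>R One)) (real n *\<^sub>R One)) \<subseteq> (rational_boxes :: 'a set set)"
      unfolding rational_boxes_def rational_points_def by (auto intro!: image_eqI[OF refl] simp: inner_sum_left_Basis)
    show "(\<Union>i. box (- (real i *\<^sub>R One)) (real i *\<^sub>R One)) = (UNIV :: 'a set)" by (rule UN_box_eq_UNIV)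
    show "emeasure (N 1) (box (- (real i *\<^sub>R One)) (real i *\<^sub>R One)) \<noteq> \<infinity>" for i by (simp add: em)
  qed
  then have "AE x in lborel. ennreal (1 * g x) = ennreal (-1 * g x)"
    unfolding N_def by (subst (asm) sigma_finite_measure.density_unique_iff[OF sigma_finite_lborel]) auto
  then show ?thesis
  proof eventually_elim
    case (elim x)
    then show ?case by (cases "g x \<ge> 0") (auto simp: ennreal_neg)
  qed
qed

lemma nsq_eq_0_iff: "L2 M f \<Longrightarrow> nsq M f = 0 \<longleftrightarrow> (AE x in M. f x = 0)"
  by (subst integral_nonneg_eq_0_iff_AE) (auto simp: L2_def)

lemma rational_boxes_separate:
  fixes g :: "'a::euclidean_space \<Rightarrow> 'b::euclidean_space"
  assumes g: "L2 lborel g"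
    and 0: "\<And>a b e. a \<in> rational_points \<Longrightarrow> b \<in> rational_points \<Longrightarrow> e \<in> Basis \<Longrightarrow>
      ip lborel g (\<lambda>x. indicat_real (box a b) x *\<^sub>R e) = 0"
  shows "nsq lborel g = 0"
proof -
  have "AE x in lborel. g x \<bullet> e = 0" if "e \<in> Basis" for e
    by (rule rational_boxes_separate_real[OF L2_inner_const[OF g]]) (use 0 that in simp)
  then have "AE x in lborel. \<forall>e\<in>Basis. g x \<bullet> e = 0"
    by (simp add: AE_finite_all)
  then have "AE x in lborel. g x = 0"
    by eventually_elim (rule euclidean_eqI, simp)
  then show ?thesis by (simp add: nsq_eq_0_iff[OF g])
qed

theorem L2_lborel_weakly_sequentially_compact:
  fixes F :: "nat \<Rightarrow> 'a::euclidean_space \<Rightarrow> 'b::euclidean_space"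
  assumes "\<And>n. L2 lborel (F n)" "\<And>n. nsq lborel (F n) \<le> C"
  obtains r f where "strict_mono r" "L2 lborel f"
    "\<And>g. L2 lborel g \<Longrightarrow> (\<lambda>n. ip lborel (F (r n)) g) \<longlonglongrightarrow> ip lborel f g"
proof -
  let ?I = "(rational_points :: 'a set) \<times> (rational_points :: 'a set) \<times> (Basis :: 'b set)"
  define Z where "Z = (\<lambda>(a, b, e) x. indicat_real (box a b) x *\<^sub>R e) \<circ> (from_nat_into ?I :: nat \<Rightarrow> 'a \<times> 'a \<times> 'b)"
  have "countable ?I"
    by (intro countable_SIGMA countable_rational_points countable_finite finite_Basis)
  moreover have "?I \<noteq> {}"
    using nonempty_Basis by (auto simp: rational_points_def intro!: exI[of _ 0])
  ultimately have rng: "range (from_nat_into ?I) = ?I" by (intro range_from_nat_into)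
  have Z1: "L2 lborel (Z i)" for i
    by (simp add: Z_def L2_indicator_box split: prod.split)
  have Z2: "nsq lborel g = 0" if g: "L2 lborel g" and 0: "\<And>i. ip lborel g (Z i) = 0" for g :: "'a \<Rightarrow> 'b"
  proof (rule rational_boxes_separate[OF g])
    fix a b :: 'a and e :: 'b assume "a \<in> rational_points" "b \<in> rational_points" "e \<in> Basis"
    then have "(a, b, e) \<in> range (from_nat_into ?I)" unfolding rng by simp
    then obtain i where "from_nat_into ?I i = (a, b, e)" by auto
    then show "ip lborel g (\<lambda>x. indicat_real (box a b) x *\<^sub>R e) = 0"
      using 0[of i] by (simp add: Z_def)
  qed
  show ?thesis
    by (rule L2_weakly_sequentially_compact[OF assms Z1 Z2]) (assumption | rule that)+
qed

text \<open>Bumps converge boundedly to indicators of boxes, so vanishing against test functions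
  implies vanishing integrals over boxes.\<close>

lemma test_functions_separate:
  fixes g :: "'a::euclidean_space \<Rightarrow> real"
  assumes g: "L2 lborel g" and 0: "\<And>\<phi>. \<phi> \<in> test_functions \<Longrightarrow> (LBINT x. g x * \<phi> x) = 0"
  shows "AE x in lborel. g x = 0"
proof (rule rational_boxes_separate_real[OF g])
  fix a b :: 'a
  have [measurable]: "g \<in> borel_measurable borel" using g by (simp add: L2_def)
  have [measurable]: "bump a b n \<in> borel_measurable borel" for n
    by (rule test_functions_measurable[OF bump_test_function])
  have int: "integrable lborel (\<lambda>x. indicator (box a b) x * g x)"
    using L2_inner[OF L2_indicator_box[of a b "1::real"] g] by simp
  have "(\<lambda>n. LBINT x. g x * bump a b n x) \<longlonglongrightarrow> (LBINT x. g x * indicator (box a b) x)"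
  proof (rule integral_dominated_convergence)
    show "integrable lborel (\<lambda>x. \<bar>indicator (box a b) x * g x\<bar>)" using int by (rule integrable_abs)
    show "AE x in lborel. norm (g x * bump a b n x) \<le> \<bar>indicator (box a b) x * g x\<bar>" for n
    proof (rule AE_I2)
      fix x show "norm (g x * bump a b n x) \<le> \<bar>indicator (box a b) x * g x\<bar>"
        using bump_bounds[of a b n x] bump_outside[of x a b n]
        by (cases "x \<in> box a b") (auto simp: abs_mult mult_left_le)
    qed
    show "AE x in lborel. (\<lambda>n. g x * bump a b n x) \<longlonglongrightarrow> g x * indicator (box a b) x"
      by (intro AE_I2 tendsto_intros bump_tendsto)
  qed measurable
  then have "(\<lambda>n. 0) \<longlonglongrightarrow> (LBINT x. g x * indicator (box a b) x)"
    using 0[OF bump_test_function] by simp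
  then show "(LBINT x. indicator (box a b) x * g x) = 0"
    by (simp add: LIMSEQ_const_iff mult.commute)
qed

lemma test_functions_dense:
  fixes g :: "'a::euclidean_space \<Rightarrow> real"
  assumes g: "L2 lborel g"
  shows "\<exists>\<phi>. (\<forall>n. \<phi> n \<in> test_functions) \<and> (\<lambda>n. nsq lborel (\<lambda>x. \<phi> n x - g x)) \<longlonglongrightarrow> 0"
proof -
  have lin: "(\<lambda>x. \<phi> x + c *\<^sub>R \<psi> x) \<in> test_functions"
    if "\<phi> \<in> test_functions" "\<psi> \<in> test_functions" for \<phi> \<psi> :: "'a \<Rightarrow> real" and c
    using test_functions_linear[OF that, of c] by simp
  have orth: "nsq lborel h = 0"
    if h: "L2 lborel h" and 0: "\<And>\<phi>. \<phi> \<in> test_functions \<Longrightarrow> ip lborel h \<phi> = 0" for h :: "'a \<Rightarrow> real"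
    unfolding nsq_eq_0_iff[OF h] by (rule test_functions_separate[OF h]) (use 0 in simp)
  have "\<exists>\<phi>\<in>test_functions. nsq lborel (\<lambda>x. g x - \<phi> x) < 1 / real (Suc n)" for n
    by (rule L2_dense[OF test_functions_L2 test_functions_zero lin orth g, of "1 / real (Suc n)"]) auto
  then obtain \<phi> where \<phi>: "\<And>n. \<phi> n \<in> test_functions" "\<And>n. nsq lborel (\<lambda>x. g x - \<phi> n x) < 1 / real (Suc n)"
    by metis
  have "(\<lambda>n. nsq lborel (\<lambda>x. \<phi> n x - g x)) \<longlonglongrightarrow> 0"
  proof (rule tendsto_sandwich[OF _ _ tendsto_const lim_1_over_n[THEN LIMSEQ_Suc]])
    show "\<forall>\<^sub>F n in sequentially. nsq lborel (\<lambda>x. \<phi> n x - g x) \<le> 1 / real (Suc n)"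
      using \<phi>(2) by (intro always_eventually allI) (simp only: real_norm_def abs_minus_commute less_imp_le)
  qed auto
  with \<phi>(1) show ?thesis by (intro exI[of _ \<phi>]) simp
qed

text \<open>Counterpart over \<open>lborel\<close> of membership in \<open>H1\<close>, with the weak
  gradient as an explicit argument instead of a choice. Linear combinations, translates and weak
  limits can then be given their gradients directly.\<close>

definition wgrad :: "('a::euclidean_space \<Rightarrow> real) \<Rightarrow> ('a \<Rightarrow> 'a) \<Rightarrow> bool" where
  "wgrad u G \<longleftrightarrow> L2 lborel u \<and> L2 lborel G \<and>
     (\<forall>\<phi>\<in>test_functions. \<forall>b\<in>Basis.
        (LBINT x. u x * (gradient \<phi> x \<bullet> b)) = - (LBINT x. (G x \<bullet> b) * \<phi> x))"

lemma wgradD: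
  assumes "wgrad u G"
  shows "L2 lborel u" "L2 lborel G"
  using assms by (auto simp: wgrad_def)

lemma L2_mult: "L2 M f \<Longrightarrow> L2 M g \<Longrightarrow> integrable M (\<lambda>x. f x * g x :: real)"
  using L2_inner[of M f g] by simp

lemma wgrad_directional:
  assumes w: "wgrad u G" and \<phi>: "\<phi> \<in> test_functions"
  shows "(LBINT x. u x * (gradient \<phi> x \<bullet> h)) = - (LBINT x. (G x \<bullet> h) * \<phi> x)"
proof -
  have i1: "integrable lborel (\<lambda>x. u x * (gradient \<phi> x \<bullet> b))" for b
    by (intro L2_mult wgradD[OF w] L2_inner_const gradient_L2 \<phi>)
  have i2: "integrable lborel (\<lambda>x. (G x \<bullet> b) * \<phi> x)" for b
    by (intro L2_mult wgradD[OF w] L2_inner_const test_functions_L2 \<phi>)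
  have "(LBINT x. u x * (gradient \<phi> x \<bullet> h))
      = (LBINT x. (\<Sum>b\<in>Basis. (h \<bullet> b) * (u x * (gradient \<phi> x \<bullet> b))))"
    by (subst euclidean_inner[of "gradient \<phi> _" h]) (simp add: sum_distrib_left mult_ac)
  also have "\<dots> = (\<Sum>b\<in>Basis. (h \<bullet> b) * (LBINT x. u x * (gradient \<phi> x \<bullet> b)))"
    using i1 by (subst Bochner_Integration.integral_sum) auto
  also have "\<dots> = (\<Sum>b\<in>Basis. - ((h \<bullet> b) * (LBINT x. (G x \<bullet> b) * \<phi> x)))"
    using w \<phi> by (intro sum.cong) (auto simp: wgrad_def)
  also have "\<dots> = - (LBINT x. (\<Sum>b\<in>Basis. (h \<bullet> b) * ((G x \<bullet> b) * \<phi> x)))"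
    using i2 by (subst Bochner_Integration.integral_sum) (auto simp: sum_negf)
  also have "\<dots> = - (LBINT x. (G x \<bullet> h) * \<phi> x)"
    by (subst euclidean_inner[of "G _" h]) (simp add: sum_distrib_left sum_distrib_right mult_ac)
  finally show ?thesis .
qed

text \<open>Both gradients have the same pairings with test functions, which separate. Equality of
  \<open>u\<close> and \<open>u'\<close> only almost everywhere is allowed, since it will be applied
  to different representatives.\<close>

lemma wgrad_unique:
  assumes "wgrad u G" "wgrad u' G'" and eq: "AE x in lborel. u x = u' x"
  shows "AE x in lborel. G x = G' x"
proof -
  note L = wgradD[OF assms(1)] wgradD[OF assms(2)]
  have "AE x in lborel. (G x - G' x) \<bullet> b = 0" if b: "b \<in> Basis" for b
  proof (rule test_functions_separate)
    show "L2 lborel (\<lambda>x. (G x - G' x) \<bullet> b)" by (intro L2_inner_const L2_diff L)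
    fix \<phi> :: "'a \<Rightarrow> real" assume \<phi>: "\<phi> \<in> test_functions"
    note [measurable] = L[THEN L2_measurable] L2_measurable[OF gradient_L2[OF \<phi>]]
    have "(LBINT x. u x * (gradient \<phi> x \<bullet> b)) = (LBINT x. u' x * (gradient \<phi> x \<bullet> b))"
      by (rule integral_cong_AE) (use eq in \<open>measurable, auto\<close>)
    then have "(LBINT x. (G x \<bullet> b) * \<phi> x) = (LBINT x. (G' x \<bullet> b) * \<phi> x)"
      using wgrad_directional[OF assms(1) \<phi>, of b] wgrad_directional[OF assms(2) \<phi>, of b] by simp
    moreover have "integrable lborel (\<lambda>x. (G x \<bullet> b) * \<phi> x)" "integrable lborel (\<lambda>x. (G' x \<bullet> b) * \<phi> x)"
      by (intro L2_mult L L2_inner_const test_functions_L2 \<phi>)+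
    ultimately show "(LBINT x. (G x - G' x) \<bullet> b * \<phi> x) = 0"
      by (simp add: inner_diff_left left_diff_distrib)
  qed
  then have "AE x in lborel. \<forall>b\<in>Basis. (G x - G' x) \<bullet> b = 0" by (simp add: AE_finite_all)
  then show ?thesis
    by eventually_elim (simp add: euclidean_eq_iff[of "G _"] inner_diff_left)
qed

lemma wgrad_linear:
  assumes "wgrad u G" "wgrad v H"
  shows "wgrad (\<lambda>x. u x + c * v x) (\<lambda>x. G x + c *\<^sub>R H x)"
  unfolding wgrad_def
proof (intro conjI ballI)
  note L = wgradD[OF assms(1)] wgradD[OF assms(2)]
  show "L2 lborel (\<lambda>x. u x + c * v x)" using L2_add_scaleR[OF L(1,3), of c] by simp
  show "L2 lborel (\<lambda>x. G x + c *\<^sub>R H x)" by (rule L2_add_scaleR[OF L(2,4)])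
  fix \<phi> :: "'a \<Rightarrow> real" and b :: 'a assume \<phi>: "\<phi> \<in> test_functions" and b: "b \<in> Basis"
  have i: "integrable lborel (\<lambda>x. u x * (gradient \<phi> x \<bullet> b))" "integrable lborel (\<lambda>x. v x * (gradient \<phi> x \<bullet> b))"
    "integrable lborel (\<lambda>x. (G x \<bullet> b) * \<phi> x)" "integrable lborel (\<lambda>x. (H x \<bullet> b) * \<phi> x)"
    by (intro L2_mult L L2_inner_const test_functions_L2 gradient_L2 \<phi>)+
  have "(LBINT x. (u x + c * v x) * (gradient \<phi> x \<bullet> b))
      = (LBINT x. u x * (gradient \<phi> x \<bullet> b)) + c * (LBINT x. v x * (gradient \<phi> x \<bullet> b))"
    using i by (simp add: distrib_right mult.assoc)
  also have "\<dots> = - ((LBINT x. (G x \<bullet> b) * \<phi> x) + c * (LBINT x. (H x \<bullet> b) * \<phi> x))"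
    by (simp add: wgrad_directional[OF assms(1) \<phi>] wgrad_directional[OF assms(2) \<phi>])
  also have "\<dots> = - (LBINT x. (G x + c *\<^sub>R H x) \<bullet> b * \<phi> x)"
    using i by (simp add: inner_add_left distrib_right mult.assoc)
  finally show "(LBINT x. (u x + c * v x) * (gradient \<phi> x \<bullet> b)) = - (LBINT x. (G x + c *\<^sub>R H x) \<bullet> b * \<phi> x)" .
qed

section \<open>Translations and integration by parts\<close>

lemma integral_lborel_translate:
  fixes f :: "'a::euclidean_space \<Rightarrow> real"
  assumes [measurable]: "f \<in> borel_measurable borel"
  shows "(LBINT x. f (x + s)) = (LBINT x. f x)"
proof -
  have "(LBINT x. f x) = (LINT x|distr lborel borel ((+) s). f x)" by (simp add: lborel_distr_plus)
  also have "\<dots> = (LBINT x. f (s + x))" by (rule integral_distr) auto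
  finally show ?thesis by (simp add: add.commute)
qed

lemma integrable_lborel_translate:
  fixes f :: "'a::euclidean_space \<Rightarrow> real"
  assumes f: "integrable lborel f"
  shows "integrable lborel (\<lambda>x. f (x + s))"
proof -
  have "integrable (distr lborel borel ((+) s)) f" using f by (simp add: lborel_distr_plus)
  then show ?thesis by (subst (asm) integrable_distr_eq) (use f in \<open>auto simp: add.commute\<close>)
qed

lemma
  assumes f: "L2 lborel f"
  shows L2_translate: "L2 lborel (\<lambda>x. f (x + s))"
    and nsq_translate: "nsq lborel (\<lambda>x. f (x + s)) = nsq lborel f"
proof -
  have [measurable]: "f \<in> borel_measurable borel" using f by (simp add: L2_def)
  have "integrable lborel (\<lambda>x. (norm (f (x + s)))\<^sup>2)"
    by (rule integrable_lborel_translate) (use f in \<open>simp add: L2_def\<close>)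
  then show "L2 lborel (\<lambda>x. f (x + s))" by (simp add: L2_def)
  show "nsq lborel (\<lambda>x. f (x + s)) = nsq lborel f"
    by (rule integral_lborel_translate) measurable
qed

lemma gradient_translate:
  assumes "\<phi> \<in> test_functions"
  shows "gradient (\<lambda>x. \<phi> (x + s)) x = gradient \<phi> (x + s)"
proof -
  have "((\<lambda>x. \<phi> (x + s)) has_derivative frechet_derivative \<phi> (at (x + s))) (at x)"
    by (rule has_derivative_compose[OF _ test_functions_has_derivative[OF assms], of "\<lambda>x. x + s" "\<lambda>h. h", simplified])
      (auto intro!: derivative_eq_intros)
  from frechet_derivative_at[OF this] show ?thesis by (simp add: gradient_def)
qed

lemma wgrad_translate:
  assumes w: "wgrad u G"
  shows "wgrad (\<lambda>x. u (x + s)) (\<lambda>x. G (x + s))"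
  unfolding wgrad_def
proof (intro conjI ballI L2_translate wgradD[OF w])
  fix \<phi> :: "'a \<Rightarrow> real" and b :: 'a assume \<phi>: "\<phi> \<in> test_functions" and b: "b \<in> Basis"
  define \<psi> where "\<psi> = (\<lambda>x. \<phi> (x + (- s)))"
  have \<psi>: "\<psi> \<in> test_functions" unfolding \<psi>_def by (rule test_functions_translate[OF \<phi>])
  have [measurable]: "u \<in> borel_measurable borel" "G \<in> borel_measurable borel"
    "gradient \<psi> \<in> borel_measurable borel" "\<psi> \<in> borel_measurable borel"
    using wgradD[OF w] gradient_L2[OF \<psi>] test_functions_L2[OF \<psi>] by (auto simp: L2_def)
  have g: "gradient \<psi> (x + s) = gradient \<phi> x" for x
    unfolding \<psi>_def gradient_translate[OF \<phi>] by simp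
  have "(LBINT x. u (x + s) * (gradient \<phi> x \<bullet> b)) = (LBINT x. u (x + s) * (gradient \<psi> (x + s) \<bullet> b))"
    by (simp add: g)
  also have "\<dots> = (LBINT x. u x * (gradient \<psi> x \<bullet> b))"
    by (rule integral_lborel_translate) measurable
  also have "\<dots> = - (LBINT x. (G x \<bullet> b) * \<psi> x)" by (rule wgrad_directional[OF w \<psi>])
  also have "(LBINT x. (G x \<bullet> b) * \<psi> x) = (LBINT x. (G (x + s) \<bullet> b) * \<psi> (x + s))"
    by (rule integral_lborel_translate[symmetric]) measurable
  finally show "(LBINT x. u (x + s) * (gradient \<phi> x \<bullet> b)) = - (LBINT x. (G (x + s) \<bullet> b) * \<phi> x)"
    by (simp add: \<psi>_def)
qed

text \<open>Translation invariance makes the integral of \<phi> along the line through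
  \<open>h\<close> constant, and its derivative is the integral in question. With the product rule
  this yields integration by parts in \<open>wgrad_test_function\<close>.\<close>

lemma integral_gradient_test_function:
  assumes \<phi>: "\<phi> \<in> test_functions"
  shows "(LBINT x. gradient \<phi> x \<bullet> h) = 0"
proof -
  note [measurable] = test_functions_measurable[OF \<phi>]
  have "((\<lambda>s. LBINT x. 1 * \<phi> (x + s *\<^sub>R h)) has_real_derivative
      (LBINT x. 1 * (gradient \<phi> (x + 0 *\<^sub>R h) \<bullet> h))) (at 0)"
    by (rule has_derivative_integral_translate[OF \<phi>]) auto
  moreover have "(\<lambda>s. LBINT x. 1 * \<phi> (x + s *\<^sub>R h)) = (\<lambda>s. LBINT x. \<phi> x)"
    using integral_lborel_translate[of \<phi>] by auto
  ultimately show ?thesis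
    using DERIV_unique[OF _ DERIV_const] by fastforce
qed

lemma gradient_mult:
  assumes \<phi>: "\<phi> \<in> test_functions" and \<psi>: "\<psi> \<in> test_functions"
  shows "gradient (\<lambda>x. \<phi> x * \<psi> x) x = \<phi> x *\<^sub>R gradient \<psi> x + \<psi> x *\<^sub>R gradient \<phi> x"
proof -
  have "((\<lambda>x. \<phi> x * \<psi> x) has_derivative
      (\<lambda>h. \<phi> x * frechet_derivative \<psi> (at x) h + frechet_derivative \<phi> (at x) h * \<psi> x)) (at x)"
    by (intro has_derivative_mult test_functions_has_derivative \<phi> \<psi>)
  note eq = frechet_derivative_at[OF this, symmetric]
  show ?thesis
    unfolding gradient_def eq
    by (simp add: scaleR_sum_right sum.distrib scaleR_add_left mult.commute)
qed

lemma wgrad_test_function: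
  assumes \<phi>: "\<phi> \<in> test_functions"
  shows "wgrad \<phi> (gradient \<phi>)"
  unfolding wgrad_def
proof (intro conjI ballI test_functions_L2 gradient_L2 \<phi>)
  fix \<psi> :: "'a \<Rightarrow> real" and b :: 'a assume \<psi>: "\<psi> \<in> test_functions" and b: "b \<in> Basis"
  have i: "integrable lborel (\<lambda>x. \<phi> x * (gradient \<psi> x \<bullet> b))" "integrable lborel (\<lambda>x. (gradient \<phi> x \<bullet> b) * \<psi> x)"
    by (intro L2_mult L2_inner_const test_functions_L2 gradient_L2 \<phi> \<psi>)+
  have "0 = (LBINT x. gradient (\<lambda>x. \<phi> x * \<psi> x) x \<bullet> b)"
    by (rule integral_gradient_test_function[OF test_functions_mult[OF \<phi> \<psi>], symmetric])
  also have "\<dots> = (LBINT x. \<phi> x * (gradient \<psi> x \<bullet> b) + (gradient \<phi> x \<bullet> b) * \<psi> x)"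
    by (simp add: gradient_mult[OF \<phi> \<psi>] inner_add_left mult.commute)
  finally show "(LBINT x. \<phi> x * (gradient \<psi> x \<bullet> b)) = - (LBINT x. (gradient \<phi> x \<bullet> b) * \<psi> x)"
    using i by simp
qed

lemma L2_locally_integrable:
  fixes u :: "'a::euclidean_space \<Rightarrow> real"
  assumes "L2 lborel u"
  shows "integrable lborel (\<lambda>x. indicator (cball 0 R) x * u x)"
proof -
  have "(\<lambda>x::'a. (indicat_real (cball 0 R) x)\<^sup>2) = indicat_real (cball 0 R)"
    by (auto simp: indicator_def)
  moreover have "indicat_real (cball (0::'a) R) \<in> borel_measurable lborel"
    using borel_measurable_integrable[OF integrable_indicator_cball] .
  ultimately have "L2 lborel (indicat_real (cball (0::'a) R))" unfolding L2_def by simp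
  from L2_mult[OF this assms] show ?thesis .
qed

lemma norm_inner_const_nsq_le:
  assumes "L2 M G"
  shows "nsq M (\<lambda>x. G x \<bullet> h) \<le> (norm h)\<^sup>2 * nsq M G"
proof -
  have "nsq M (\<lambda>x. G x \<bullet> h) \<le> (LINT x|M. (norm h)\<^sup>2 * (norm (G x))\<^sup>2)"
  proof (rule integral_mono)
    show "integrable M (\<lambda>x. (norm (G x \<bullet> h))\<^sup>2)" using L2_inner_const[OF assms, of h] by (simp add: L2_def)
    show "integrable M (\<lambda>x. (norm h)\<^sup>2 * (norm (G x))\<^sup>2)" using assms by (simp add: L2_def)
    show "(norm (G x \<bullet> h))\<^sup>2 \<le> (norm h)\<^sup>2 * (norm (G x))\<^sup>2" for x
      using power_mono[OF Cauchy_Schwarz_ineq2[of "G x" h], of 2] by (simp add: power_mult_distrib mult.commute)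
  qed
  then show ?thesis by simp
qed

text \<open>By duality: pair the increment of \<open>u\<close> with a test function, move the
  translation onto that function, and apply the mean value theorem to the pairing. Smoothness is
  then needed of the test function only, and \<open>u\<close> is never approximated by smooth
  functions.\<close>

theorem wgrad_translation_estimate:
  assumes w: "wgrad u G"
  shows "nsq lborel (\<lambda>x. u (x + h) - u x) \<le> (norm h)\<^sup>2 * nsq lborel G"
proof -
  note L = wgradD[OF w]
  have [measurable]: "u \<in> borel_measurable borel" "G \<in> borel_measurable borel"
    using L by (auto simp: L2_def)
  define g where "g x = u (x + h) - u x" for x
  have g: "L2 lborel g" unfolding g_def by (intro L2_diff L2_translate L)
  define K where "K = sqrt ((norm h)\<^sup>2 * nsq lborel G)"
  have key: "ip lborel g \<phi> \<le> K * sqrt (nsq lborel \<phi>)" if \<phi>: "\<phi> \<in> test_functions" for \<phi> :: "'a \<Rightarrow> real"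
  proof -
    note [measurable] = test_functions_measurable[OF \<phi>]
    \<comment> \<open>Interpolates between the pairing with u at s = 0 and with its translate by
      \<open>h\<close> at s = 1.\<close>
    define F where "F s = (LBINT x. u x * \<phi> (x + s *\<^sub>R (- h)))" for s
    define F' where "F' s = (LBINT x. (G x \<bullet> h) * \<phi> (x + s *\<^sub>R (- h)))" for s
    have "(F has_real_derivative F' s) (at s)" for s
    proof -
      define \<psi> where "\<psi> x = \<phi> (x + s *\<^sub>R (- h))" for x
      have \<psi>: "\<psi> \<in> test_functions" unfolding \<psi>_def by (rule test_functions_translate[OF \<phi>])
      have "(F has_real_derivative (LBINT x. u x * (gradient \<phi> (x + s *\<^sub>R (- h)) \<bullet> (- h)))) (at s)"
        unfolding F_def by (rule has_derivative_integral_translate[OF \<phi> _ L2_locally_integrable[OF L(1)]]) measurable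
      also have "(LBINT x. u x * (gradient \<phi> (x + s *\<^sub>R (- h)) \<bullet> (- h))) = (LBINT x. u x * (gradient \<psi> x \<bullet> (- h)))"
        unfolding \<psi>_def gradient_translate[OF \<phi>] ..
      also have "\<dots> = F' s"
        using wgrad_directional[OF w \<psi>, of "- h"] by (simp add: F'_def \<psi>_def)
      finally show ?thesis .
    qed
    from MVT2[of 0 1 F F', OF zero_less_one this] obtain s where s: "F 1 - F 0 = F' s" by auto
    have "ip lborel g \<phi> = F 1 - F 0"
    proof -
      have "F 1 = (LBINT x. u (x + h) * \<phi> (x + h + 1 *\<^sub>R (- h)))"
        unfolding F_def by (rule integral_lborel_translate[symmetric]) measurable
      then show ?thesis
        using L2_mult[OF L2_translate[OF L(1)] test_functions_L2[OF \<phi>], of h] L2_mult[OF L(1) test_functions_L2[OF \<phi>]]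
        by (simp add: F_def g_def left_diff_distrib)
    qed
    also have "\<dots> = F' s" by (rule s)
    also have "\<dots> \<le> sqrt (nsq lborel (\<lambda>x. G x \<bullet> h)) * sqrt (nsq lborel (\<lambda>x. \<phi> (x + s *\<^sub>R (- h))))"
      unfolding F'_def using ip_abs_le[OF L2_inner_const[OF L(2)] L2_translate[OF test_functions_L2[OF \<phi>]], of h "s *\<^sub>R (- h)"]
      by simp
    also have "nsq lborel (\<lambda>x. \<phi> (x + s *\<^sub>R (- h))) = nsq lborel \<phi>"
      by (rule nsq_translate[OF test_functions_L2[OF \<phi>]])
    also have "sqrt (nsq lborel (\<lambda>x. G x \<bullet> h)) * sqrt (nsq lborel \<phi>) \<le> K * sqrt (nsq lborel \<phi>)"
      unfolding K_def by (intro mult_right_mono real_sqrt_le_mono norm_inner_const_nsq_le L) auto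
    finally show ?thesis .
  qed
  \<comment> \<open>Letting the test functions tend to \<open>g\<close> itself turns the linear
    bound into \<bar>g\<bar>^2 \<le> K \<bar>g\<bar> for the L2 norm.\<close>
  obtain \<phi> where \<phi>: "\<And>n. \<phi> n \<in> test_functions" "(\<lambda>n. nsq lborel (\<lambda>x. \<phi> n x - g x)) \<longlonglongrightarrow> 0"
    using test_functions_dense[OF g] by (elim exE conjE) (rule that, rule spec)
  have "(\<lambda>n. ip lborel g (\<phi> n)) \<longlonglongrightarrow> ip lborel g g"
    using tendsto_ip_left[of lborel \<phi>, OF test_functions_L2[OF \<phi>(1)] g g \<phi>(2)] by (simp add: mult.commute)
  moreover have "(\<lambda>n. K * sqrt (nsq lborel (\<phi> n))) \<longlonglongrightarrow> K * sqrt (nsq lborel g)"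
    by (intro tendsto_mult tendsto_const tendsto_real_sqrt tendsto_nsq[of lborel \<phi>, OF test_functions_L2[OF \<phi>(1)] g \<phi>(2)])
  ultimately have "ip lborel g g \<le> K * sqrt (nsq lborel g)"
    by (rule LIMSEQ_le) (use key \<phi>(1) in blast)
  then have *: "sqrt (nsq lborel g) * sqrt (nsq lborel g) \<le> K * sqrt (nsq lborel g)"
    by (simp add: power2_eq_square)
  have "K \<ge> 0" by (simp add: K_def)
  have "sqrt (nsq lborel g) \<le> K"
  proof (cases "sqrt (nsq lborel g) > 0")
    case True
    from mult_right_le_imp_le[OF * True] show ?thesis .
  next
    case False
    then show ?thesis using \<open>K \<ge> 0\<close> by linarith
  qed
  then have "nsq lborel g \<le> (norm h)\<^sup>2 * nsq lborel G" unfolding K_def by simp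
  then show ?thesis by (simp add: g_def)
qed

section \<open>Averages over small cubes and the cubic integral\<close>

text \<open>The uniform probability measure on the cube. The scale of an average enters through the
  integrand, so Jensen's inequality and Tonelli's theorem always concern this one measure.\<close>

definition unit_cube :: "'a::euclidean_space measure" where
  "unit_cube = density lborel (indicator (cbox 0 One))"

lemma sets_unit_cube [measurable_cong, simp]: "sets unit_cube = sets borel"
  by (simp add: unit_cube_def)

lemma space_unit_cube [simp]: "space unit_cube = UNIV"
  by (simp add: unit_cube_def)

lemma emeasure_unit_cube: "emeasure (unit_cube :: 'a::euclidean_space measure) UNIV = 1"
  by (simp add: unit_cube_def emeasure_density emeasure_lborel_cbox_eq inner_diff_left)

lemma measure_unit_cube [simp]: "measure unit_cube UNIV = 1"
  by (simp add: measure_def emeasure_unit_cube)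

interpretation unit_cube: finite_measure unit_cube
  by standard (simp add: emeasure_unit_cube)

lemma unit_cube_integral_const: "(LINT h|unit_cube. c) = (c::real)"
  by (simp add: measure_def emeasure_unit_cube)

lemma AE_unit_cube_norm_le: "AE h in (unit_cube :: 'a::euclidean_space measure). norm h \<le> real DIM('a)"
  unfolding unit_cube_def
proof (subst AE_density, simp, rule AE_I2, rule impI)
  fix h :: 'a assume "0 < (indicator (cbox 0 One) h :: ennreal)"
  then have h: "h \<in> cbox 0 One" by (cases "h \<in> cbox 0 One") auto
  have "norm h \<le> (\<Sum>b\<in>Basis. \<bar>h \<bullet> b\<bar>)" by (rule norm_le_l1)
  also have "\<dots> \<le> (\<Sum>b\<in>(Basis::'a set). 1)" using h by (intro sum_mono) (auto simp: mem_box)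
  finally show "norm h \<le> real DIM('a)" by simp
qed

lemma unit_cube_L2_integrable:
  fixes f :: "'a::euclidean_space \<Rightarrow> real"
  assumes "L2 unit_cube f"
  shows "integrable unit_cube f"
proof (rule unit_cube.square_integrable_imp_integrable)
  show "f \<in> borel_measurable unit_cube" "integrable unit_cube (\<lambda>x. (f x)\<^sup>2)"
    using assms by (simp_all add: L2_def)
qed

lemma unit_cube_Jensen:
  fixes f :: "'a::euclidean_space \<Rightarrow> real"
  assumes "L2 unit_cube f"
  shows "(LINT h|unit_cube. f h)\<^sup>2 \<le> nsq unit_cube f"
proof -
  have "L2 unit_cube (\<lambda>_::'a. 1::real)" by (simp add: L2_def)
  from ip_Cauchy_Schwarz[OF assms this] show ?thesis by (simp add: unit_cube_integral_const)
qed

text \<open>The mean over the cube of side \<open>r\<close> that has \<open>x\<close> as its lowest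
  corner, not as its centre.\<close>

definition avg :: "real \<Rightarrow> ('a::euclidean_space \<Rightarrow> real) \<Rightarrow> 'a \<Rightarrow> real" where
  "avg r u x = (LINT h|unit_cube. u (x + r *\<^sub>R h))"

lemma nn_integral_lborel_affine:
  fixes f :: "'a::euclidean_space \<Rightarrow> ennreal"
  assumes [measurable]: "f \<in> borel_measurable borel" and r: "r > 0"
  shows "(\<integral>\<^sup>+x. f x \<partial>lborel) = ennreal (r ^ DIM('a)) * (\<integral>\<^sup>+h. f (x + r *\<^sub>R h) \<partial>lborel)"
  using r by (subst lborel_affine[of r x])
    (simp_all add: nn_integral_density nn_integral_distr nn_integral_cmult)

lemma
  fixes u :: "'a::euclidean_space \<Rightarrow> real"
  assumes u: "L2 lborel u" and r: "r > 0"
  shows L2_unit_cube_affine: "L2 unit_cube (\<lambda>h. u (x + r *\<^sub>R h))"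
    and nsq_unit_cube_affine_le: "nsq unit_cube (\<lambda>h. u (x + r *\<^sub>R h)) \<le> nsq lborel u / r ^ DIM('a)"
proof -
  have [measurable]: "u \<in> borel_measurable borel" using u by (simp add: L2_def)
  have "(\<integral>\<^sup>+h. ennreal ((norm (u (x + r *\<^sub>R h)))\<^sup>2) \<partial>unit_cube)
      = (\<integral>\<^sup>+h. indicator (cbox 0 One) h * ennreal ((norm (u (x + r *\<^sub>R h)))\<^sup>2) \<partial>lborel)"
    unfolding unit_cube_def by (subst nn_integral_density) auto
  also have "\<dots> \<le> (\<integral>\<^sup>+h. ennreal ((norm (u (x + r *\<^sub>R h)))\<^sup>2) \<partial>lborel)"
    by (intro nn_integral_mono) (auto simp: indicator_def)
  also have "\<dots> = ennreal (1 / r ^ DIM('a)) * (ennreal (r ^ DIM('a)) * (\<integral>\<^sup>+h. ennreal ((norm (u (x + r *\<^sub>R h)))\<^sup>2) \<partial>lborel))"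
    using r by (simp add: mult.assoc[symmetric] ennreal_mult[symmetric])
  also have "\<dots> = ennreal (1 / r ^ DIM('a)) * (\<integral>\<^sup>+x. ennreal ((norm (u x))\<^sup>2) \<partial>lborel)"
    by (subst nn_integral_lborel_affine[OF _ r, of "\<lambda>x. ennreal ((norm (u x))\<^sup>2)" x]) auto
  also have "\<dots> = ennreal (nsq lborel u / r ^ DIM('a))"
    unfolding nsq_eq_nn_integral[OF u] using r by (simp add: ennreal_mult[symmetric])
  finally have *: "(\<integral>\<^sup>+h. ennreal ((norm (u (x + r *\<^sub>R h)))\<^sup>2) \<partial>unit_cube) \<le> ennreal (nsq lborel u / r ^ DIM('a))" .
  show "L2 unit_cube (\<lambda>h. u (x + r *\<^sub>R h))" "nsq unit_cube (\<lambda>h. u (x + r *\<^sub>R h)) \<le> nsq lborel u / r ^ DIM('a)"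
    using L2_nn_integralI[OF _ *] r by auto
qed

lemma avg_square_le:
  assumes "L2 lborel (u :: 'a::euclidean_space \<Rightarrow> real)" "r > 0"
  shows "(avg r u x)\<^sup>2 \<le> nsq lborel u / r ^ DIM('a)"
  unfolding avg_def
  using unit_cube_Jensen[OF L2_unit_cube_affine[OF assms]] nsq_unit_cube_affine_le[OF assms]
  by (rule order_trans)

lemma avg_integrable:
  fixes u :: "'a::euclidean_space \<Rightarrow> real"
  assumes "L2 lborel u" "r > 0"
  shows "integrable unit_cube (\<lambda>h. u (x + r *\<^sub>R h))"
  by (rule unit_cube_L2_integrable[OF L2_unit_cube_affine[OF assms]])

lemma avg_diff:
  assumes "L2 lborel u" "L2 lborel v" "r > 0"
  shows "avg r (\<lambda>x. u x - v x) x = avg r u x - avg r v x"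
  unfolding avg_def using avg_integrable[OF assms(1,3)] avg_integrable[OF assms(2,3)] by simp

lemma avg_translate: "avg r (\<lambda>x. u (x + k)) x = avg r u (x + k)"
  by (simp add: avg_def add_ac)

lemma avg_measurable:
  assumes [measurable]: "u \<in> borel_measurable borel"
  shows "avg r u \<in> borel_measurable borel"
  unfolding avg_def[abs_def] by measurable

text \<open>Jensen's inequality bounds the squared deviation by the mean of squared increments;
  after exchanging the integrals, the translation estimate applies for each shift
  separately.\<close>

lemma
  fixes u :: "'a::euclidean_space \<Rightarrow> real"
  assumes w: "wgrad u G" and r: "r > 0"
  shows L2_avg_diff: "L2 lborel (\<lambda>x. avg r u x - u x)"
    and nsq_avg_diff_le: "nsq lborel (\<lambda>x. avg r u x - u x) \<le> (real DIM('a))\<^sup>2 * r\<^sup>2 * nsq lborel G"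
proof -
  note L = wgradD[OF w]
  have [measurable]: "u \<in> borel_measurable borel" using L by (simp add: L2_def)
  note [measurable] = avg_measurable[OF this]
  interpret P: pair_sigma_finite lborel "unit_cube :: 'a measure" ..
  have pt: "ennreal ((norm (avg r u x - u x))\<^sup>2) \<le> (\<integral>\<^sup>+h. ennreal ((norm (u (x + r *\<^sub>R h) - u x))\<^sup>2) \<partial>unit_cube)" for x
  proof -
    have c: "L2 unit_cube (\<lambda>h::'a. u x)" by (simp add: L2_def)
    have d: "L2 unit_cube (\<lambda>h. u (x + r *\<^sub>R h) - u x)" by (intro L2_diff L2_unit_cube_affine L r c)
    have "avg r u x - u x = (LINT h|unit_cube. u (x + r *\<^sub>R h) - u x)"
      using avg_integrable[OF L(1) r, of x] by (simp add: avg_def unit_cube_integral_const)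
    then have "(avg r u x - u x)\<^sup>2 \<le> nsq unit_cube (\<lambda>h. u (x + r *\<^sub>R h) - u x)"
      using unit_cube_Jensen[OF d] by simp
    then show ?thesis unfolding nsq_eq_nn_integral[OF d] by (simp add: ennreal_leI)
  qed
  have "(\<integral>\<^sup>+x. ennreal ((norm (avg r u x - u x))\<^sup>2) \<partial>lborel)
      \<le> (\<integral>\<^sup>+x. (\<integral>\<^sup>+h. ennreal ((norm (u (x + r *\<^sub>R h) - u x))\<^sup>2) \<partial>unit_cube) \<partial>lborel)"
    by (intro nn_integral_mono pt)
  also have "\<dots> = (\<integral>\<^sup>+h. (\<integral>\<^sup>+x. ennreal ((norm (u (x + r *\<^sub>R h) - u x))\<^sup>2) \<partial>lborel) \<partial>unit_cube)"
    by (rule P.Fubini'[symmetric]) measurable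
  also have "\<dots> \<le> (\<integral>\<^sup>+h. ennreal ((real DIM('a))\<^sup>2 * r\<^sup>2 * nsq lborel G) \<partial>(unit_cube :: 'a measure))"
  proof (rule nn_integral_mono_AE, use AE_unit_cube_norm_le in eventually_elim)
    fix h :: 'a assume h: "norm h \<le> real DIM('a)"
    have "nsq lborel (\<lambda>x. u (x + r *\<^sub>R h) - u x) \<le> (norm (r *\<^sub>R h))\<^sup>2 * nsq lborel G"
      by (rule wgrad_translation_estimate[OF w])
    also have "\<dots> \<le> (real DIM('a))\<^sup>2 * r\<^sup>2 * nsq lborel G"
      using mult_left_mono[OF power_mono[OF h, of 2], of "r\<^sup>2"]
      by (intro mult_right_mono) (auto simp: power_mult_distrib mult.commute)
    finally show "(\<integral>\<^sup>+x. ennreal ((norm (u (x + r *\<^sub>R h) - u x))\<^sup>2) \<partial>lborel) \<le> ennreal ((real DIM('a))\<^sup>2 * r\<^sup>2 * nsq lborel G)"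
      by (subst nsq_eq_nn_integral[OF L2_diff[OF L2_translate[OF L(1)] L(1)]]) (rule ennreal_leI)
  qed
  also have "\<dots> = ennreal ((real DIM('a))\<^sup>2 * r\<^sup>2 * nsq lborel G)"
    by (simp add: emeasure_unit_cube)
  finally have *: "(\<integral>\<^sup>+x. ennreal ((norm (avg r u x - u x))\<^sup>2) \<partial>lborel) \<le> ennreal ((real DIM('a))\<^sup>2 * r\<^sup>2 * nsq lborel G)" .
  show "L2 lborel (\<lambda>x. avg r u x - u x)" "nsq lborel (\<lambda>x. avg r u x - u x) \<le> (real DIM('a))\<^sup>2 * r\<^sup>2 * nsq lborel G"
    using L2_nn_integralI[OF _ *] by auto
qed

lemma L2_avg:
  assumes "wgrad u G" "r > 0"
  shows "L2 lborel (avg r u)"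
  using L2_add[OF L2_avg_diff[OF assms] wgradD(1)[OF assms(1)]] by simp

text \<open>Averaging commutes with translation, so the pointwise bound for averages can be applied
  to the increment of \<open>u\<close>, whose L2 norm is controlled by the gradient.\<close>

lemma avg_translation_estimate:
  fixes u :: "'a::euclidean_space \<Rightarrow> real"
  assumes w: "wgrad u G" and r: "r > 0"
  shows "(avg r u (x + k) - avg r u x)\<^sup>2 \<le> (norm k)\<^sup>2 * nsq lborel G / r ^ DIM('a)"
proof -
  note L = wgradD[OF w]
  have "avg r u (x + k) - avg r u x = avg r (\<lambda>x. u (x + k) - u x) x"
    using avg_diff[OF L2_translate[OF L(1)] L(1) r] by (simp add: avg_translate)
  then have "(avg r u (x + k) - avg r u x)\<^sup>2 \<le> nsq lborel (\<lambda>x. u (x + k) - u x) / r ^ DIM('a)"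
    using avg_square_le[OF L2_diff[OF L2_translate[OF L(1)] L(1)] r] by simp
  also have "\<dots> \<le> (norm k)\<^sup>2 * nsq lborel G / r ^ DIM('a)"
    using wgrad_translation_estimate[OF w] r by (intro divide_right_mono) auto
  finally show ?thesis .
qed

lemma avg_avg_diff_le:
  fixes u :: "'a::euclidean_space \<Rightarrow> real"
  assumes w: "wgrad u G" and r: "r > 0" and s: "s > 0"
  shows "\<bar>avg r (avg s u) x - avg s u x\<bar> \<le> real DIM('a) * r * sqrt (nsq lborel G / s ^ DIM('a))"
proof -
  have i: "integrable unit_cube (\<lambda>h. avg s u (x + r *\<^sub>R h))"
    by (rule avg_integrable[OF L2_avg[OF w s] r])
  have "avg r (avg s u) x - avg s u x = (LINT h|unit_cube. avg s u (x + r *\<^sub>R h) - avg s u x)"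
    using i by (simp add: avg_def[of r] unit_cube_integral_const)
  also have "\<bar>\<dots>\<bar> \<le> (LINT h|unit_cube. \<bar>avg s u (x + r *\<^sub>R h) - avg s u x\<bar>)"
    using integral_norm_bound[of unit_cube "\<lambda>h. avg s u (x + r *\<^sub>R h) - avg s u x"] by simp
  also have "\<dots> \<le> (LINT h|(unit_cube::'a measure). real DIM('a) * r * sqrt (nsq lborel G / s ^ DIM('a)))"
  proof (rule integral_mono_AE)
    show "integrable unit_cube (\<lambda>h. \<bar>avg s u (x + r *\<^sub>R h) - avg s u x\<bar>)"
      using i by (intro integrable_abs Bochner_Integration.integrable_diff) auto
    show "AE h in unit_cube. \<bar>avg s u (x + r *\<^sub>R h) - avg s u x\<bar> \<le> real DIM('a) * r * sqrt (nsq lborel G / s ^ DIM('a))"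
      using AE_unit_cube_norm_le
    proof eventually_elim
      case (elim h)
      have "\<bar>avg s u (x + r *\<^sub>R h) - avg s u x\<bar> \<le> sqrt ((norm (r *\<^sub>R h))\<^sup>2 * (nsq lborel G / s ^ DIM('a)))"
        using real_sqrt_le_mono[OF avg_translation_estimate[OF w s, of x "r *\<^sub>R h"]] by simp
      also have "\<dots> = norm h * r * sqrt (nsq lborel G / s ^ DIM('a))"
        using r by (simp only: real_sqrt_mult real_sqrt_abs norm_scaleR abs_norm_cancel abs_of_pos mult.commute[of r] abs_mult)
      also have "\<dots> \<le> real DIM('a) * r * sqrt (nsq lborel G / s ^ DIM('a))"
        using elim r s by (intro mult_right_mono) auto
      finally show ?case .
    qed
  qed auto
  finally show ?thesis by (simp add: unit_cube_integral_const)
qed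

text \<open>Both averages are compared with the double average: \<open>avg r u\<close> through the
  L2 distance of \<open>avg s u\<close> from \<open>u\<close>, and \<open>avg s u\<close> through
  its own Lipschitz bound.\<close>

lemma avg_diff_sup_le:
  fixes u :: "'a::euclidean_space \<Rightarrow> real"
  assumes w: "wgrad u G" and r: "r > 0" and s: "s > 0"
  shows "\<bar>avg r u x - avg s u x\<bar>
    \<le> real DIM('a) * s * sqrt (nsq lborel G / r ^ DIM('a)) + real DIM('a) * r * sqrt (nsq lborel G / s ^ DIM('a))"
proof -
  note L = wgradD[OF w]
  have "(avg r (\<lambda>x. avg s u x - u x) x)\<^sup>2 \<le> nsq lborel (\<lambda>x. avg s u x - u x) / r ^ DIM('a)"
    by (rule avg_square_le[OF L2_avg_diff[OF w s] r])
  also have "\<dots> \<le> (real DIM('a))\<^sup>2 * s\<^sup>2 * nsq lborel G / r ^ DIM('a)"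
    using nsq_avg_diff_le[OF w s] r by (intro divide_right_mono) auto
  also have "\<dots> = (real DIM('a) * s)\<^sup>2 * (nsq lborel G / r ^ DIM('a))"
    by (simp add: power_mult_distrib)
  finally have "sqrt ((avg r (\<lambda>x. avg s u x - u x) x)\<^sup>2) \<le> sqrt ((real DIM('a) * s)\<^sup>2 * (nsq lborel G / r ^ DIM('a)))"
    by (rule real_sqrt_le_mono)
  then have "\<bar>avg r (\<lambda>x. avg s u x - u x) x\<bar> \<le> real DIM('a) * s * sqrt (nsq lborel G / r ^ DIM('a))"
    using s by (simp only: real_sqrt_mult[of "(_)\<^sup>2"] real_sqrt_abs abs_mult abs_of_nat abs_of_pos)
  moreover have "avg r (\<lambda>x. avg s u x - u x) x = avg r (avg s u) x - avg r u x"
    by (rule avg_diff[OF L2_avg[OF w s] L(1) r])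
  ultimately show ?thesis using avg_avg_diff_le[OF w r s, of x] by linarith
qed

section \<open>The cubic integral between consecutive scales\<close>

lemma cube_add_le: "\<bar>a + b\<bar> ^ 3 \<le> 4 * \<bar>a\<bar> ^ 3 + 4 * \<bar>b :: real\<bar> ^ 3"
proof -
  have *: "(s + t) ^ 3 \<le> 4 * s ^ 3 + 4 * t ^ 3" if "s \<ge> 0" "t \<ge> 0" for s t :: real
  proof -
    have "4 * s ^ 3 + 4 * t ^ 3 - (s + t) ^ 3 = 3 * (s + t) * (s - t)\<^sup>2"
      by (simp add: power3_eq_cube power2_eq_square algebra_simps)
    moreover have "3 * (s + t) * (s - t)\<^sup>2 \<ge> 0" using that by simp
    ultimately show ?thesis by linarith
  qed
  have "\<bar>a + b\<bar> ^ 3 \<le> (\<bar>a\<bar> + \<bar>b\<bar>) ^ 3" by (intro power_mono) auto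
  also have "\<dots> \<le> 4 * \<bar>a\<bar> ^ 3 + 4 * \<bar>b\<bar> ^ 3" by (rule *) auto
  finally show ?thesis .
qed

lemma four_ennreal_add:
  "a \<ge> 0 \<Longrightarrow> b \<ge> 0 \<Longrightarrow> 4 * ennreal a + 4 * ennreal b = ennreal (4 * a + 4 * b)"
  by (simp add: ennreal_plus ennreal_mult)

lemma nn_integral_cube_add_le:
  fixes f g :: "'a \<Rightarrow> real"
  assumes [measurable]: "f \<in> borel_measurable M" "g \<in> borel_measurable M"
  shows "(\<integral>\<^sup>+x. ennreal (\<bar>f x + g x\<bar> ^ 3) \<partial>M)
    \<le> 4 * (\<integral>\<^sup>+x. ennreal (\<bar>f x\<bar> ^ 3) \<partial>M) + 4 * (\<integral>\<^sup>+x. ennreal (\<bar>g x\<bar> ^ 3) \<partial>M)"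
proof -
  have "(\<integral>\<^sup>+x. ennreal (\<bar>f x + g x\<bar> ^ 3) \<partial>M) \<le> (\<integral>\<^sup>+x. 4 * ennreal (\<bar>f x\<bar> ^ 3) + 4 * ennreal (\<bar>g x\<bar> ^ 3) \<partial>M)"
  proof (rule nn_integral_mono)
    fix x
    have "ennreal (\<bar>f x + g x\<bar> ^ 3) \<le> ennreal (4 * \<bar>f x\<bar> ^ 3 + 4 * \<bar>g x\<bar> ^ 3)"
      by (intro ennreal_leI cube_add_le)
    also have "\<dots> = 4 * ennreal (\<bar>f x\<bar> ^ 3) + 4 * ennreal (\<bar>g x\<bar> ^ 3)"
      by (simp add: ennreal_plus ennreal_mult)
    finally show "ennreal (\<bar>f x + g x\<bar> ^ 3) \<le> 4 * ennreal (\<bar>f x\<bar> ^ 3) + 4 * ennreal (\<bar>g x\<bar> ^ 3)" .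
  qed
  also have "\<dots> = 4 * (\<integral>\<^sup>+x. ennreal (\<bar>f x\<bar> ^ 3) \<partial>M) + 4 * (\<integral>\<^sup>+x. ennreal (\<bar>g x\<bar> ^ 3) \<partial>M)"
    by (simp add: nn_integral_add nn_integral_cmult)
  finally show ?thesis .
qed

lemma nn_integral_cube_sup_le:
  assumes f: "L2 M f" and b: "\<And>x. \<bar>f x\<bar> \<le> B" and B: "B \<ge> 0" and C: "nsq M f \<le> C"
  shows "(\<integral>\<^sup>+x. ennreal (\<bar>f x :: real\<bar> ^ 3) \<partial>M) \<le> ennreal (B * C)"
proof -
  have [measurable]: "f \<in> borel_measurable M" using f by (simp add: L2_def)
  have "(\<integral>\<^sup>+x. ennreal (\<bar>f x\<bar> ^ 3) \<partial>M) \<le> (\<integral>\<^sup>+x. ennreal B * ennreal ((norm (f x))\<^sup>2) \<partial>M)"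
  proof (rule nn_integral_mono)
    fix x
    have "\<bar>f x\<bar> ^ 3 = \<bar>f x\<bar> * (norm (f x))\<^sup>2" by (simp add: power3_eq_cube power2_eq_square)
    also have "\<dots> \<le> B * (norm (f x))\<^sup>2" by (intro mult_right_mono b) simp
    finally show "ennreal (\<bar>f x\<bar> ^ 3) \<le> ennreal B * ennreal ((norm (f x))\<^sup>2)"
      using B by (simp add: ennreal_mult[symmetric] ennreal_leI)
  qed
  also have "\<dots> = ennreal (B * nsq M f)"
    using B by (simp add: nn_integral_cmult nsq_eq_nn_integral[OF f, simplified] ennreal_mult)
  also have "\<dots> \<le> ennreal (B * C)" using B C by (intro ennreal_leI mult_left_mono)
  finally show ?thesis .
qed

text \<open>The scales \<open>64\<^sup>-\<^sup>j\<close> are so coarse that the elementary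
  \<open>\<bar>a + b\<bar>\<^sup>3 \<le> 4\<bar>a\<bar>\<^sup>3 + 4\<bar>b\<bar>\<^sup>3\<close> can replace Minkowski's inequality in \<open>L\<^sup>3\<close>.\<close>

definition dyadic_avg :: "nat \<Rightarrow> ('a::euclidean_space \<Rightarrow> real) \<Rightarrow> 'a \<Rightarrow> real" where
  "dyadic_avg j = avg ((1/64) ^ j)"

text \<open>For r = 64^(-j) in dimension 5 the general bound is of order r * r^(-5/2) = r^(-3/2),
  which is 8^(3j).\<close>

lemma dyadic_avg_diff_sup_le:
  fixes u :: "'a::euclidean_space \<Rightarrow> real"
  assumes w: "wgrad u G" and dim: "DIM('a) = 5"
  shows "\<bar>dyadic_avg (Suc j) u x - dyadic_avg j u x\<bar> \<le> 200000 * 8 ^ (3 * j) * sqrt (nsq lborel G)"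
proof -
  define g where "g = sqrt (nsq lborel G)"
  have g: "g \<ge> 0" by (simp add: g_def)
  \<comment> \<open>This is r^(-1/2), so that every half-integer power of the scale becomes an
    integer power of \<open>e\<close>.\<close>
  define e :: real where "e = 8 ^ j"
  have e: "e > 0" by (simp add: e_def)
  have r: "(1/64::real) ^ j = 1 / e\<^sup>2" "(1/64::real) ^ Suc j = 1 / (64 * e\<^sup>2)"
    using power_mult[of "8::real" 2 j] power_mult[of "8::real" j 2]
    by (simp_all add: e_def power_divide mult.commute)
  have sq: "sqrt (nsq lborel G / (1 / c\<^sup>2) ^ 5) = g * c ^ 5" if "c > 0" for c
  proof -
    have "nsq lborel G / (1 / c\<^sup>2) ^ 5 = nsq lborel G * (c ^ 5)\<^sup>2"
      by (simp add: power_divide power_mult[symmetric] mult.commute)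
    then show ?thesis using that by (simp only: real_sqrt_mult real_sqrt_abs g_def) simp
  qed
  have "\<bar>dyadic_avg (Suc j) u x - dyadic_avg j u x\<bar>
      \<le> 5 * (1 / e\<^sup>2) * sqrt (nsq lborel G / (1 / (64 * e\<^sup>2)) ^ 5) + 5 * (1 / (64 * e\<^sup>2)) * sqrt (nsq lborel G / (1 / e\<^sup>2) ^ 5)"
    using avg_diff_sup_le[OF w, of "(1/64) ^ Suc j" "(1/64) ^ j" x] e
    unfolding dyadic_avg_def dim r by simp
  also have "64 * e\<^sup>2 = (8 * e)\<^sup>2" by (simp add: power2_eq_square)
  also have "5 * (1 / e\<^sup>2) * sqrt (nsq lborel G / (1 / (8 * e)\<^sup>2) ^ 5) + 5 * (1 / (8 * e)\<^sup>2) * sqrt (nsq lborel G / (1 / e\<^sup>2) ^ 5)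
      = 5 * (1 / e\<^sup>2) * (g * (8 * e) ^ 5) + 5 * (1 / (8 * e)\<^sup>2) * (g * e ^ 5)"
    using e by (simp only: sq mult_pos_pos zero_less_numeral)
  also have "\<dots> = (5 * 8 ^ 5 + 5 / 64) * (g * e ^ 3)"
    using e by (simp add: field_simps power2_eq_square eval_nat_numeral)
  \<comment> \<open>The exact constant is 163840 + 5/64, rounded up.\<close>
  also have "\<dots> \<le> 200000 * (g * e ^ 3)" using g e by (intro mult_right_mono) auto
  also have "e ^ 3 = 8 ^ (3 * j)" by (simp add: e_def power_mult[symmetric] mult.commute)
  finally show ?thesis by (simp add: g_def mult_ac)
qed

text \<open>Both averages are compared with \<open>u\<close>. Each comparison costs 25 r^2 with 25
  the squared dimension, and doubling in the sum of squares gives 100; r^2 is 8^(-4j).\<close>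

lemma dyadic_avg_diff_nsq_le:
  fixes u :: "'a::euclidean_space \<Rightarrow> real"
  assumes w: "wgrad u G" and dim: "DIM('a) = 5"
  shows "L2 lborel (\<lambda>x. dyadic_avg (Suc j) u x - dyadic_avg j u x)"
    "nsq lborel (\<lambda>x. dyadic_avg (Suc j) u x - dyadic_avg j u x) \<le> 100 * (1/8) ^ (4 * j) * nsq lborel G"
proof -
  have r: "(1/64::real) ^ j > 0" "(1/64::real) ^ Suc j > 0" for j by auto
  note D = L2_avg_diff[OF w r(1), of j] L2_avg_diff[OF w r(1), of "Suc j"]
  let ?f = "\<lambda>j x. avg ((1/64) ^ j) u x - u x"
  have eq: "dyadic_avg (Suc j) u x - dyadic_avg j u x = ?f (Suc j) x + (- 1) *\<^sub>R ?f j x" for x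
    by (simp add: dyadic_avg_def)
  show "L2 lborel (\<lambda>x. dyadic_avg (Suc j) u x - dyadic_avg j u x)"
    unfolding eq by (rule L2_add_scaleR[OF D(2,1)])
  have *: "nsq lborel (?f i) \<le> 25 * ((1/8) ^ (4 * j) * nsq lborel G)" if "j \<le> i" for i
  proof -
    have "nsq lborel (?f i) \<le> 25 * ((1/64) ^ i)\<^sup>2 * nsq lborel G"
      using nsq_avg_diff_le[OF w r(1), of i] unfolding dim by simp
    also have "\<dots> \<le> 25 * ((1/64) ^ j)\<^sup>2 * nsq lborel G"
      using power_decreasing[OF that, of "1/64::real"] by (intro mult_right_mono mult_left_mono power_mono) auto
    also have "((1/64) ^ j)\<^sup>2 = (1/8::real) ^ (4 * j)"
    proof -
      have "(1/64::real) ^ j = (1/8) ^ (2 * j)"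
        using power_mult[of "1/8::real" 2 j] by (simp add: power2_eq_square)
      then have "((1/64) ^ j)\<^sup>2 = (1/8::real) ^ (2 * j * 2)" by (simp only: power_mult)
      then show ?thesis by (simp add: mult.commute mult.left_commute)
    qed
    finally show ?thesis by simp
  qed
  have "nsq lborel (\<lambda>x. ?f (Suc j) x + (- 1) *\<^sub>R ?f j x) \<le> 2 * nsq lborel (?f (Suc j)) + 2 * nsq lborel (\<lambda>x. (- 1) *\<^sub>R ?f j x)"
    by (rule nsq_add_le[OF D(2) L2_scaleR[OF D(1)]])
  also have "nsq lborel (\<lambda>x. (- 1) *\<^sub>R ?f j x) = nsq lborel (?f j)" unfolding nsq_scaleR by simp
  finally show "nsq lborel (\<lambda>x. dyadic_avg (Suc j) u x - dyadic_avg j u x) \<le> 100 * (1/8) ^ (4 * j) * nsq lborel G"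
    unfolding eq using *[of j, OF order_refl] *[of "Suc j", OF le_SucI[OF order_refl]] by linarith
qed

lemma dyadic_avg_measurable:
  assumes "u \<in> borel_measurable borel"
  shows "dyadic_avg j u \<in> borel_measurable borel"
  unfolding dyadic_avg_def by (rule avg_measurable[OF assms])

text \<open>Downward induction from \<open>J\<close>, with a bound independent of \<open>J\<close>.
  The sup and L2 estimates multiply to (C/8) 8^(-j), so the constant is 8 * 200000 * 100. In the
  step both summands become half of the claim: 4 * (C/8) 8^(-j) each.\<close>

lemma dyadic_avg_cube_le:
  fixes u :: "'a::euclidean_space \<Rightarrow> real"
  assumes w: "wgrad u G" and dim: "DIM('a) = 5" and "j \<le> J"
  defines "C \<equiv> 160000000 * sqrt (nsq lborel G) ^ 3"
  shows "(\<integral>\<^sup>+x. ennreal (\<bar>dyadic_avg J u x - dyadic_avg j u x\<bar> ^ 3) \<partial>lborel) \<le> ennreal (C * (1/8) ^ j)"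
  using \<open>j \<le> J\<close>
proof (induction rule: inc_induct)
  case base
  show ?case by simp
next
  case (step j)
  have [measurable]: "u \<in> borel_measurable borel" using wgradD[OF w] by (simp add: L2_def)
  note [measurable] = dyadic_avg_measurable[OF this]
  define g where "g = sqrt (nsq lborel G)"
  have g: "g \<ge> 0" "g\<^sup>2 = nsq lborel G" by (simp_all add: g_def)
  have C: "C \<ge> 0" using g by (simp add: C_def flip: g_def)
  have "(\<integral>\<^sup>+x. ennreal (\<bar>dyadic_avg (Suc j) u x - dyadic_avg j u x\<bar> ^ 3) \<partial>lborel)
      \<le> ennreal ((200000 * 8 ^ (3 * j) * g) * (100 * (1/8) ^ (4 * j) * nsq lborel G))"
    using dyadic_avg_diff_nsq_le[OF w dim, of j] dyadic_avg_diff_sup_le[OF w dim, of j] g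
    by (intro nn_integral_cube_sup_le) (auto simp: g_def)
  also have "(200000 * 8 ^ (3 * j) * g) * (100 * (1/8) ^ (4 * j) * nsq lborel G) = C / 8 * (1/8) ^ j"
  proof -
    have "(8::real) ^ (3 * j) * (1/8) ^ (4 * j) = (1/8) ^ j"
    proof -
      have "(1/8::real) ^ (4 * j) = (1/8) ^ (3 * j) * (1/8) ^ j" by (simp flip: power_add)
      moreover have "(8::real) ^ (3 * j) * (1/8) ^ (3 * j) = 1" by (simp flip: power_mult_distrib)
      ultimately show ?thesis by (simp flip: mult.assoc)
    qed
    moreover have "C / 8 = 20000000 * (g * nsq lborel G)"
    proof -
      have "g * nsq lborel G = g ^ 3" unfolding g(2)[symmetric] by (simp add: power3_eq_cube power2_eq_square)
      then show ?thesis by (simp add: C_def g_def)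
    qed
    ultimately show ?thesis by (simp add: mult_ac)
  qed
  finally have D: "(\<integral>\<^sup>+x. ennreal (\<bar>dyadic_avg (Suc j) u x - dyadic_avg j u x\<bar> ^ 3) \<partial>lborel) \<le> ennreal (C / 8 * (1/8) ^ j)" .
  have "(\<integral>\<^sup>+x. ennreal (\<bar>dyadic_avg J u x - dyadic_avg j u x\<bar> ^ 3) \<partial>lborel)
      = (\<integral>\<^sup>+x. ennreal (\<bar>(dyadic_avg J u x - dyadic_avg (Suc j) u x) + (dyadic_avg (Suc j) u x - dyadic_avg j u x)\<bar> ^ 3) \<partial>lborel)"
    by simp
  also have "\<dots> \<le> 4 * (\<integral>\<^sup>+x. ennreal (\<bar>dyadic_avg J u x - dyadic_avg (Suc j) u x\<bar> ^ 3) \<partial>lborel)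
      + 4 * (\<integral>\<^sup>+x. ennreal (\<bar>dyadic_avg (Suc j) u x - dyadic_avg j u x\<bar> ^ 3) \<partial>lborel)"
    by (rule nn_integral_cube_add_le) measurable
  also have "\<dots> \<le> 4 * ennreal (C * (1/8) ^ Suc j) + 4 * ennreal (C / 8 * (1/8) ^ j)"
    by (intro add_mono mult_left_mono step.IH D) auto
  also have "\<dots> = ennreal (4 * (C * (1/8) ^ Suc j) + 4 * (C / 8 * (1/8) ^ j))"
    using C by (intro four_ennreal_add) auto
  also have "4 * (C * (1/8) ^ Suc j) + 4 * (C / 8 * (1/8) ^ j) = C * (1/8) ^ j" by simp
  finally show ?case .
qed

text \<open>The averages tend to \<open>u\<close> in L2, hence almost everywhere along a
  subsequence, and Fatou's lemma lets the fine scale in the previous bound go to infinity.\<close>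

theorem dyadic_avg_L3_estimate:
  fixes u :: "'a::euclidean_space \<Rightarrow> real"
  assumes w: "wgrad u G" and dim: "DIM('a) = 5"
  shows "(\<integral>\<^sup>+x. ennreal (\<bar>u x - dyadic_avg j u x\<bar> ^ 3) \<partial>lborel)
    \<le> ennreal (160000000 * sqrt (nsq lborel G) ^ 3 * (1/8) ^ j)"
proof -
  have um [measurable]: "u \<in> borel_measurable borel" using wgradD[OF w] by (simp add: L2_def)
  note [measurable] = dyadic_avg_measurable[OF um]
  have r: "(1/64::real) ^ J > 0" for J by auto
  have D: "L2 lborel (\<lambda>x. dyadic_avg J u x - u x)" for J
    unfolding dyadic_avg_def by (rule L2_avg_diff[OF w r])
  have "(\<lambda>J. nsq lborel (\<lambda>x. dyadic_avg J u x - u x)) \<longlonglongrightarrow> 0"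
  proof (rule tendsto_sandwich[OF _ _ tendsto_const])
    show "\<forall>\<^sub>F J in sequentially. nsq lborel (\<lambda>x. dyadic_avg J u x - u x) \<le> 25 * ((1/64) ^ J)\<^sup>2 * nsq lborel G"
      unfolding dyadic_avg_def using nsq_avg_diff_le[OF w r] dim by (intro always_eventually allI) simp
    have "(\<lambda>J. 25 * ((1/64::real) ^ J)\<^sup>2 * nsq lborel G) \<longlonglongrightarrow> 25 * 0\<^sup>2 * nsq lborel G"
      by (intro tendsto_intros LIMSEQ_realpow_zero) auto
    then show "(\<lambda>J. 25 * ((1/64::real) ^ J)\<^sup>2 * nsq lborel G) \<longlonglongrightarrow> 0" by simp
  qed auto
  then have "(\<lambda>J. LBINT x. norm ((dyadic_avg J u x - u x)\<^sup>2)) \<longlonglongrightarrow> 0" by simp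
  moreover have "integrable lborel (\<lambda>x. (dyadic_avg J u x - u x)\<^sup>2)" for J
    using D[of J] by (simp add: L2_def)
  ultimately obtain k where k: "strict_mono k" "AE x in lborel. (\<lambda>n. (dyadic_avg (k n) u x - u x)\<^sup>2) \<longlonglongrightarrow> 0"
    using tendsto_L1_AE_subseq[of lborel "\<lambda>J x. (dyadic_avg J u x - u x)\<^sup>2"] by blast
  have "AE x in lborel. (\<lambda>n. dyadic_avg (k n) u x) \<longlonglongrightarrow> u x"
    using k(2)
  proof eventually_elim
    case (elim x)
    have "(\<lambda>n. \<bar>dyadic_avg (k n) u x - u x\<bar>) \<longlonglongrightarrow> 0"
      using tendsto_real_sqrt[OF elim] by simp
    then show ?case by (simp add: LIM_zero_iff tendsto_rabs_zero_iff)
  qed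
  then have "(\<integral>\<^sup>+x. ennreal (\<bar>u x - dyadic_avg j u x\<bar> ^ 3) \<partial>lborel)
      = (\<integral>\<^sup>+x. liminf (\<lambda>n. ennreal (\<bar>dyadic_avg (k n) u x - dyadic_avg j u x\<bar> ^ 3)) \<partial>lborel)"
  proof (intro nn_integral_cong_AE, eventually_elim)
    case (elim x)
    have "(\<lambda>n. ennreal (\<bar>dyadic_avg (k n) u x - dyadic_avg j u x\<bar> ^ 3)) \<longlonglongrightarrow> ennreal (\<bar>u x - dyadic_avg j u x\<bar> ^ 3)"
      by (intro tendsto_ennrealI tendsto_intros elim)
    from lim_imp_Liminf[OF sequentially_bot this] show ?case by (rule sym)
  qed
  also have "\<dots> \<le> liminf (\<lambda>n. \<integral>\<^sup>+x. ennreal (\<bar>dyadic_avg (k n) u x - dyadic_avg j u x\<bar> ^ 3) \<partial>lborel)"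
    by (rule nn_integral_liminf) measurable
  also have "\<dots> \<le> limsup (\<lambda>n. \<integral>\<^sup>+x. ennreal (\<bar>dyadic_avg (k n) u x - dyadic_avg j u x\<bar> ^ 3) \<partial>lborel)"
    by (rule Liminf_le_Limsup) simp
  also have "\<dots> \<le> ennreal (160000000 * sqrt (nsq lborel G) ^ 3 * (1/8) ^ j)"
  proof (rule Limsup_bounded)
    show "\<forall>\<^sub>F n in sequentially. (\<integral>\<^sup>+x. ennreal (\<bar>dyadic_avg (k n) u x - dyadic_avg j u x\<bar> ^ 3) \<partial>lborel)
        \<le> ennreal (160000000 * sqrt (nsq lborel G) ^ 3 * (1/8) ^ j)"
      using eventually_ge_at_top[of j]
    proof eventually_elim
      case (elim n)
      then have "j \<le> k n" using seq_suble[OF k(1), of n] by linarith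
      then show ?case by (rule dyadic_avg_cube_le[OF w dim])
    qed
  qed
  finally show ?thesis .
qed

lemma nn_integral_cube_integrableI:
  assumes [measurable]: "f \<in> borel_measurable M" and le: "(\<integral>\<^sup>+x. ennreal (\<bar>f x :: real\<bar> ^ 3) \<partial>M) \<le> ennreal C" and "C \<ge> 0"
  shows "integrable M (\<lambda>x. \<bar>f x\<bar> ^ 3)" "(LINT x|M. \<bar>f x\<bar> ^ 3) \<le> C"
proof -
  show *: "integrable M (\<lambda>x. \<bar>f x\<bar> ^ 3)"
    using le by (intro integrableI_nonneg) (auto simp: le_less_trans)
  show "(LINT x|M. \<bar>f x\<bar> ^ 3) \<le> C"
    using le \<open>C \<ge> 0\<close> nn_integral_eq_integral[OF *] by simp
qed

theorem H1_L3_bounds: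
  fixes R :: real
  assumes dim: "DIM('a::euclidean_space) = 5"
  obtains C where "C \<ge> 0"
    "\<And>(u :: 'a \<Rightarrow> real) G. wgrad u G \<Longrightarrow> nsq lborel u \<le> R \<Longrightarrow> nsq lborel G \<le> R \<Longrightarrow>
       integrable lborel (\<lambda>x. \<bar>u x\<bar> ^ 3) \<and> (LBINT x. \<bar>u x\<bar> ^ 3) \<le> C"
    "\<And>(u :: 'a \<Rightarrow> real) G j. wgrad u G \<Longrightarrow> nsq lborel u \<le> R \<Longrightarrow> nsq lborel G \<le> R \<Longrightarrow>
       integrable lborel (\<lambda>x. \<bar>u x - dyadic_avg j u x\<bar> ^ 3) \<and>
       (LBINT x. \<bar>u x - dyadic_avg j u x\<bar> ^ 3) \<le> C * (1/8) ^ j"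
proof -
  define C1 where "C1 = 160000000 * sqrt \<bar>R\<bar> ^ 3"
  \<comment> \<open>At scale 0 the average has sup norm at most sqrt \<bar>R\<bar> and squared L2
    norm at most (2 * 25 + 2) \<bar>R\<bar>. Absolute values cover every real
    \<open>R\<close>.\<close>
  define C where "C = 4 * C1 + 4 * (sqrt \<bar>R\<bar> * (52 * \<bar>R\<bar>))"
  have C1: "C1 \<ge> 0" by (simp add: C1_def)
  have C: "C \<ge> C1" "C \<ge> 0" using C1 by (auto simp: C_def)
  have main: "(\<integral>\<^sup>+x. ennreal (\<bar>u x - dyadic_avg j u x\<bar> ^ 3) \<partial>lborel) \<le> ennreal (C1 * (1/8) ^ j)"
    if w: "wgrad u G" and R: "nsq lborel G \<le> R" for u :: "'a \<Rightarrow> real" and G j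
  proof -
    have "sqrt (nsq lborel G) ^ 3 \<le> sqrt \<bar>R\<bar> ^ 3" using R by (intro power_mono real_sqrt_le_mono) auto
    then have "160000000 * sqrt (nsq lborel G) ^ 3 * (1/8) ^ j \<le> C1 * (1/8) ^ j"
      unfolding C1_def by (intro mult_right_mono mult_left_mono) auto
    then show ?thesis using dyadic_avg_L3_estimate[OF w dim, of j] by (meson ennreal_leI order_trans)
  qed
  show ?thesis
  proof (rule that[OF C(2)])
    fix u :: "'a \<Rightarrow> real" and G j assume w: "wgrad u G" and R: "nsq lborel u \<le> R" "nsq lborel G \<le> R"
    have um [measurable]: "u \<in> borel_measurable borel" using wgradD[OF w] by (simp add: L2_def)
    note [measurable] = dyadic_avg_measurable[OF um]
    have le: "C1 * (1/8) ^ j \<le> C * (1/8) ^ j" by (intro mult_right_mono C) auto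
    have "integrable lborel (\<lambda>x. \<bar>u x - dyadic_avg j u x\<bar> ^ 3)"
      "(LBINT x. \<bar>u x - dyadic_avg j u x\<bar> ^ 3) \<le> C1 * (1/8) ^ j"
      using nn_integral_cube_integrableI[OF _ main[OF w R(2), of j]] C1 by auto
    with le show "integrable lborel (\<lambda>x. \<bar>u x - dyadic_avg j u x\<bar> ^ 3) \<and>
       (LBINT x. \<bar>u x - dyadic_avg j u x\<bar> ^ 3) \<le> C * (1/8) ^ j" by linarith
  next
    fix u :: "'a \<Rightarrow> real" and G assume w: "wgrad u G" and R: "nsq lborel u \<le> R" "nsq lborel G \<le> R"
    note L = wgradD[OF w]
    have um [measurable]: "u \<in> borel_measurable borel" using L by (simp add: L2_def)
    note [measurable] = dyadic_avg_measurable[OF um]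
    have A0: "L2 lborel (dyadic_avg 0 u)" "L2 lborel (\<lambda>x. dyadic_avg 0 u x - u x)"
      unfolding dyadic_avg_def by (rule L2_avg[OF w] L2_avg_diff[OF w], simp)+
    have "nsq lborel (dyadic_avg 0 u) = nsq lborel (\<lambda>x. (dyadic_avg 0 u x - u x) + u x)" by simp
    also have "\<dots> \<le> 2 * nsq lborel (\<lambda>x. dyadic_avg 0 u x - u x) + 2 * nsq lborel u"
      by (rule nsq_add_le[OF A0(2) L(1)])
    also have "nsq lborel (\<lambda>x. dyadic_avg 0 u x - u x) \<le> 25 * nsq lborel G"
      using nsq_avg_diff_le[OF w, of 1] unfolding dyadic_avg_def dim by simp
    finally have n: "nsq lborel (dyadic_avg 0 u) \<le> 52 * \<bar>R\<bar>" using R by linarith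
    have b: "\<bar>dyadic_avg 0 u x\<bar> \<le> sqrt \<bar>R\<bar>" for x
    proof (rule real_le_rsqrt)
      show "\<bar>dyadic_avg 0 u x\<bar>\<^sup>2 \<le> \<bar>R\<bar>"
        using avg_square_le[OF L(1), of 1 x] R unfolding dyadic_avg_def by simp
    qed
    have "(\<integral>\<^sup>+x. ennreal (\<bar>u x\<bar> ^ 3) \<partial>lborel) = (\<integral>\<^sup>+x. ennreal (\<bar>(u x - dyadic_avg 0 u x) + dyadic_avg 0 u x\<bar> ^ 3) \<partial>lborel)"
      by simp
    also have "\<dots> \<le> 4 * (\<integral>\<^sup>+x. ennreal (\<bar>u x - dyadic_avg 0 u x\<bar> ^ 3) \<partial>lborel) + 4 * (\<integral>\<^sup>+x. ennreal (\<bar>dyadic_avg 0 u x\<bar> ^ 3) \<partial>lborel)"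
      by (rule nn_integral_cube_add_le) measurable
    also have "\<dots> \<le> 4 * ennreal (C1 * (1/8) ^ 0) + 4 * ennreal (sqrt \<bar>R\<bar> * (52 * \<bar>R\<bar>))"
      by (intro add_mono mult_left_mono main[OF w R(2)] nn_integral_cube_sup_le A0 b n) auto
    also have "\<dots> = ennreal (4 * (C1 * (1/8) ^ 0) + 4 * (sqrt \<bar>R\<bar> * (52 * \<bar>R\<bar>)))"
      using C1 by (intro four_ennreal_add) auto
    also have "\<dots> = ennreal C" by (simp add: C_def)
    finally show "integrable lborel (\<lambda>x. \<bar>u x\<bar> ^ 3) \<and> (LBINT x. \<bar>u x\<bar> ^ 3) \<le> C"
      using nn_integral_cube_integrableI[of u lborel C] C by auto
  qed
qed

section \<open>Weak continuity of the trilinear form\<close>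

definition tri :: "('a::euclidean_space \<Rightarrow> real) \<Rightarrow> ('a \<Rightarrow> real) \<Rightarrow> ('a \<Rightarrow> real) \<Rightarrow> real" where
  "tri f g h = (LBINT x. f x * g x * h x)"

lemma abs_mult3_le_cubes: "\<bar>a * b * c\<bar> \<le> \<bar>a\<bar> ^ 3 + \<bar>b\<bar> ^ 3 + \<bar>c :: real\<bar> ^ 3"
proof -
  define m where "m = max \<bar>a\<bar> (max \<bar>b\<bar> \<bar>c\<bar>)"
  have "\<bar>a * b * c\<bar> \<le> m * m * m"
    unfolding abs_mult by (intro mult_mono) (auto simp: m_def)
  also have "\<dots> = m ^ 3" by (simp add: power3_eq_cube)
  also have "m ^ 3 \<le> \<bar>a\<bar> ^ 3 + \<bar>b\<bar> ^ 3 + \<bar>c\<bar> ^ 3"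
    unfolding m_def max_def by (auto simp: add_increasing add_increasing2)
  finally show ?thesis .
qed

lemma
  fixes f g h :: "'a \<Rightarrow> real"
  assumes [measurable]: "f \<in> borel_measurable M" "g \<in> borel_measurable M" "h \<in> borel_measurable M"
    and i: "integrable M (\<lambda>x. \<bar>f x\<bar> ^ 3)" "integrable M (\<lambda>x. \<bar>g x\<bar> ^ 3)" "integrable M (\<lambda>x. \<bar>h x\<bar> ^ 3)"
  shows integrable_mult3: "integrable M (\<lambda>x. f x * g x * h x)"
    and integral_mult3_le: "\<bar>LINT x|M. f x * g x * h x\<bar>
      \<le> (LINT x|M. \<bar>f x\<bar> ^ 3) + (LINT x|M. \<bar>g x\<bar> ^ 3) + (LINT x|M. \<bar>h x\<bar> ^ 3)"
proof -
  have s: "integrable M (\<lambda>x. \<bar>f x\<bar> ^ 3 + \<bar>g x\<bar> ^ 3 + \<bar>h x\<bar> ^ 3)" using i by simp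
  show *: "integrable M (\<lambda>x. f x * g x * h x)"
  proof (rule Bochner_Integration.integrable_bound[OF s])
    show "(\<lambda>x. f x * g x * h x) \<in> borel_measurable M" by measurable
    show "AE x in M. norm (f x * g x * h x) \<le> norm (\<bar>f x\<bar> ^ 3 + \<bar>g x\<bar> ^ 3 + \<bar>h x\<bar> ^ 3)"
      using abs_mult3_le_cubes by (intro AE_I2) simp
  qed
  have "\<bar>LINT x|M. f x * g x * h x\<bar> \<le> (LINT x|M. \<bar>f x * g x * h x\<bar>)"
    using integral_norm_bound[of M "\<lambda>x. f x * g x * h x"] by simp
  also have "\<dots> \<le> (LINT x|M. \<bar>f x\<bar> ^ 3 + \<bar>g x\<bar> ^ 3 + \<bar>h x\<bar> ^ 3)"
    by (intro integral_mono integrable_abs * s abs_mult3_le_cubes)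
  also have "\<dots> = (LINT x|M. \<bar>f x\<bar> ^ 3) + (LINT x|M. \<bar>g x\<bar> ^ 3) + (LINT x|M. \<bar>h x\<bar> ^ 3)"
    using i by simp
  finally show "\<bar>LINT x|M. f x * g x * h x\<bar>
      \<le> (LINT x|M. \<bar>f x\<bar> ^ 3) + (LINT x|M. \<bar>g x\<bar> ^ 3) + (LINT x|M. \<bar>h x\<bar> ^ 3)" .
qed

text \<open>The weights 1/l^2, l, l have product 1. Choosing \<open>l\<close> small lets one factor
  with a small cubic integral absorb the large weight, which does the work of Hoelder's
  inequality.\<close>

lemma integral_mult3_scaled_le:
  fixes f g h :: "'a \<Rightarrow> real"
  assumes m: "f \<in> borel_measurable M" "g \<in> borel_measurable M" "h \<in> borel_measurable M"
    and i: "integrable M (\<lambda>x. \<bar>f x\<bar> ^ 3)" "integrable M (\<lambda>x. \<bar>g x\<bar> ^ 3)" "integrable M (\<lambda>x. \<bar>h x\<bar> ^ 3)"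
    and l: "l > 0"
  shows "\<bar>LINT x|M. f x * g x * h x\<bar>
      \<le> (1 / l\<^sup>2) ^ 3 * (LINT x|M. \<bar>f x\<bar> ^ 3) + l ^ 3 * (LINT x|M. \<bar>g x\<bar> ^ 3) + l ^ 3 * (LINT x|M. \<bar>h x\<bar> ^ 3)"
proof -
  have c: "(\<lambda>x. \<bar>c * k x\<bar> ^ 3) = (\<lambda>x. c ^ 3 * \<bar>k x\<bar> ^ 3)" if "c > 0" for c and k :: "'a \<Rightarrow> real"
    using that by (auto simp: abs_mult power_mult_distrib)
  have l2: "1 / l\<^sup>2 > 0" using l by simp
  have "\<bar>LINT x|M. (1 / l\<^sup>2 * f x) * (l * g x) * (l * h x)\<bar>
      \<le> (LINT x|M. \<bar>1 / l\<^sup>2 * f x\<bar> ^ 3) + (LINT x|M. \<bar>l * g x\<bar> ^ 3) + (LINT x|M. \<bar>l * h x\<bar> ^ 3)"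
    unfolding c[OF l] c[OF l2] using m i
    by (intro integral_mult3_le[of "\<lambda>x. 1 / l\<^sup>2 * f x" M "\<lambda>x. l * g x" "\<lambda>x. l * h x", unfolded c[OF l] c[OF l2]]) auto
  moreover have eq: "(1 / l\<^sup>2 * f x) * (l * g x) * (l * h x) = f x * g x * h x" for x
    using l by (simp add: power2_eq_square)
  ultimately show ?thesis unfolding eq c[OF l] c[OF l2] by (simp only: integral_mult_right_zero)
qed

section \<open>Uniform estimates on balls of H1\<close>

definition H1ball :: "real \<Rightarrow> ('a::euclidean_space \<Rightarrow> real) \<Rightarrow> bool" where
  "H1ball R u \<longleftrightarrow> (\<exists>G. wgrad u G \<and> nsq lborel u \<le> R \<and> nsq lborel G \<le> R)"

lemma H1ball_L2: "H1ball R u \<Longrightarrow> L2 lborel u"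
  by (auto simp: H1ball_def wgradD)

lemma H1ball_nsq_le: "H1ball R u \<Longrightarrow> nsq lborel u \<le> R"
  by (auto simp: H1ball_def)

lemma H1ball_measurable: "H1ball R u \<Longrightarrow> u \<in> borel_measurable borel"
  using H1ball_L2 by (auto simp: L2_def)

lemma H1ball_mono: "H1ball R u \<Longrightarrow> R \<le> R' \<Longrightarrow> H1ball R' u"
  by (auto simp: H1ball_def intro: order_trans)

lemma wgrad_H1ball: "wgrad u G \<Longrightarrow> H1ball (max (nsq lborel u) (nsq lborel G)) u"
  by (auto simp: H1ball_def)

lemma H1ball_cube_integrable:
  fixes u :: "'a::euclidean_space \<Rightarrow> real"
  assumes "DIM('a) = 5" "H1ball R u"
  shows "integrable lborel (\<lambda>x. \<bar>u x\<bar> ^ 3)"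
proof (rule H1_L3_bounds[OF assms(1), of R])
  fix C assume "\<And>(u :: 'a \<Rightarrow> real) G. wgrad u G \<Longrightarrow> nsq lborel u \<le> R \<Longrightarrow> nsq lborel G \<le> R \<Longrightarrow>
       integrable lborel (\<lambda>x. \<bar>u x\<bar> ^ 3) \<and> (LBINT x. \<bar>u x\<bar> ^ 3) \<le> C"
  then show ?thesis using assms(2) unfolding H1ball_def by blast
qed

lemma tri_integrable:
  fixes f g h :: "'a::euclidean_space \<Rightarrow> real"
  assumes "DIM('a) = 5" "H1ball R f" "H1ball R' g" "H1ball R'' h"
  shows "integrable lborel (\<lambda>x. f x * g x * h x)"
  by (rule integrable_mult3)
    (use H1ball_measurable[OF assms(2)] H1ball_measurable[OF assms(3)] H1ball_measurable[OF assms(4)]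
      H1ball_cube_integrable[OF assms(1,2)] H1ball_cube_integrable[OF assms(1,3)] H1ball_cube_integrable[OF assms(1,4)] in simp_all)

lemma tri_bounded:
  assumes dim: "DIM('a::euclidean_space) = 5"
  obtains C where "\<And>f g h :: 'a \<Rightarrow> real. H1ball R f \<Longrightarrow> H1ball R g \<Longrightarrow> H1ball R h \<Longrightarrow> \<bar>tri f g h\<bar> \<le> C"
proof (rule H1_L3_bounds[OF dim, of R])
  fix C assume "\<And>(u :: 'a \<Rightarrow> real) G. wgrad u G \<Longrightarrow> nsq lborel u \<le> R \<Longrightarrow> nsq lborel G \<le> R \<Longrightarrow>
       integrable lborel (\<lambda>x. \<bar>u x\<bar> ^ 3) \<and> (LBINT x. \<bar>u x\<bar> ^ 3) \<le> C"
  then have C: "(LBINT x. \<bar>u x\<bar> ^ 3) \<le> C" if "H1ball R u" for u :: "'a \<Rightarrow> real"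
    using that unfolding H1ball_def by blast
  show ?thesis
  proof (rule that[of "3 * C"])
    fix f g h :: "'a \<Rightarrow> real" assume *: "H1ball R f" "H1ball R g" "H1ball R h"
    have "\<bar>tri f g h\<bar> \<le> (LBINT x. \<bar>f x\<bar> ^ 3) + (LBINT x. \<bar>g x\<bar> ^ 3) + (LBINT x. \<bar>h x\<bar> ^ 3)"
      unfolding tri_def
      by (rule integral_mult3_le) (use *[THEN H1ball_measurable] *[THEN H1ball_cube_integrable[OF dim]] in simp_all)
    with *[THEN C] show "\<bar>tri f g h\<bar> \<le> 3 * C" by linarith
  qed
qed

text \<open>The order of choices matters: \<open>l\<close> first, to make the terms of
  \<open>g\<close> and \<open>h\<close> at most e/4 each, and then \<open>j\<close>, so that 8^(-j)
  beats the large weight on the first slot. Neither depends on the functions.\<close>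

lemma tri_dyadic_avg_uniform:
  assumes dim: "DIM('a::euclidean_space) = 5" and e: "e > 0"
  obtains j where "\<And>f g h :: 'a \<Rightarrow> real. H1ball R f \<Longrightarrow> H1ball R g \<Longrightarrow> H1ball R h \<Longrightarrow>
    integrable lborel (\<lambda>x. (f x - dyadic_avg j f x) * g x * h x) \<and> \<bar>tri (\<lambda>x. f x - dyadic_avg j f x) g h\<bar> \<le> e"
proof (rule H1_L3_bounds[OF dim, of R])
  fix C assume C0: "C \<ge> 0" and "\<And>(u :: 'a \<Rightarrow> real) G. wgrad u G \<Longrightarrow> nsq lborel u \<le> R \<Longrightarrow> nsq lborel G \<le> R \<Longrightarrow>
       integrable lborel (\<lambda>x. \<bar>u x\<bar> ^ 3) \<and> (LBINT x. \<bar>u x\<bar> ^ 3) \<le> C"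
    and "\<And>(u :: 'a \<Rightarrow> real) G j. wgrad u G \<Longrightarrow> nsq lborel u \<le> R \<Longrightarrow> nsq lborel G \<le> R \<Longrightarrow>
       integrable lborel (\<lambda>x. \<bar>u x - dyadic_avg j u x\<bar> ^ 3) \<and>
       (LBINT x. \<bar>u x - dyadic_avg j u x\<bar> ^ 3) \<le> C * (1/8) ^ j"
  then have C: "(LBINT x. \<bar>u x\<bar> ^ 3) \<le> C"
    and CJ: "integrable lborel (\<lambda>x. \<bar>u x - dyadic_avg j u x\<bar> ^ 3)"
      "(LBINT x. \<bar>u x - dyadic_avg j u x\<bar> ^ 3) \<le> C * (1/8) ^ j" if "H1ball R u" for u :: "'a \<Rightarrow> real" and j
    using that unfolding H1ball_def by blast+
  define l where "l = root 3 (e / (4 * (C + 1)))"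
  have l: "l > 0" using e C0 by (simp add: l_def)
  have l3: "l ^ 3 * C \<le> e / 4"
  proof -
    have "l ^ 3 = e / (4 * (C + 1))" using e C0 by (simp add: l_def)
    then have "l ^ 3 * C \<le> e / (4 * (C + 1)) * (C + 1)" using e C0 by (simp only:) (intro mult_left_mono; simp)
    also have "\<dots> = e / 4" using C0 by (simp add: field_simps)
    finally show ?thesis .
  qed
  define K where "K = (1 / l\<^sup>2) ^ 3 * C"
  have "(\<lambda>j. K * (1/8) ^ j) \<longlonglongrightarrow> K * 0"
    by (intro tendsto_intros LIMSEQ_realpow_zero) auto
  then have "\<forall>\<^sub>F j in sequentially. K * (1/8) ^ j < e / 2"
    using e by (intro order_tendstoD(2)) auto
  then obtain j where j: "K * (1/8) ^ j < e / 2" by (auto dest!: eventually_happens)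
  show ?thesis
  proof (rule that[of j])
    fix f g h :: "'a \<Rightarrow> real" assume *: "H1ball R f" "H1ball R g" "H1ball R h"
    note m [measurable] = *[THEN H1ball_measurable]
    note [measurable] = dyadic_avg_measurable[OF m(1), of j]
    have fm: "(\<lambda>x. f x - dyadic_avg j f x) \<in> borel_measurable lborel" by measurable
    have gm: "g \<in> borel_measurable lborel" "h \<in> borel_measurable lborel" by simp_all
    note i = CJ(1)[OF *(1), of j] H1ball_cube_integrable[OF dim *(2)] H1ball_cube_integrable[OF dim *(3)]
    have "\<bar>tri (\<lambda>x. f x - dyadic_avg j f x) g h\<bar>
      \<le> (1 / l\<^sup>2) ^ 3 * (LBINT x. \<bar>f x - dyadic_avg j f x\<bar> ^ 3) + l ^ 3 * (LBINT x. \<bar>g x\<bar> ^ 3) + l ^ 3 * (LBINT x. \<bar>h x\<bar> ^ 3)"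
      unfolding tri_def by (rule integral_mult3_scaled_le[OF fm gm i l])
    also have "\<dots> \<le> (1 / l\<^sup>2) ^ 3 * (C * (1/8) ^ j) + l ^ 3 * C + l ^ 3 * C"
      using l by (intro add_mono mult_left_mono CJ(2) C *) auto
    also have "(1 / l\<^sup>2) ^ 3 * (C * (1/8) ^ j) = K * (1/8) ^ j" by (simp add: K_def)
    also have "K * (1/8) ^ j + l ^ 3 * C + l ^ 3 * C \<le> e" using j l3 by linarith
    finally show "integrable lborel (\<lambda>x. (f x - dyadic_avg j f x) * g x * h x) \<and> \<bar>tri (\<lambda>x. f x - dyadic_avg j f x) g h\<bar> \<le> e"
      using integrable_mult3[OF fm gm i] by simp
  qed
qed

text \<open>The density of the uniform distribution on the cube with corner \<open>x\<close> and
  side \<open>r\<close>. It makes an average an L2 pairing, so weak convergence controls averages at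
  each point.\<close>

definition avg_kernel :: "real \<Rightarrow> 'a::euclidean_space \<Rightarrow> 'a \<Rightarrow> real" where
  "avg_kernel r x y = indicator (cbox 0 One) ((y - x) /\<^sub>R r) / r ^ DIM('a)"

lemma L2_avg_kernel:
  fixes x :: "'a::euclidean_space"
  assumes r: "r > 0"
  shows "L2 lborel (avg_kernel r x)"
proof -
  have m [measurable]: "avg_kernel r x \<in> borel_measurable borel"
    unfolding avg_kernel_def[abs_def] by measurable
  have "(\<integral>\<^sup>+y. ennreal ((norm (avg_kernel r x y))\<^sup>2) \<partial>lborel)
      = ennreal (r ^ DIM('a)) * (\<integral>\<^sup>+h. ennreal ((norm (avg_kernel r x (x + r *\<^sub>R h)))\<^sup>2) \<partial>lborel)"
    by (rule nn_integral_lborel_affine[OF _ r]) measurable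
  also have "(\<lambda>h. ennreal ((norm (avg_kernel r x (x + r *\<^sub>R h)))\<^sup>2))
      = (\<lambda>h. ennreal ((1 / r ^ DIM('a))\<^sup>2) * indicator (cbox 0 One) h)"
    using r by (auto simp: avg_kernel_def indicator_def)
  also have "(\<integral>\<^sup>+h. ennreal ((1 / r ^ DIM('a))\<^sup>2) * indicator (cbox 0 One) h \<partial>lborel) = ennreal ((1 / r ^ DIM('a))\<^sup>2) * emeasure lborel (cbox 0 (One :: 'a))"
    by (simp add: nn_integral_cmult)
  also have "ennreal (r ^ DIM('a)) * (ennreal ((1 / r ^ DIM('a))\<^sup>2) * emeasure lborel (cbox 0 (One :: 'a))) \<le> ennreal (r ^ DIM('a) * (1 / r ^ DIM('a))\<^sup>2)"
    using r by (simp add: emeasure_lborel_cbox_eq inner_diff_left ennreal_mult)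
  finally show ?thesis by (rule L2_nn_integralI[rotated]) (use r m in simp_all)
qed

lemma avg_eq_ip:
  fixes u :: "'a::euclidean_space \<Rightarrow> real"
  assumes u: "L2 lborel u" and r: "r > 0"
  shows "avg r u x = ip lborel u (avg_kernel r x)"
proof -
  have m [measurable]: "u \<in> borel_measurable borel" using u by (simp add: L2_def)
  have [measurable]: "avg_kernel r x \<in> borel_measurable borel"
    using L2_avg_kernel[OF r, of x] by (simp add: L2_def)
  have "ip lborel u (avg_kernel r x) = (LINT y|density (distr lborel borel (\<lambda>h. x + r *\<^sub>R h)) (\<lambda>_. ennreal (r ^ DIM('a))). u y * avg_kernel r x y)"
    using r lborel_affine[of r x] by simp
  also have "\<dots> = (LINT y|distr lborel borel (\<lambda>h. x + r *\<^sub>R h). r ^ DIM('a) * (u y * avg_kernel r x y))"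
    using r by (subst integral_density) auto
  also have "\<dots> = (LBINT h. r ^ DIM('a) * (u (x + r *\<^sub>R h) * avg_kernel r x (x + r *\<^sub>R h)))"
    by (subst integral_distr) auto
  also have "\<dots> = (LBINT h. indicator (cbox 0 One) h * u (x + r *\<^sub>R h))"
    using r by (intro Bochner_Integration.integral_cong) (auto simp: avg_kernel_def)
  also have "\<dots> = (LINT h|density lborel (\<lambda>h. ennreal (indicator (cbox 0 One) h)). u (x + r *\<^sub>R h))"
    by (subst integral_density) auto
  also have "\<dots> = avg r u x"
    by (simp add: avg_def unit_cube_def ennreal_indicator)
  finally show ?thesis by simp
qed

section \<open>Weak convergence and the trilinear form\<close>

definition weakly_converges :: "'a measure \<Rightarrow> (nat \<Rightarrow> 'a \<Rightarrow> 'b::euclidean_space) \<Rightarrow> ('a \<Rightarrow> 'b) \<Rightarrow> bool" where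
  "weakly_converges M F f \<longleftrightarrow> (\<forall>g. L2 M g \<longrightarrow> (\<lambda>n. ip M (F n) g) \<longlonglongrightarrow> ip M f g)"

lemma weakly_convergesD: "weakly_converges M F f \<Longrightarrow> L2 M g \<Longrightarrow> (\<lambda>n. ip M (F n) g) \<longlonglongrightarrow> ip M f g"
  by (simp add: weakly_converges_def)

lemma weakly_converges_const: "weakly_converges M (\<lambda>n. f) f"
  by (simp add: weakly_converges_def)

lemma weakly_converges_dyadic_avg:
  assumes "weakly_converges lborel f g" "\<And>n. L2 lborel (f n)" "L2 lborel g"
  shows "(\<lambda>n. dyadic_avg j (f n) x) \<longlonglongrightarrow> dyadic_avg j g x"
proof -
  have r: "(1/64::real) ^ j > 0" by simp
  show ?thesis
    unfolding dyadic_avg_def avg_eq_ip[OF assms(2) r] avg_eq_ip[OF assms(3) r]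
    by (rule weakly_convergesD[OF assms(1) L2_avg_kernel[OF r]])
qed

lemma tendsto_ip_strong_weak:
  fixes F G :: "nat \<Rightarrow> 'a \<Rightarrow> 'b::euclidean_space"
  assumes F: "\<And>n. L2 M (F n)" "L2 M f" "(\<lambda>n. nsq M (\<lambda>x. F n x - f x)) \<longlonglongrightarrow> 0"
    and G: "\<And>n. L2 M (G n)" "L2 M g" "weakly_converges M G g" "\<And>n. nsq M (G n) \<le> R"
  shows "(\<lambda>n. ip M (F n) (G n)) \<longlonglongrightarrow> ip M f g"
proof -
  have "(\<lambda>n. ip M (\<lambda>x. F n x - f x) (G n)) \<longlonglongrightarrow> 0"
  proof (rule tendsto_rabs_zero_cancel, rule tendsto_sandwich[OF _ _ tendsto_const])
    show "(\<lambda>n. sqrt (nsq M (\<lambda>x. F n x - f x)) * sqrt R) \<longlonglongrightarrow> 0"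
      by (rule tendsto_eq_intros F(3) refl | simp)+
    have "\<bar>ip M (\<lambda>x. F n x - f x) (G n)\<bar> \<le> sqrt (nsq M (\<lambda>x. F n x - f x)) * sqrt R" for n
      by (rule order_trans[OF ip_abs_le[OF L2_diff[OF F(1,2)] G(1)] mult_left_mono[OF real_sqrt_le_mono[OF G(4)]]]) simp
    then show "\<forall>\<^sub>F n in sequentially. \<bar>ip M (\<lambda>x. F n x - f x) (G n)\<bar> \<le> sqrt (nsq M (\<lambda>x. F n x - f x)) * sqrt R"
      by simp
  qed auto
  moreover have "(\<lambda>n. ip M f (G n)) \<longlonglongrightarrow> ip M f g"
    using weakly_convergesD[OF G(3) F(2)] by (simp add: inner_commute)
  ultimately have "(\<lambda>n. ip M (\<lambda>x. F n x - f x) (G n) + ip M f (G n)) \<longlonglongrightarrow> 0 + ip M f g"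
    by (rule tendsto_add)
  moreover have "ip M (\<lambda>x. F n x - f x) (G n) + ip M f (G n) = ip M (F n) (G n)" for n
    using ip_diff_left[OF F(1,2) G(1), of n n] by simp
  ultimately show ?thesis by simp
qed

lemma dyadic_avg_bounded:
  fixes R :: real
  obtains B where "B \<ge> 0" "\<And>(u :: 'a::euclidean_space \<Rightarrow> real) x. L2 lborel u \<Longrightarrow> nsq lborel u \<le> R \<Longrightarrow> \<bar>dyadic_avg j u x\<bar> \<le> B"
proof (rule that[of "sqrt (\<bar>R\<bar> / ((1/64) ^ j) ^ DIM('a))"])
  fix u :: "'a \<Rightarrow> real" and x assume u: "L2 lborel u" "nsq lborel u \<le> R"
  have r: "(1/64::real) ^ j > 0" by simp
  have "(dyadic_avg j u x)\<^sup>2 \<le> nsq lborel u / ((1/64) ^ j) ^ DIM('a)"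
    unfolding dyadic_avg_def by (rule avg_square_le[OF u(1) r])
  also have "\<dots> \<le> \<bar>R\<bar> / ((1/64) ^ j) ^ DIM('a)" using u(2) by (intro divide_right_mono) auto
  finally show "\<bar>dyadic_avg j u x\<bar> \<le> sqrt (\<bar>R\<bar> / ((1/64) ^ j) ^ DIM('a))"
    by (intro real_le_rsqrt) simp
qed simp

lemma L2_mult_bounded:
  fixes f g :: "'a \<Rightarrow> real"
  assumes f: "L2 M f" and [measurable]: "g \<in> borel_measurable M" and B: "\<And>x. \<bar>g x\<bar> \<le> B"
  shows "L2 M (\<lambda>x. f x * g x)"
proof -
  have [measurable]: "f \<in> borel_measurable M" using f by (simp add: L2_def)
  have "integrable M (\<lambda>x. (f x * g x)\<^sup>2)"
  proof (rule Bochner_Integration.integrable_bound)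
    show "integrable M (\<lambda>x. B\<^sup>2 * (f x)\<^sup>2)" using f by (simp add: L2_def)
    show "(\<lambda>x. (f x * g x)\<^sup>2) \<in> borel_measurable M" by measurable
    show "AE x in M. norm ((f x * g x)\<^sup>2) \<le> norm (B\<^sup>2 * (f x)\<^sup>2)"
    proof (rule AE_I2)
      fix x
      have "(g x)\<^sup>2 \<le> B\<^sup>2" using power_mono[OF B[of x], of 2] by simp
      then show "norm ((f x * g x)\<^sup>2) \<le> norm (B\<^sup>2 * (f x)\<^sup>2)"
        using mult_right_mono[OF \<open>(g x)\<^sup>2 \<le> B\<^sup>2\<close>, of "(f x)\<^sup>2"] by (simp add: power_mult_distrib mult.commute)
    qed
  qed
  then show ?thesis by (simp add: L2_def)
qed

text \<open>Up to a uniform error the first slot may be replaced by its average. The product of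
  \<open>w\<close> with the averages converges strongly in L2, as the averages are uniformly bounded
  and converge pointwise while \<open>w\<close> is fixed; a strong limit pairs well with the weak
  limit in the third slot.\<close>

theorem tri_weakly_continuous:
  fixes w f g :: "'a::euclidean_space \<Rightarrow> real"
  assumes dim: "DIM('a) = 5"
    and w: "H1ball R w" and F: "\<And>n. H1ball R (F n)" "H1ball R f" "weakly_converges lborel F f"
    and G: "\<And>n. H1ball R (G n)" "H1ball R g" "weakly_converges lborel G g"
  shows "(\<lambda>n. tri (F n) w (G n)) \<longlonglongrightarrow> tri f w g"
proof (rule LIMSEQ_I)
  fix e :: real assume e: "e > 0"
  obtain j where j: "\<And>f g h :: 'a \<Rightarrow> real. H1ball R f \<Longrightarrow> H1ball R g \<Longrightarrow> H1ball R h \<Longrightarrow>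
    integrable lborel (\<lambda>x. (f x - dyadic_avg j f x) * g x * h x) \<and> \<bar>tri (\<lambda>x. f x - dyadic_avg j f x) g h\<bar> \<le> e / 3"
    using tri_dyadic_avg_uniform[OF dim, of "e / 3"] e by auto
  obtain B where B: "B \<ge> 0" "\<And>(u :: 'a \<Rightarrow> real) x. L2 lborel u \<Longrightarrow> nsq lborel u \<le> R \<Longrightarrow> \<bar>dyadic_avg j u x\<bar> \<le> B"
    using dyadic_avg_bounded by metis
  \<comment> \<open>The averaged part is grouped with \<open>w\<close> into a single L2 function, so
    that what remains is a pairing with the third slot.\<close>
  have split: "tri k w h = tri (\<lambda>x. k x - dyadic_avg j k x) w h + ip lborel (\<lambda>x. w x * dyadic_avg j k x) h"
    and wL: "L2 lborel (\<lambda>x. w x * dyadic_avg j k x)"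
    if k: "H1ball R k" and h: "H1ball R h" for k h
  proof -
    have m: "dyadic_avg j k \<in> borel_measurable lborel"
      using dyadic_avg_measurable[OF H1ball_measurable[OF k]] by simp
    show wL: "L2 lborel (\<lambda>x. w x * dyadic_avg j k x)"
      by (rule L2_mult_bounded[OF H1ball_L2[OF w] m B(2)[OF H1ball_L2[OF k] H1ball_nsq_le[OF k]]])
    have "integrable lborel (\<lambda>x. (w x * dyadic_avg j k x) * h x)"
      by (rule L2_mult[OF wL H1ball_L2[OF h]])
    moreover have "integrable lborel (\<lambda>x. (k x - dyadic_avg j k x) * w x * h x)"
      using j[OF k w h] by simp
    ultimately have "(LBINT x. (k x - dyadic_avg j k x) * w x * h x) + (LBINT x. (w x * dyadic_avg j k x) * h x)
        = (LBINT x. (k x - dyadic_avg j k x) * w x * h x + (w x * dyadic_avg j k x) * h x)" by simp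
    also have "\<dots> = tri k w h"
      unfolding tri_def by (intro Bochner_Integration.integral_cong) (auto simp: algebra_simps)
    finally show "tri k w h = tri (\<lambda>x. k x - dyadic_avg j k x) w h + ip lborel (\<lambda>x. w x * dyadic_avg j k x) h"
      by (simp add: tri_def)
  qed
  have "(\<lambda>n. ip lborel (\<lambda>x. w x * dyadic_avg j (F n) x) (G n)) \<longlonglongrightarrow> ip lborel (\<lambda>x. w x * dyadic_avg j f x) g"
  proof (rule tendsto_ip_strong_weak[where R = R])
    show "L2 lborel (\<lambda>x. w x * dyadic_avg j (F n) x)" for n by (rule wL[OF F(1) F(1)])
    show "L2 lborel (\<lambda>x. w x * dyadic_avg j f x)" by (rule wL[OF F(2) F(2)])
    have [measurable]: "dyadic_avg j (F n) \<in> borel_measurable borel" for n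
      by (rule dyadic_avg_measurable[OF H1ball_measurable[OF F(1)]])
    have [measurable]: "dyadic_avg j f \<in> borel_measurable borel" "w \<in> borel_measurable borel"
      by (rule dyadic_avg_measurable[OF H1ball_measurable[OF F(2)]] H1ball_measurable[OF w])+
    have "(\<lambda>n. LBINT x. (norm (w x * dyadic_avg j (F n) x - w x * dyadic_avg j f x))\<^sup>2) \<longlonglongrightarrow> (LINT x|(lborel :: 'a measure). (0::real))"
    proof (rule integral_dominated_convergence[where f = "\<lambda>x. 0" and w = "\<lambda>x. (2 * B)\<^sup>2 * (w x)\<^sup>2"])
      show "integrable lborel (\<lambda>x. (2 * B)\<^sup>2 * (w x)\<^sup>2)" using H1ball_L2[OF w] by (simp add: L2_def)
      show "AE x in lborel. norm ((norm (w x * dyadic_avg j (F n) x - w x * dyadic_avg j f x))\<^sup>2) \<le> (2 * B)\<^sup>2 * (w x)\<^sup>2" for n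
      proof (rule AE_I2)
        fix x
        have "\<bar>dyadic_avg j (F n) x - dyadic_avg j f x\<bar> \<le> 2 * B"
          using B(2)[OF H1ball_L2[OF F(1)] H1ball_nsq_le[OF F(1)], of n x]
            B(2)[OF H1ball_L2[OF F(2)] H1ball_nsq_le[OF F(2)], of x] by linarith
        from power_mono[OF this, of 2] have "(dyadic_avg j (F n) x - dyadic_avg j f x)\<^sup>2 \<le> (2 * B)\<^sup>2" by simp
        from mult_right_mono[OF this, of "(w x)\<^sup>2"]
        show "norm ((norm (w x * dyadic_avg j (F n) x - w x * dyadic_avg j f x))\<^sup>2) \<le> (2 * B)\<^sup>2 * (w x)\<^sup>2"
          by (simp add: right_diff_distrib[symmetric] power_mult_distrib mult.commute)
      qed
      show "AE x in lborel. (\<lambda>n. (norm (w x * dyadic_avg j (F n) x - w x * dyadic_avg j f x))\<^sup>2) \<longlonglongrightarrow> 0"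
      proof (rule AE_I2)
        fix x
        have "(\<lambda>n. dyadic_avg j (F n) x) \<longlonglongrightarrow> dyadic_avg j f x"
          by (rule weakly_converges_dyadic_avg[OF F(3) H1ball_L2[OF F(1)] H1ball_L2[OF F(2)]])
        then have "(\<lambda>n. (norm (w x * dyadic_avg j (F n) x - w x * dyadic_avg j f x))\<^sup>2)
            \<longlonglongrightarrow> (norm (w x * dyadic_avg j f x - w x * dyadic_avg j f x))\<^sup>2"
          by (intro tendsto_intros)
        then show "(\<lambda>n. (norm (w x * dyadic_avg j (F n) x - w x * dyadic_avg j f x))\<^sup>2) \<longlonglongrightarrow> 0" by simp
      qed
      show "(\<lambda>x. 0) \<in> borel_measurable lborel" by simp
      show "(\<lambda>x. (norm (w x * dyadic_avg j (F n) x - w x * dyadic_avg j f x))\<^sup>2) \<in> borel_measurable lborel" for n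
        by measurable
    qed
    then show "(\<lambda>n. nsq lborel (\<lambda>x. w x * dyadic_avg j (F n) x - w x * dyadic_avg j f x)) \<longlonglongrightarrow> 0" by simp
  qed (use G H1ball_L2 H1ball_nsq_le in blast)+
  from LIMSEQ_D[OF this, of "e / 3"] e obtain N where
    N: "\<And>n. n \<ge> N \<Longrightarrow> \<bar>ip lborel (\<lambda>x. w x * dyadic_avg j (F n) x) (G n) - ip lborel (\<lambda>x. w x * dyadic_avg j f x) g\<bar> < e / 3"
    by auto
  show "\<exists>N. \<forall>n\<ge>N. norm (tri (F n) w (G n) - tri f w g) < e"
  proof (intro exI allI impI)
    fix n assume "n \<ge> N"
    then show "norm (tri (F n) w (G n) - tri f w g) < e"
      using N[of n] j[OF F(1)[of n] w G(1)[of n]] j[OF F(2) w G(2)]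
      unfolding split[OF F(1) G(1), of n n] split[OF F(2) G(2)] real_norm_def by linarith
  qed
qed

text \<open>If all averages of \<open>v\<close> were below \<open>d\<close>, the averaged part of
  the integral would be at most e/4 and the remainder e/2, short of \<open>e\<close>. This rules out
  that a maximizing sequence spreads out to nothing.\<close>

lemma tri_nonvanishing:
  assumes dim: "DIM('a::euclidean_space) = 5" and e: "e > 0"
  obtains j d where "d > 0"
    "\<And>u v :: 'a \<Rightarrow> real. H1ball R u \<Longrightarrow> H1ball R v \<Longrightarrow> tri v u u \<ge> e \<Longrightarrow> \<exists>x. \<bar>dyadic_avg j v x\<bar> \<ge> d"
proof -
  obtain j where j: "\<And>f g h :: 'a \<Rightarrow> real. H1ball R f \<Longrightarrow> H1ball R g \<Longrightarrow> H1ball R h \<Longrightarrow>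
    integrable lborel (\<lambda>x. (f x - dyadic_avg j f x) * g x * h x) \<and> \<bar>tri (\<lambda>x. f x - dyadic_avg j f x) g h\<bar> \<le> e / 2"
    using tri_dyadic_avg_uniform[OF dim, of "e / 2"] e by auto
  define d where "d = e / (4 * (\<bar>R\<bar> + 1))"
  have d: "d > 0" using e by (simp add: d_def)
  show ?thesis
  proof (rule that[OF d, of j], rule ccontr)
    fix u v :: "'a \<Rightarrow> real"
    assume u: "H1ball R u" and v: "H1ball R v" and ge: "tri v u u \<ge> e" and "\<not> (\<exists>x. \<bar>dyadic_avg j v x\<bar> \<ge> d)"
    then have lt: "\<bar>dyadic_avg j v x\<bar> \<le> d" for x by (meson not_le less_imp_le)
    note m [measurable] = H1ball_measurable[OF u]
    have uL: "integrable lborel (\<lambda>x. (u x)\<^sup>2)" using H1ball_L2[OF u] by (simp add: L2_def)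
    have i1: "integrable lborel (\<lambda>x. (v x - dyadic_avg j v x) * u x * u x)" using j[OF v u u] by simp
    have i2: "integrable lborel (\<lambda>x. v x * u x * u x)" by (rule tri_integrable[OF dim v u u])
    have "(LBINT x. v x * u x * u x - (v x - dyadic_avg j v x) * u x * u x) \<le> (LBINT x. d * (u x)\<^sup>2)"
    proof (rule integral_mono)
      fix x
      have "v x * u x * u x - (v x - dyadic_avg j v x) * u x * u x = dyadic_avg j v x * (u x)\<^sup>2"
        by (simp add: power2_eq_square algebra_simps)
      also have "\<dots> \<le> d * (u x)\<^sup>2" using lt[of x] by (intro mult_right_mono) auto
      finally show "v x * u x * u x - (v x - dyadic_avg j v x) * u x * u x \<le> d * (u x)\<^sup>2" .
    qed (use i1 i2 uL in simp_all)
    then have "tri v u u - tri (\<lambda>x. v x - dyadic_avg j v x) u u \<le> d * nsq lborel u"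
      using i1 i2 by (simp add: tri_def)
    moreover have "d * nsq lborel u \<le> d * (\<bar>R\<bar> + 1)"
      using H1ball_nsq_le[OF u] d by (intro mult_left_mono) auto
    moreover have "d * (\<bar>R\<bar> + 1) = e / 4" by (simp add: d_def field_simps)
    ultimately show False using j[OF v u u] ge e by linarith
  qed
qed

section \<open>The maximization problem\<close>

lemma L2_bounded_linear:
  fixes F :: "'a \<Rightarrow> 'b::euclidean_space" and T :: "'b \<Rightarrow> 'c::euclidean_space"
  assumes F: "L2 M F" and T: "bounded_linear T"
  shows "L2 M (\<lambda>x. T (F x))"
proof -
  interpret bounded_linear T by fact
  obtain K where K: "\<And>x. norm (T x) \<le> norm x * K" using bounded by blast
  have [measurable]: "F \<in> borel_measurable M" using F by (simp add: L2_def)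
  have "T \<in> borel_measurable borel"
    by (intro borel_measurable_continuous_onI linear_continuous_on T)
  then have m [measurable]: "(\<lambda>x. T (F x)) \<in> borel_measurable M" by measurable
  have "integrable M (\<lambda>x. (norm (T (F x)))\<^sup>2)"
  proof (rule Bochner_Integration.integrable_bound)
    show "integrable M (\<lambda>x. K\<^sup>2 * (norm (F x))\<^sup>2)" using F by (simp add: L2_def)
    show "(\<lambda>x. (norm (T (F x)))\<^sup>2) \<in> borel_measurable M" by measurable
    show "AE x in M. norm ((norm (T (F x)))\<^sup>2) \<le> norm (K\<^sup>2 * (norm (F x))\<^sup>2)"
    proof (rule AE_I2)
      fix x
      show "norm ((norm (T (F x)))\<^sup>2) \<le> norm (K\<^sup>2 * (norm (F x))\<^sup>2)"
        using power_mono[OF K[of "F x"], of 2] by (simp add: power_mult_distrib mult.commute)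
    qed
  qed
  with m show ?thesis by (simp add: L2_def)
qed

lemma nsq_eq_ip: "nsq M f = ip M f f"
  by (simp add: power2_norm_eq_inner)

text \<open>Extracting a component is moved to the test function by its pointwise adjoint
  \<open>T'\<close>. \<open>S\<close> acts on whole functions so that \<open>U\<close>,
  \<open>DU\<close>, \<open>V\<close> and \<open>DV\<close> fit.\<close>

lemma weakly_converges_adjoint:
  assumes conv: "weakly_converges M F f" and T': "bounded_linear T'"
    and adj: "\<And>n x y. S (F n) x \<bullet> y = F n x \<bullet> T' y" "\<And>x y. S f x \<bullet> y = f x \<bullet> T' y"
  shows "weakly_converges M (\<lambda>n. S (F n)) (S f)"
  unfolding weakly_converges_def adj
  using weakly_convergesD[OF conv L2_bounded_linear[OF _ T']] by blast

text \<open>The maximization depends on the system only through four positive weights, so these are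
  kept abstract here.\<close>

locale h1_pairs =
  fixes c1 c2 c3 c4 :: real and type :: "'a::euclidean_space itself"
  assumes c_pos: "c1 > 0" "c2 > 0" "c3 > 0" "c4 > 0" and dim: "DIM('a) = 5"
begin

text \<open>A pair \<open>(u, v)\<close> and its weak gradients are stored in one function, with weights that turn the
  quadratic part of the functional into the squared \<open>L\<^sup>2\<close> norm.\<close>

definition mk :: "('a \<Rightarrow> real) \<Rightarrow> ('a \<Rightarrow> 'a) \<Rightarrow> ('a \<Rightarrow> real) \<Rightarrow> ('a \<Rightarrow> 'a) \<Rightarrow> 'a \<Rightarrow> real \<times> 'a \<times> real \<times> 'a" where
  "mk u G v H = (\<lambda>x. (c1 * u x, c2 *\<^sub>R G x, c3 * v x, c4 *\<^sub>R H x))"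

definition U :: "('a \<Rightarrow> real \<times> 'a \<times> real \<times> 'a) \<Rightarrow> 'a \<Rightarrow> real" where
  "U F x = (1 / c1) *\<^sub>R fst (F x)"

definition DU :: "('a \<Rightarrow> real \<times> 'a \<times> real \<times> 'a) \<Rightarrow> 'a \<Rightarrow> 'a" where
  "DU F x = (1 / c2) *\<^sub>R fst (snd (F x))"

definition V :: "('a \<Rightarrow> real \<times> 'a \<times> real \<times> 'a) \<Rightarrow> 'a \<Rightarrow> real" where
  "V F x = (1 / c3) *\<^sub>R fst (snd (snd (F x)))"

definition DV :: "('a \<Rightarrow> real \<times> 'a \<times> real \<times> 'a) \<Rightarrow> 'a \<Rightarrow> 'a" where
  "DV F x = (1 / c4) *\<^sub>R snd (snd (snd (F x)))"

definition Hs :: "('a \<Rightarrow> real \<times> 'a \<times> real \<times> 'a) \<Rightarrow> bool" where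
  "Hs F \<longleftrightarrow> wgrad (U F) (DU F) \<and> wgrad (V F) (DV F)"

definition B :: "('a \<Rightarrow> real \<times> 'a \<times> real \<times> 'a) \<Rightarrow> real" where
  "B F = tri (V F) (U F) (U F)"

text \<open>The derivative of \<open>B\<close> at \<open>F\<close> in direction \<open>P\<close>;
  the two equal slots of \<open>U\<close> produce the factor 2.\<close>

definition dB :: "('a \<Rightarrow> real \<times> 'a \<times> real \<times> 'a) \<Rightarrow> ('a \<Rightarrow> real \<times> 'a \<times> real \<times> 'a) \<Rightarrow> real" where
  "dB F P = tri (V P) (U F) (U F) + 2 * tri (V F) (U F) (U P)"

lemma mk_components [simp]: "U (mk u G v H) = u" "DU (mk u G v H) = G" "V (mk u G v H) = v" "DV (mk u G v H) = H"
  using c_pos by (auto simp: U_def DU_def V_def DV_def mk_def)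

lemma mk_decompose: "mk (U F) (DU F) (V F) (DV F) = F"
  using c_pos by (auto simp: U_def DU_def V_def DV_def mk_def)

lemma Hs_mk [simp]: "Hs (mk u G v H) \<longleftrightarrow> wgrad u G \<and> wgrad v H"
  by (simp add: Hs_def)

lemma L2_components:
  assumes "L2 lborel F"
  shows "L2 lborel (U F)" "L2 lborel (DU F)" "L2 lborel (V F)" "L2 lborel (DV F)"
  unfolding U_def DU_def V_def DV_def
  by (rule L2_bounded_linear[OF assms], intro bounded_linear_intros bounded_linear_ident)+

lemma Hs_components_L2:
  assumes "Hs F"
  shows "L2 lborel (U F)" "L2 lborel (DU F)" "L2 lborel (V F)" "L2 lborel (DV F)"
  using assms by (auto simp: Hs_def dest: wgradD)

lemma inner_decompose:
  "F x \<bullet> P x = c1\<^sup>2 * (U F x * U P x) + c2\<^sup>2 * (DU F x \<bullet> DU P x) + c3\<^sup>2 * (V F x * V P x) + c4\<^sup>2 * (DV F x \<bullet> DV P x)"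
  by (subst (1) mk_decompose[of F, symmetric], subst (1) mk_decompose[of P, symmetric])
    (simp add: mk_def inner_Pair power2_eq_square mult_ac)

lemma Hs_L2:
  assumes F: "Hs F"
  shows "L2 lborel F"
proof -
  note L = Hs_components_L2[OF F]
  have [measurable]: "U F \<in> borel_measurable borel" "DU F \<in> borel_measurable borel"
    "V F \<in> borel_measurable borel" "DV F \<in> borel_measurable borel"
    using L by (auto simp: L2_def)
  have "mk (U F) (DU F) (V F) (DV F) \<in> borel_measurable borel"
    unfolding mk_def by measurable
  then have "F \<in> borel_measurable lborel" by (simp add: mk_decompose)
  moreover have "integrable lborel (\<lambda>x. F x \<bullet> F x)"
    unfolding inner_decompose[of F _ F]
    by (intro Bochner_Integration.integrable_add integrable_mult_right L2_mult L2_inner L)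
  ultimately show ?thesis by (simp add: L2_def power2_norm_eq_inner)
qed

lemma ip_decompose:
  assumes F: "Hs F" and P: "Hs P"
  shows "ip lborel F P = c1\<^sup>2 * (LBINT x. U F x * U P x) + c2\<^sup>2 * (LBINT x. DU F x \<bullet> DU P x)
    + c3\<^sup>2 * (LBINT x. V F x * V P x) + c4\<^sup>2 * (LBINT x. DV F x \<bullet> DV P x)"
proof -
  note L = Hs_components_L2[OF F] Hs_components_L2[OF P]
  have "integrable lborel (\<lambda>x. U F x * U P x)" "integrable lborel (\<lambda>x. DU F x \<bullet> DU P x)"
    "integrable lborel (\<lambda>x. V F x * V P x)" "integrable lborel (\<lambda>x. DV F x \<bullet> DV P x)"
    by (intro L2_mult L2_inner L)+
  then show ?thesis unfolding inner_decompose[of F _ P] by simp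
qed

lemma nsq_decompose:
  assumes F: "Hs F"
  shows "nsq lborel F = c1\<^sup>2 * nsq lborel (U F) + c2\<^sup>2 * nsq lborel (DU F)
    + c3\<^sup>2 * nsq lborel (V F) + c4\<^sup>2 * nsq lborel (DV F)"
  using ip_decompose[OF F F] unfolding nsq_eq_ip by simp

lemma add_components:
  "U (\<lambda>x. F x + t *\<^sub>R P x) = (\<lambda>x. U F x + t * U P x)"
  "DU (\<lambda>x. F x + t *\<^sub>R P x) = (\<lambda>x. DU F x + t *\<^sub>R DU P x)"
  "V (\<lambda>x. F x + t *\<^sub>R P x) = (\<lambda>x. V F x + t * V P x)"
  "DV (\<lambda>x. F x + t *\<^sub>R P x) = (\<lambda>x. DV F x + t *\<^sub>R DV P x)"
  by (auto simp: U_def DU_def V_def DV_def algebra_simps add_divide_distrib)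

lemma Hs_linear: "Hs F \<Longrightarrow> Hs P \<Longrightarrow> Hs (\<lambda>x. F x + t *\<^sub>R P x)"
  unfolding Hs_def add_components by (auto intro: wgrad_linear)

lemma Hs_zero: "Hs (\<lambda>x. 0)"
proof -
  have "wgrad (\<lambda>x::'a. 0) (\<lambda>x. 0)" by (simp add: wgrad_def)
  then show ?thesis by (simp add: Hs_def U_def[abs_def] DU_def[abs_def] V_def[abs_def] DV_def[abs_def])
qed

lemma Hs_scaleR: "Hs F \<Longrightarrow> Hs (\<lambda>x. t *\<^sub>R F x)"
  using Hs_linear[OF Hs_zero, of F t] by simp

lemma scaleR_components: "U (\<lambda>x. t *\<^sub>R F x) = (\<lambda>x. t * U F x)" "V (\<lambda>x. t *\<^sub>R F x) = (\<lambda>x. t * V F x)"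
  by (auto simp: U_def V_def)

lemma B_scaleR: "B (\<lambda>x. t *\<^sub>R F x) = t ^ 3 * B F"
proof -
  have eq: "(t * v) * (t * u) * (t * u) = t ^ 3 * (v * u * u)" for u v :: real
    by (simp add: power3_eq_cube)
  show ?thesis unfolding B_def scaleR_components tri_def eq by (rule integral_mult_right_zero)
qed

lemma Hs_translate: "Hs F \<Longrightarrow> Hs (\<lambda>x. F (x + s))"
  unfolding Hs_def using wgrad_translate[of "U F" "DU F" s] wgrad_translate[of "V F" "DV F" s]
  by (simp add: U_def[abs_def] DU_def[abs_def] V_def[abs_def] DV_def[abs_def])

lemma B_translate:
  assumes "Hs F"
  shows "B (\<lambda>x. F (x + s)) = B F"
proof -
  have [measurable]: "U F \<in> borel_measurable borel" "V F \<in> borel_measurable borel"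
    using Hs_components_L2[OF assms] by (auto simp: L2_def)
  have "B (\<lambda>x. F (x + s)) = (LBINT x. V F (x + s) * U F (x + s) * U F (x + s))"
    by (simp add: B_def tri_def U_def V_def)
  also have "\<dots> = B F"
    unfolding B_def tri_def by (rule integral_lborel_translate) measurable
  finally show ?thesis .
qed

text \<open>The sum dominates each reciprocal squared weight, so one constant bounds all four
  components.\<close>

definition K :: real where
  "K = 1 / c1\<^sup>2 + 1 / c2\<^sup>2 + 1 / c3\<^sup>2 + 1 / c4\<^sup>2"

lemma component_nsq_le:
  assumes "Hs F"
  shows "nsq lborel (U F) \<le> K * nsq lborel F" "nsq lborel (DU F) \<le> K * nsq lborel F"
    "nsq lborel (V F) \<le> K * nsq lborel F" "nsq lborel (DV F) \<le> K * nsq lborel F"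
proof -
  have aux: "s \<le> K * n" if "c\<^sup>2 * s \<le> n" "c \<in> {c1, c2, c3, c4}" "s \<ge> 0" for s n c
  proof -
    have c: "c > 0" using that(2) c_pos by auto
    have "n \<ge> 0" using that(1,3) c by (meson order_trans mult_nonneg_nonneg zero_le_power2)
    have "1 / c\<^sup>2 \<le> K"
    proof -
      have "0 \<le> 1 / c1\<^sup>2" "0 \<le> 1 / c2\<^sup>2" "0 \<le> 1 / c3\<^sup>2" "0 \<le> 1 / c4\<^sup>2" by simp_all
      then show ?thesis using that(2) by (auto simp: K_def)
    qed
    have "s \<le> 1 / c\<^sup>2 * n" using that(1) c by (simp add: field_simps)
    also have "\<dots> \<le> K * n" using \<open>1 / c\<^sup>2 \<le> K\<close> \<open>n \<ge> 0\<close> by (rule mult_right_mono)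
    finally show ?thesis .
  qed
  have nn: "0 \<le> c1\<^sup>2 * nsq lborel (U F)" "0 \<le> c2\<^sup>2 * nsq lborel (DU F)" "0 \<le> c3\<^sup>2 * nsq lborel (V F)" "0 \<le> c4\<^sup>2 * nsq lborel (DV F)"
    by (intro mult_nonneg_nonneg zero_le_power2 nsq_nonneg)+
  note d = nsq_decompose[OF assms]
  show "nsq lborel (U F) \<le> K * nsq lborel F" by (rule aux[of c1]) (use nn d in \<open>linarith | simp\<close>)+
  show "nsq lborel (DU F) \<le> K * nsq lborel F" by (rule aux[of c2]) (use nn d in \<open>linarith | simp\<close>)+
  show "nsq lborel (V F) \<le> K * nsq lborel F" by (rule aux[of c3]) (use nn d in \<open>linarith | simp\<close>)+
  show "nsq lborel (DV F) \<le> K * nsq lborel F" by (rule aux[of c4]) (use nn d in \<open>linarith | simp\<close>)+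
qed

lemma K_nonneg: "K \<ge> 0"
  by (simp add: K_def)

lemma Hs_H1ball:
  assumes "Hs F" "nsq lborel F \<le> R"
  shows "H1ball (K * R) (U F)" "H1ball (K * R) (V F)"
  using component_nsq_le[OF assms(1)] mult_left_mono[OF assms(2) K_nonneg] assms(1)
  unfolding H1ball_def Hs_def by (meson order_trans)+

lemma Hs_H1ball_ex:
  assumes "Hs F"
  shows "H1ball (K * nsq lborel F) (U F)" "H1ball (K * nsq lborel F) (V F)"
  using Hs_H1ball[OF assms order_refl] by auto

text \<open>The expansion is exact because \<open>B\<close> is a cubic form, and its
  \<open>t\<^sup>2\<close> coefficient is the derivative with the roles of \<open>F\<close> and
  \<open>P\<close> exchanged. Hence weak continuity of \<open>dB\<close> is needed in both
  arguments.\<close>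

lemma B_expand:
  assumes F: "Hs F" and P: "Hs P"
  shows "B (\<lambda>x. F x + t *\<^sub>R P x) = B F + t * dB F P + t\<^sup>2 * dB P F + t ^ 3 * B P"
proof -
  note i = tri_integrable[OF dim Hs_H1ball_ex(2)[OF F] Hs_H1ball_ex(1)[OF F] Hs_H1ball_ex(1)[OF F]]
    tri_integrable[OF dim Hs_H1ball_ex(2)[OF F] Hs_H1ball_ex(1)[OF F] Hs_H1ball_ex(1)[OF P]]
    tri_integrable[OF dim Hs_H1ball_ex(2)[OF F] Hs_H1ball_ex(1)[OF P] Hs_H1ball_ex(1)[OF P]]
    tri_integrable[OF dim Hs_H1ball_ex(2)[OF P] Hs_H1ball_ex(1)[OF F] Hs_H1ball_ex(1)[OF F]]
    tri_integrable[OF dim Hs_H1ball_ex(2)[OF P] Hs_H1ball_ex(1)[OF P] Hs_H1ball_ex(1)[OF F]]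
    tri_integrable[OF dim Hs_H1ball_ex(2)[OF P] Hs_H1ball_ex(1)[OF P] Hs_H1ball_ex(1)[OF P]]
  have e: "(V F x + t * V P x) * (U F x + t * U P x) * (U F x + t * U P x)
      = V F x * U F x * U F x + (t * (V P x * U F x * U F x) + (2 * t) * (V F x * U F x * U P x))
        + (t\<^sup>2 * (V F x * U P x * U P x) + (2 * t\<^sup>2) * (V P x * U P x * U F x)) + t ^ 3 * (V P x * U P x * U P x)" for x
    by (simp add: algebra_simps power2_eq_square power3_eq_cube)
  have "B (\<lambda>x. F x + t *\<^sub>R P x) = tri (V F) (U F) (U F)
      + (t * tri (V P) (U F) (U F) + (2 * t) * tri (V F) (U F) (U P))
      + (t\<^sup>2 * tri (V F) (U P) (U P) + (2 * t\<^sup>2) * tri (V P) (U P) (U F)) + t ^ 3 * tri (V P) (U P) (U P)"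
    unfolding B_def add_components tri_def e
    by (simp only: i Bochner_Integration.integral_add Bochner_Integration.integrable_add integrable_mult_right
        integral_mult_right_zero)
  then show ?thesis unfolding B_def dB_def by (simp add: algebra_simps)
qed

lemma dB_diagonal: "dB F F = 3 * B F"
  by (simp add: dB_def B_def)

lemma B_bounded:
  obtains C where "\<And>F. Hs F \<Longrightarrow> nsq lborel F \<le> 1 \<Longrightarrow> B F \<le> C"
proof -
  obtain C where C: "\<And>f g h :: 'a \<Rightarrow> real. H1ball (K * 1) f \<Longrightarrow> H1ball (K * 1) g \<Longrightarrow> H1ball (K * 1) h \<Longrightarrow> \<bar>tri f g h\<bar> \<le> C"
    using tri_bounded[OF dim] by metis
  show ?thesis
  proof (rule that[of C])
    fix F assume "Hs F" "nsq lborel F \<le> 1"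
    from Hs_H1ball[OF this] show "B F \<le> C" using C[of "V F" "U F" "U F"] by (simp add: B_def)
  qed
qed

text \<open>By homogeneity, the best constant in the bound of \<open>B\<close> by the power 3/2 of
  the squared norm.\<close>

definition beta :: real where
  "beta = (SUP F\<in>{F. Hs F \<and> nsq lborel F = 1}. B F)"

lemma B_le_beta1:
  assumes "Hs F" "nsq lborel F = 1"
  shows "B F \<le> beta"
proof -
  obtain C where C: "\<And>F. Hs F \<Longrightarrow> nsq lborel F \<le> 1 \<Longrightarrow> B F \<le> C" using B_bounded by metis
  show ?thesis
    unfolding beta_def by (rule cSUP_upper) (use assms C in \<open>auto intro!: bdd_aboveI[of _ C]\<close>)
qed

text \<open>Normalization and degree 3 homogeneity reduce to the unit sphere. A pair of norm zero
  cannot be normalized, but then \<open>V F\<close> vanishes almost everywhere and so does the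
  integrand.\<close>

lemma B_le_beta:
  assumes F: "Hs F"
  shows "B F \<le> beta * sqrt (nsq lborel F) ^ 3"
proof (cases "nsq lborel F = 0")
  case True
  have "nsq lborel (V F) \<le> 0" using component_nsq_le(3)[OF F] True by simp
  then have "nsq lborel (V F) = 0" using nsq_nonneg[of lborel "V F"] by linarith
  then have "AE x in lborel. V F x = 0" using nsq_eq_0_iff[OF Hs_components_L2(3)[OF F]] by simp
  then have "AE x in lborel. V F x * U F x * U F x = 0" by eventually_elim simp
  then have "B F = 0" unfolding B_def tri_def by (rule integral_eq_zero_AE)
  with True show ?thesis by simp
next
  case False
  then have n: "nsq lborel F > 0" using nsq_nonneg[of lborel F] by linarith
  define s where "s = sqrt (nsq lborel F)"
  have s: "s > 0" "s\<^sup>2 = nsq lborel F" using n by (simp_all add: s_def)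
  have "nsq lborel (\<lambda>x. (1 / s) *\<^sub>R F x) = 1"
    unfolding nsq_scaleR s(2)[symmetric] using s(1) by (simp add: power_divide)
  then have "B (\<lambda>x. (1 / s) *\<^sub>R F x) \<le> beta" by (intro B_le_beta1 Hs_scaleR F)
  then have "(1 / s) ^ 3 * B F \<le> beta" by (simp only: B_scaleR)
  then show ?thesis using s(1) by (simp add: s_def[symmetric] power_divide field_simps)
qed

text \<open>On a pair with both components equal to a bump, \<open>B\<close> is the integral of its
  cube.\<close>

lemma B_positive_exists: "\<exists>F. Hs F \<and> B F > 0"
proof -
  define \<phi> where "\<phi> = bump (0::'a) One 1"
  have w: "wgrad \<phi> (gradient \<phi>)"
    unfolding \<phi>_def by (intro wgrad_test_function bump_test_function)
  have nn: "0 \<le> \<phi> x * \<phi> x * \<phi> x" for x using bump_bounds[of 0 One 1 x] by (simp add: \<phi>_def)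
  have i: "integrable lborel (\<lambda>x. \<phi> x * \<phi> x * \<phi> x)"
    by (rule tri_integrable[OF dim wgrad_H1ball wgrad_H1ball wgrad_H1ball]) (rule w)+
  have "(LBINT x. \<phi> x * \<phi> x * \<phi> x) \<noteq> 0"
  proof
    assume "(LBINT x. \<phi> x * \<phi> x * \<phi> x) = 0"
    then have "AE x in lborel. \<phi> x * \<phi> x * \<phi> x = 0"
      using integral_nonneg_eq_0_iff_AE[OF i] nn by simp
    moreover have "\<phi> x \<noteq> 0" if "x \<in> box 0 One" for x
      unfolding \<phi>_def bump_def using that by (auto simp: mem_box flat_1)
    ultimately have "AE x in lborel. x \<notin> box (0::'a) One" by (auto elim: eventually_mono)
    then have "box (0::'a) One \<in> null_sets lborel" by (subst (asm) AE_iff_null_sets[symmetric]) auto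
    then have "emeasure lborel (box (0::'a) One) = 0" by auto
    then show False by (simp add: emeasure_lborel_box_eq inner_diff_left)
  qed
  moreover have "(LBINT x. \<phi> x * \<phi> x * \<phi> x) \<ge> 0" using nn by (intro Bochner_Integration.integral_nonneg)
  ultimately have "B (mk \<phi> (gradient \<phi>) \<phi> (gradient \<phi>)) > 0" by (simp add: B_def tri_def)
  with w show ?thesis by (intro exI[of _ "mk \<phi> (gradient \<phi>) \<phi> (gradient \<phi>)"]) simp
qed

lemma unit_vector_exists: "{F. Hs F \<and> nsq lborel F = 1} \<noteq> {}"
  and beta_pos: "beta > 0"
proof -
  obtain F where F: "Hs F" "B F > 0" using B_positive_exists by blast
  have lt: "0 < beta * sqrt (nsq lborel F) ^ 3" using F(2) B_le_beta[OF F(1)] by linarith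
  then have "nsq lborel F \<noteq> 0" by auto
  then have n: "nsq lborel F > 0" using nsq_nonneg[of lborel F] by linarith
  have "nsq lborel (\<lambda>x. (1 / sqrt (nsq lborel F)) *\<^sub>R F x) = 1"
    unfolding nsq_scaleR using n by (simp add: power_divide)
  with Hs_scaleR[OF F(1)] show "{F. Hs F \<and> nsq lborel F = 1} \<noteq> {}" by blast
  have "sqrt (nsq lborel F) ^ 3 > 0" using n by (intro zero_less_power real_sqrt_gt_zero)
  with lt show "beta > 0" by (rule zero_less_mult_pos2)
qed

section \<open>Weak limits and the maximizer\<close>

lemma weak_components:
  assumes conv: "weakly_converges lborel F f" and F: "\<And>n. L2 lborel (F n)" and f: "L2 lborel f"
  shows "weakly_converges lborel (\<lambda>n. U (F n)) (U f)" "weakly_converges lborel (\<lambda>n. DU (F n)) (DU f)"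
    "weakly_converges lborel (\<lambda>n. V (F n)) (V f)" "weakly_converges lborel (\<lambda>n. DV (F n)) (DV f)"
proof -
  note wc = weakly_converges_adjoint[OF conv]
  show "weakly_converges lborel (\<lambda>n. U (F n)) (U f)"
    by (rule wc[where T' = "\<lambda>z. ((1 / c1) *\<^sub>R z, 0, 0, 0)"])
      (auto simp: U_def inner_prod_def intro!: bounded_linear_intros bounded_linear_ident bounded_linear_divide)
  show "weakly_converges lborel (\<lambda>n. DU (F n)) (DU f)"
    by (rule wc[where T' = "\<lambda>z. (0, (1 / c2) *\<^sub>R z, 0, 0)"])
      (auto simp: DU_def inner_prod_def intro!: bounded_linear_intros bounded_linear_ident bounded_linear_divide)
  show "weakly_converges lborel (\<lambda>n. V (F n)) (V f)"
    by (rule wc[where T' = "\<lambda>z. (0, 0, (1 / c3) *\<^sub>R z, 0)"])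
      (auto simp: V_def inner_prod_def intro!: bounded_linear_intros bounded_linear_ident bounded_linear_divide)
  show "weakly_converges lborel (\<lambda>n. DV (F n)) (DV f)"
    by (rule wc[where T' = "\<lambda>z. (0, 0, 0, (1 / c4) *\<^sub>R z)"])
      (auto simp: DV_def inner_prod_def intro!: bounded_linear_intros bounded_linear_ident bounded_linear_divide)
qed

text \<open>Both sides of the integration by parts identity are pairings with fixed L2 functions, so
  the identity survives weak convergence.\<close>

lemma wgrad_weak_limit:
  fixes u :: "'a \<Rightarrow> real"
  assumes w: "\<And>n. wgrad (u' n) (G' n)" and u: "weakly_converges lborel u' u" "L2 lborel u"
    and G: "weakly_converges lborel G' G" "L2 lborel G"
  shows "wgrad u G"
  unfolding wgrad_def
proof (intro conjI ballI u G)
  fix \<phi> :: "'a \<Rightarrow> real" and b :: 'a assume \<phi>: "\<phi> \<in> test_functions" and b: "b \<in> Basis"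
  have "(\<lambda>n. LBINT x. u' n x * (gradient \<phi> x \<bullet> b)) \<longlonglongrightarrow> (LBINT x. u x * (gradient \<phi> x \<bullet> b))"
    using weakly_convergesD[OF u(1) test_functions_L2[OF gradient_inner_test_function[OF \<phi> b]]] by simp
  moreover have "(\<lambda>n. - (LBINT x. (G' n x \<bullet> b) * \<phi> x)) \<longlonglongrightarrow> - (LBINT x. (G x \<bullet> b) * \<phi> x)"
  proof -
    have "L2 lborel (\<lambda>x. \<phi> x *\<^sub>R b)"
      by (rule L2_bounded_linear[OF test_functions_L2[OF \<phi>]]) (rule bounded_linear_scaleR_left)
    from tendsto_minus[OF weakly_convergesD[OF G(1) this]] show ?thesis by (simp add: mult.commute)
  qed
  moreover have "(LBINT x. u' n x * (gradient \<phi> x \<bullet> b)) = - (LBINT x. (G' n x \<bullet> b) * \<phi> x)" for n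
    by (rule wgrad_directional[OF w \<phi>])
  ultimately show "(LBINT x. u x * (gradient \<phi> x \<bullet> b)) = - (LBINT x. (G x \<bullet> b) * \<phi> x)"
    using LIMSEQ_unique by simp
qed

lemma Hs_weak_limit:
  assumes "\<And>n. Hs (F n)" "weakly_converges lborel F f" "L2 lborel f"
  shows "Hs f"
  using assms(1) unfolding Hs_def
  by (intro conjI wgrad_weak_limit[OF _ weak_components(1)[OF assms(2) Hs_L2[OF assms(1)] assms(3)] L2_components(1)[OF assms(3)]
        weak_components(2)[OF assms(2) Hs_L2[OF assms(1)] assms(3)] L2_components(2)[OF assms(3)]]
      wgrad_weak_limit[OF _ weak_components(3)[OF assms(2) Hs_L2[OF assms(1)] assms(3)] L2_components(3)[OF assms(3)]
        weak_components(4)[OF assms(2) Hs_L2[OF assms(1)] assms(3)] L2_components(4)[OF assms(3)]]) auto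

text \<open>Every summand contains a component of the fixed \<open>P\<close>. Reordering the
  symmetric product puts that component in the middle, the slot that
  \<open>tri_weakly_continuous\<close> keeps fixed; when \<open>P\<close> occurs twice, its second
  copy is a constant sequence.\<close>

lemma dB_weakly_continuous:
  assumes F: "\<And>n. Hs (F n)" "\<And>n. nsq lborel (F n) = 1" and conv: "weakly_converges lborel F f" and f: "Hs f" and P: "Hs P"
  shows "(\<lambda>n. dB (F n) P) \<longlonglongrightarrow> dB f P" "(\<lambda>n. dB P (F n)) \<longlonglongrightarrow> dB P f"
proof -
  define R where "R = max (K * 1) (max (K * nsq lborel f) (K * nsq lborel P))"
  have b: "H1ball R (U (F n))" "H1ball R (V (F n))" for n
    using Hs_H1ball[OF F(1), of n 1] F(2)[of n] by (auto simp: R_def intro: H1ball_mono)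
  have bf: "H1ball R (U f)" "H1ball R (V f)" "H1ball R (U P)" "H1ball R (V P)"
    using Hs_H1ball_ex[OF f] Hs_H1ball_ex[OF P] by (auto simp: R_def intro: H1ball_mono)
  note w = weak_components[OF conv Hs_L2[OF F(1)] Hs_L2[OF f]]
  note t = tri_weakly_continuous[OF dim]
  have 1: "(\<lambda>n. tri (U (F n)) (V P) (U (F n))) \<longlonglongrightarrow> tri (U f) (V P) (U f)"
    by (rule t[where R = R]) (fact b bf w)+
  have 2: "(\<lambda>n. tri (V (F n)) (U P) (U (F n))) \<longlonglongrightarrow> tri (V f) (U P) (U f)"
    by (rule t[where R = R]) (fact b bf w)+
  have 3: "(\<lambda>n. tri (V (F n)) (U P) (U P)) \<longlonglongrightarrow> tri (V f) (U P) (U P)"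
    by (rule t[where R = R]) (fact b bf w weakly_converges_const)+
  have 4: "(\<lambda>n. tri (U (F n)) (V P) (U P)) \<longlonglongrightarrow> tri (U f) (V P) (U P)"
    by (rule t[where R = R]) (fact b bf w weakly_converges_const)+
  have eq: "dB g P = tri (U g) (V P) (U g) + 2 * tri (V g) (U P) (U g)"
    "dB P g = tri (V g) (U P) (U P) + 2 * tri (U g) (V P) (U P)" for g
    by (simp_all add: dB_def tri_def mult_ac)
  show "(\<lambda>n. dB (F n) P) \<longlonglongrightarrow> dB f P" unfolding eq by (intro tendsto_intros 1 2)
  show "(\<lambda>n. dB P (F n)) \<longlonglongrightarrow> dB P f" unfolding eq by (intro tendsto_intros 3 4)
qed

text \<open>Testing \<open>B \<le> beta * nsq powr (3/2)\<close> along a line through the terms of a maximizing sequence and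
  passing to the weak limit only involves the terms of \<open>B\<close> that are weakly continuous.\<close>

lemma maximizing_sequence_weak_limit:
  assumes F: "\<And>n. Hs (F n)" "\<And>n. nsq lborel (F n) = 1" and conv: "weakly_converges lborel F f" and f: "Hs f"
    and max: "(\<lambda>n. B (F n)) \<longlonglongrightarrow> beta" and P: "Hs P"
  shows "dB f P = 3 * beta * ip lborel f P"
proof -
  \<comment> \<open>The limit of the squared norms along the sequence. Its constant term is 1,
    inherited from the unit vectors, and not the squared norm of \<open>f\<close>.\<close>
  define N where "N t = 1 + 2 * t * ip lborel f P + t\<^sup>2 * nsq lborel P" for t
  \<comment> \<open>Likewise the constant term of the cubic is \<open>beta\<close>, the limit of the
    values, not \<open>B f\<close>. So \<open>g\<close> vanishes at 0 even before \<open>f\<close>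
    is known to be a maximizer.\<close>
  define g where "g t = beta * sqrt (N t) ^ 3 - (beta + t * dB f P + t\<^sup>2 * dB P f + t ^ 3 * B P)" for t
  have "g t \<ge> 0" for t
  proof -
    have "(\<lambda>n. B (\<lambda>x. F n x + t *\<^sub>R P x)) \<longlonglongrightarrow> beta + t * dB f P + t\<^sup>2 * dB P f + t ^ 3 * B P"
      unfolding B_expand[OF F(1) P] by (intro tendsto_intros max dB_weakly_continuous[OF F conv f P])
    moreover have "(\<lambda>n. beta * sqrt (nsq lborel (\<lambda>x. F n x + t *\<^sub>R P x)) ^ 3) \<longlonglongrightarrow> beta * sqrt (N t) ^ 3"
      unfolding nsq_add_scaleR[OF Hs_L2[OF F(1)] Hs_L2[OF P]] F(2) N_def
      by (intro tendsto_intros weakly_convergesD[OF conv Hs_L2[OF P]])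
    ultimately show ?thesis
      unfolding g_def using LIMSEQ_le B_le_beta[OF Hs_linear[OF F(1) P]] by fastforce
  qed
  moreover have "g 0 = 0" by (simp add: g_def N_def)
  moreover have "(g has_real_derivative (3 * beta * ip lborel f P - dB f P)) (at 0)"
    unfolding g_def N_def by (auto intro!: derivative_eq_intros)
  \<comment> \<open>\<open>g\<close> is nonnegative and vanishes at 0, so 0 is a minimum and the
    derivative there is zero.\<close>
  ultimately have "3 * beta * ip lborel f P - dB f P = 0"
    by (intro DERIV_local_min[of g _ 0 1]) auto
  then show ?thesis by simp
qed

theorem maximizer_exists:
  "\<exists>f. Hs f \<and> nsq lborel f = 1 \<and> B f = beta \<and> (\<forall>P. Hs P \<longrightarrow> dB f P = 3 * beta * ip lborel f P)"
proof -
  obtain C where C: "\<And>F. Hs F \<Longrightarrow> nsq lborel F \<le> 1 \<Longrightarrow> B F \<le> C" using B_bounded by metis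
  have bdd: "bdd_above (B ` {F. Hs F \<and> nsq lborel F = 1})"
    using C by (auto intro!: bdd_aboveI[of _ C])
  have "\<exists>F. (Hs F \<and> nsq lborel F = 1) \<and> B F > beta - beta / 2 * (1 / real (Suc n))" for n
  proof -
    have "beta - beta / 2 * (1 / real (Suc n)) < beta" using beta_pos by simp
    then show ?thesis unfolding beta_def using less_cSUP_iff[OF unit_vector_exists bdd] by auto
  qed
  then obtain F where F: "\<And>n. Hs (F n)" "\<And>n. nsq lborel (F n) = 1"
    and FB: "\<And>n. B (F n) > beta - beta / 2 * (1 / real (Suc n))" by metis
  have lim: "(\<lambda>n. B (F n)) \<longlonglongrightarrow> beta"
  proof (rule tendsto_sandwich[OF _ _ _ tendsto_const])
    have "(\<lambda>n. beta - beta / 2 * (1 / real (Suc n))) \<longlonglongrightarrow> beta - beta / 2 * 0"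
      by (intro tendsto_intros lim_1_over_n[THEN LIMSEQ_Suc])
    then show "(\<lambda>n. beta - beta / 2 * (1 / real (Suc n))) \<longlonglongrightarrow> beta" by simp
  qed (use FB F B_le_beta1 in \<open>auto intro!: always_eventually less_imp_le\<close>)
  \<comment> \<open>The slack carries the factor beta/2 so that this positive lower bound holds from
    the first term on, as the non-vanishing lemma needs for each \<open>n\<close>.\<close>
  have half: "B (F n) \<ge> beta / 2" for n
  proof -
    have "beta / 2 * (1 / real (Suc n)) \<le> beta / 2 * 1"
      using beta_pos by (intro mult_left_mono) auto
    then show ?thesis using FB[of n] by linarith
  qed
  have "beta / 2 > 0" using beta_pos by simp
  from tri_nonvanishing[OF dim this, of "K * 1"] obtain j d where d: "d > 0"
    and nv: "\<And>u v :: 'a \<Rightarrow> real. H1ball (K * 1) u \<Longrightarrow> H1ball (K * 1) v \<Longrightarrow> tri v u u \<ge> beta / 2 \<Longrightarrow> \<exists>x. \<bar>dyadic_avg j v x\<bar> \<ge> d"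
    by metis
  have "\<exists>x. \<bar>dyadic_avg j (V (F n)) x\<bar> \<ge> d" for n
    using nv[OF Hs_H1ball[OF F(1)]] F(2) half[of n] by (simp add: B_def)
  then obtain y where y: "\<And>n. \<bar>dyadic_avg j (V (F n)) (y n)\<bar> \<ge> d" by metis
  \<comment> \<open>Recentring moves the point with a large average to the origin, so a single
    average functional detects the weak limit.\<close>
  define E where "E n = (\<lambda>x. F n (x + y n))" for n
  have E: "Hs (E n)" "nsq lborel (E n) = 1" "B (E n) = B (F n)" for n
    unfolding E_def using Hs_translate[OF F(1)] nsq_translate[OF Hs_L2[OF F(1)]] F(2) B_translate[OF F(1)] by simp_all
  have Ed: "\<bar>dyadic_avg j (V (E n)) 0\<bar> \<ge> d" for n
  proof -
    have "V (E n) = (\<lambda>x. V (F n) (x + y n))" by (simp add: E_def V_def[abs_def])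
    then have "dyadic_avg j (V (E n)) 0 = dyadic_avg j (V (F n)) (y n)"
      using avg_translate[of _ "V (F n)" "y n" 0] by (simp add: dyadic_avg_def)
    with y show ?thesis by simp
  qed
  obtain r f where r: "strict_mono (r :: nat \<Rightarrow> nat)" and fL: "L2 lborel f"
    and conv: "\<And>g. L2 lborel g \<Longrightarrow> (\<lambda>n. ip lborel (E (r n)) g) \<longlonglongrightarrow> ip lborel f g"
    by (rule L2_lborel_weakly_sequentially_compact[of E 1, OF Hs_L2[OF E(1)]]) (use E(2) in auto)
  have w: "weakly_converges lborel (\<lambda>n. E (r n)) f" using conv by (simp add: weakly_converges_def)
  have f: "Hs f" by (rule Hs_weak_limit[OF E(1) w fL])
  have max: "(\<lambda>n. B (E (r n))) \<longlonglongrightarrow> beta"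
    using LIMSEQ_subseq_LIMSEQ[OF lim r] by (simp add: E(3) o_def)
  have EL: "dB f P = 3 * beta * ip lborel f P" if "Hs P" for P
    by (rule maximizing_sequence_weak_limit[OF E(1,2) w f max that])
  define s where "s = sqrt (nsq lborel f)"
  have s0: "s \<ge> 0" "s\<^sup>2 = nsq lborel f" by (simp_all add: s_def)
  \<comment> \<open>The average at the origin is weakly continuous, so it stays at least
    \<open>d\<close> in absolute value and the limit cannot be zero.\<close>
  have "nsq lborel f \<noteq> 0"
  proof
    assume 0: "nsq lborel f = 0"
    have "nsq lborel (V f) \<le> 0" using component_nsq_le(3)[OF f] 0 by simp
    then have V0: "nsq lborel (V f) = 0" using nsq_nonneg[of lborel "V f"] by linarith
    have "(dyadic_avg j (V f) 0)\<^sup>2 \<le> nsq lborel (V f) / ((1/64) ^ j) ^ DIM('a)"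
      unfolding dyadic_avg_def by (rule avg_square_le[OF Hs_components_L2(3)[OF f]]) simp
    then have z: "dyadic_avg j (V f) 0 = 0" unfolding V0 by simp
    have "(\<lambda>n. \<bar>dyadic_avg j (V (E (r n))) 0\<bar>) \<longlonglongrightarrow> \<bar>dyadic_avg j (V f) 0\<bar>"
      by (intro tendsto_rabs weakly_converges_dyadic_avg[OF weak_components(3)[OF w Hs_L2[OF E(1)] fL]
            Hs_components_L2(3)[OF E(1)] Hs_components_L2(3)[OF f]])
    then have "d \<le> \<bar>dyadic_avg j (V f) 0\<bar>" by (rule LIMSEQ_le_const) (use Ed in blast)
    with z d show False by simp
  qed
  then have "nsq lborel f > 0" using nsq_nonneg[of lborel f] by linarith
  then have s: "s > 0" unfolding s_def by (rule real_sqrt_gt_zero)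
  \<comment> \<open>Weak lower semicontinuity by pairing with \<open>f\<close> itself:
    Cauchy-Schwarz on the unit vectors gives \<open>s\<^sup>2\<close> \<le> s.\<close>
  have "nsq lborel f \<le> s"
  proof (rule LIMSEQ_le_const2)
    show "(\<lambda>n. ip lborel (E (r n)) f) \<longlonglongrightarrow> nsq lborel f" using conv[OF fL] by (simp add: power2_norm_eq_inner)
    have "ip lborel (E (r n)) f \<le> s" for n
      using ip_abs_le[OF Hs_L2[OF E(1)] fL, of "r n"] by (simp add: E(2) s_def)
    then show "\<exists>N. \<forall>n\<ge>N. ip lborel (E (r n)) f \<le> s" by blast
  qed
  then have "s * s \<le> s * 1" unfolding s0(2)[symmetric] by (simp only: power2_eq_square mult_1_right)
  then have s1: "s \<le> 1" using s by (rule mult_left_le_imp_le)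
  have "3 * B f = 3 * beta * nsq lborel f"
    using EL[OF f] by (simp add: dB_diagonal power2_norm_eq_inner)
  then have Bf: "B f = beta * s\<^sup>2" using s0 by simp
  have "B f \<le> beta * s ^ 3" using B_le_beta[OF f] by (simp add: s_def)
  \<comment> \<open>The equation gives degree 2 in \<open>s\<close> and the inequality degree 3, so
    s cannot be below 1.\<close>
  then have "s\<^sup>2 * 1 \<le> s\<^sup>2 * s" using beta_pos by (simp add: Bf power3_eq_cube power2_eq_square mult.assoc)
  then have "1 \<le> s" using s by (simp add: mult_le_cancel_left)
  with s1 have "s = 1" by simp
  with Bf s0 f EL show ?thesis by (intro exI[of _ f]) auto
qed

end

section \<open>The ground state\<close>

text \<open>Passage from the completed measure of the definitions to \<open>lborel\<close>, done
  coordinate by coordinate because the real-valued completion result is available for each inner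
  product with a basis vector.\<close>

lemma lebesgue_borel_representative:
  fixes f :: "'a::euclidean_space \<Rightarrow> 'b::euclidean_space"
  assumes f: "f \<in> borel_measurable lebesgue"
  obtains f' where "f' \<in> borel_measurable borel" "AE x in lborel. f x = f' x"
proof -
  have "\<exists>g\<in>borel_measurable lborel. AE x in lborel. f x \<bullet> b = g x" for b
    by (rule completion_ex_borel_measurable_real) (use f in measurable)
  then obtain g where g: "\<And>b. g b \<in> borel_measurable lborel" "\<And>b. AE x in lborel. f x \<bullet> b = g b x"
    by metis
  define f' where "f' x = (\<Sum>b\<in>Basis. g b x *\<^sub>R b)" for x
  have [measurable]: "g b \<in> borel_measurable borel" for b using g(1)[of b] by simp
  have m: "f' \<in> borel_measurable borel" unfolding f'_def[abs_def] by measurable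
  have "AE x in lborel. \<forall>b\<in>Basis. f x \<bullet> b = g b x" using g(2) by (simp add: AE_finite_all)
  then have "AE x in lborel. f x = f' x"
  proof eventually_elim
    case (elim x)
    have "f x = (\<Sum>b\<in>Basis. (f x \<bullet> b) *\<^sub>R b)" by (simp add: euclidean_representation)
    also have "\<dots> = f' x" unfolding f'_def using elim by (intro sum.cong) auto
    finally show ?case .
  qed
  with m show ?thesis by (rule that)
qed

lemma AE_lebesgue_iff: "(AE x in lebesgue. P x) \<longleftrightarrow> (AE x in lborel. P x)"
  by (rule AE_completion_iff)

lemma borel_imp_lebesgue_measurable: "f \<in> borel_measurable borel \<Longrightarrow> f \<in> borel_measurable lebesgue"
  by (rule measurable_completion) simp

lemma
  fixes f f' :: "'a::euclidean_space \<Rightarrow> real"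
  assumes f: "f \<in> borel_measurable lebesgue" and f': "f' \<in> borel_measurable borel"
    and eq: "AE x in lborel. f x = f' x"
  shows lebesgue_integral_eq_lborel: "(LINT x|lebesgue. f x) = (LBINT x. f' x)"
    and lebesgue_integrable_iff_lborel: "integrable lebesgue f \<longleftrightarrow> integrable lborel f'"
proof -
  have eq': "AE x in lebesgue. f x = f' x" using eq by (simp add: AE_lebesgue_iff)
  note m = borel_imp_lebesgue_measurable[OF f']
  have "(LINT x|lebesgue. f x) = (LINT x|lebesgue. f' x)" by (rule integral_cong_AE[OF f m eq'])
  also have "\<dots> = (LBINT x. f' x)" by (rule integral_completion) (use f' in simp)
  finally show "(LINT x|lebesgue. f x) = (LBINT x. f' x)" .
  have "integrable lebesgue f \<longleftrightarrow> integrable lebesgue f'" by (rule integrable_cong_AE[OF f m eq'])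
  also have "\<dots> \<longleftrightarrow> integrable lborel f'" by (rule integrable_completion) (use f' in simp)
  finally show "integrable lebesgue f \<longleftrightarrow> integrable lborel f'" .
qed

lemma square_integrable_iff_L2:
  fixes f f' :: "'a::euclidean_space \<Rightarrow> 'b::euclidean_space"
  assumes f: "f \<in> borel_measurable lebesgue" and f': "f' \<in> borel_measurable borel"
    and eq: "AE x in lborel. f x = f' x"
  shows "square_integrable f \<longleftrightarrow> L2 lborel f'"
proof -
  have "integrable lebesgue (\<lambda>x. (norm (f x))\<^sup>2) \<longleftrightarrow> integrable lborel (\<lambda>x. (norm (f' x))\<^sup>2)"
  proof (rule lebesgue_integrable_iff_lborel)
    show "(\<lambda>x. (norm (f x))\<^sup>2) \<in> borel_measurable lebesgue" using f by measurable
    show "(\<lambda>x. (norm (f' x))\<^sup>2) \<in> borel_measurable borel" using f' by measurable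
    show "AE x in lborel. (norm (f x))\<^sup>2 = (norm (f' x))\<^sup>2" using eq by eventually_elim simp
  qed
  with f f' show ?thesis by (simp add: square_integrable_def L2_def)
qed

lemma has_weak_gradient_iff:
  fixes u :: "'a::euclidean_space \<Rightarrow> real"
  assumes u: "u \<in> borel_measurable lebesgue" "u' \<in> borel_measurable borel" "AE x in lborel. u x = u' x"
    and G: "G \<in> borel_measurable lebesgue" "G' \<in> borel_measurable borel" "AE x in lborel. G x = G' x"
  shows "has_weak_gradient u G \<longleftrightarrow> (\<forall>\<phi>\<in>test_functions. \<forall>b\<in>Basis.
        (LBINT x. u' x * (gradient \<phi> x \<bullet> b)) = - (LBINT x. (G' x \<bullet> b) * \<phi> x))"
proof -
  have "(LINT x|lebesgue. u x * (gradient \<phi> x \<bullet> b)) = (LBINT x. u' x * (gradient \<phi> x \<bullet> b))"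
    "(LINT x|lebesgue. (G x \<bullet> b) * \<phi> x) = (LBINT x. (G' x \<bullet> b) * \<phi> x)"
    if \<phi>: "\<phi> \<in> test_functions" for \<phi> b
  proof -
    have g: "gradient \<phi> \<in> borel_measurable borel" using gradient_L2[OF \<phi>] by (simp add: L2_def)
    note p = test_functions_measurable[OF \<phi>]
    note [measurable] = u(1,2) G(1,2) g p borel_imp_lebesgue_measurable[OF g] borel_imp_lebesgue_measurable[OF p]
    show "(LINT x|lebesgue. u x * (gradient \<phi> x \<bullet> b)) = (LBINT x. u' x * (gradient \<phi> x \<bullet> b))"
    proof (rule lebesgue_integral_eq_lborel)
      show "AE x in lborel. u x * (gradient \<phi> x \<bullet> b) = u' x * (gradient \<phi> x \<bullet> b)" using u(3) by eventually_elim simp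
    qed measurable
    show "(LINT x|lebesgue. (G x \<bullet> b) * \<phi> x) = (LBINT x. (G' x \<bullet> b) * \<phi> x)"
    proof (rule lebesgue_integral_eq_lborel)
      show "AE x in lborel. (G x \<bullet> b) * \<phi> x = (G' x \<bullet> b) * \<phi> x" using G(3) by eventually_elim simp
    qed measurable
  qed
  then show ?thesis unfolding has_weak_gradient_def by simp
qed

text \<open>Ties an element of \<open>H1\<close> and the gradient chosen by
  \<open>weak_gradient\<close> to Borel versions, to which the theory of \<open>wgrad\<close>
  applies.\<close>

definition represents :: "('a::euclidean_space \<Rightarrow> real) \<Rightarrow> ('a \<Rightarrow> 'a) \<Rightarrow> ('a \<Rightarrow> real) \<Rightarrow> bool" where
  "represents u' G' u \<longleftrightarrow> u \<in> H1 \<and> wgrad u' G' \<and> u \<in> borel_measurable lebesgue \<and>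
     weak_gradient u \<in> borel_measurable lebesgue \<and>
     (AE x in lborel. u x = u' x) \<and> (AE x in lborel. weak_gradient u x = G' x)"

lemma wgrad_of_lebesgue:
  assumes u: "square_integrable u" and G: "square_integrable G" and w: "has_weak_gradient u G"
  obtains u' G' where "wgrad u' G'" "AE x in lborel. u x = u' x" "AE x in lborel. G x = G' x"
proof -
  have m: "u \<in> borel_measurable lebesgue" "G \<in> borel_measurable lebesgue"
    using u G by (auto simp: square_integrable_def)
  obtain u' where u': "u' \<in> borel_measurable borel" "AE x in lborel. u x = u' x"
    using lebesgue_borel_representative[OF m(1)] by metis
  obtain G' where G': "G' \<in> borel_measurable borel" "AE x in lborel. G x = G' x"
    using lebesgue_borel_representative[OF m(2)] by metis
  have "wgrad u' G'"
    unfolding wgrad_def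
    using w u G has_weak_gradient_iff[OF m(1) u' m(2) G'] square_integrable_iff_L2[OF m(1) u'] square_integrable_iff_L2[OF m(2) G']
    by simp
  with u'(2) G'(2) show ?thesis by (intro that)
qed

lemma weak_gradient_properties:
  assumes "u \<in> H1"
  shows "square_integrable (weak_gradient u)" "has_weak_gradient u (weak_gradient u)"
proof -
  have "\<exists>G. square_integrable G \<and> has_weak_gradient u G" using assms by (simp add: H1_def)
  from someI_ex[OF this] show "square_integrable (weak_gradient u)" "has_weak_gradient u (weak_gradient u)"
    unfolding weak_gradient_def by auto
qed

text \<open>The arbitrary choice in \<open>weak_gradient\<close> is harmless: by
  \<open>wgrad_unique\<close> any gradient of a Borel representative agrees with it almost
  everywhere.\<close>

lemma representsI:
  assumes w: "wgrad u' G'" and m: "u \<in> borel_measurable lebesgue" and eq: "AE x in lborel. u x = u' x"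
  shows "represents u' G' u"
proof -
  have u': "u' \<in> borel_measurable borel" and G': "G' \<in> borel_measurable borel"
    using wgradD[OF w] by (auto simp: L2_def)
  note mG = borel_imp_lebesgue_measurable[OF G']
  have su: "square_integrable u" using square_integrable_iff_L2[OF m u' eq] wgradD[OF w] by simp
  have "square_integrable G'" using square_integrable_iff_L2[OF mG G'] wgradD[OF w] by simp
  moreover have "has_weak_gradient u G'"
    using has_weak_gradient_iff[OF m u' eq mG G'] w by (simp add: wgrad_def)
  ultimately have H1: "u \<in> H1" using su by (auto simp: H1_def)
  note p = weak_gradient_properties[OF H1]
  obtain u'' G'' where *: "wgrad u'' G''" "AE x in lborel. u x = u'' x" "AE x in lborel. weak_gradient u x = G'' x"
    using wgrad_of_lebesgue[OF su p] by metis
  have "AE x in lborel. u'' x = u' x" using *(2) eq by eventually_elim simp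
  from wgrad_unique[OF *(1) w this] *(3) have "AE x in lborel. weak_gradient u x = G' x"
    by eventually_elim simp
  with w H1 m eq p show ?thesis by (simp add: represents_def square_integrable_def)
qed

lemma H1_represented:
  assumes "u \<in> H1" obtains u' G' where "represents u' G' u"
proof -
  have u: "square_integrable u" using assms by (simp add: H1_def)
  from wgrad_of_lebesgue[OF u weak_gradient_properties[OF assms]]
  obtain u' G' where "wgrad u' G'" "AE x in lborel. u x = u' x" by metis
  from representsI[OF this(1) _ this(2)] u that show ?thesis by (simp add: square_integrable_def)
qed

lemma wgrad_represents: "wgrad u G \<Longrightarrow> represents u G u"
  using wgradD(1)[of u G] by (intro representsI borel_imp_lebesgue_measurable) (auto simp: L2_def)

lemma represents_linear:
  assumes u: "represents u' G' u" and v: "represents v' H' v"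
  shows "represents (\<lambda>x. u' x + c * v' x) (\<lambda>x. G' x + c *\<^sub>R H' x) (\<lambda>x. u x + c * v x)"
proof (rule representsI)
  have [measurable]: "u \<in> borel_measurable lebesgue" "v \<in> borel_measurable lebesgue"
    using u v by (auto simp: represents_def)
  show "(\<lambda>x. u x + c * v x) \<in> borel_measurable lebesgue" by measurable
  show "wgrad (\<lambda>x. u' x + c * v' x) (\<lambda>x. G' x + c *\<^sub>R H' x)"
    using u v by (intro wgrad_linear) (auto simp: represents_def)
  have "AE x in lborel. u x = u' x" "AE x in lborel. v x = v' x" using u v by (auto simp: represents_def)
  then show "AE x in lborel. u x + c * v x = u' x + c * v' x" by eventually_elim simp
qed

lemma represents_integrals:
  assumes u: "represents u' G' u" and v: "represents v' H' v"
  shows "(LINT x|lebesgue. (norm (weak_gradient u x))\<^sup>2) = nsq lborel G'"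
    "(LINT x|lebesgue. (u x)\<^sup>2) = nsq lborel u'"
    "(LINT x|lebesgue. v x * (u x)\<^sup>2) = tri v' u' u'"
proof -
  have a: "AE x in lborel. u x = u' x" "AE x in lborel. weak_gradient u x = G' x" "AE x in lborel. v x = v' x"
    using u v by (auto simp: represents_def)
  have m: "u \<in> borel_measurable lebesgue" "weak_gradient u \<in> borel_measurable lebesgue" "v \<in> borel_measurable lebesgue"
    using u v by (auto simp: represents_def)
  have m': "u' \<in> borel_measurable borel" "G' \<in> borel_measurable borel" "v' \<in> borel_measurable borel"
    using u v by (auto simp: represents_def L2_def dest: wgradD)
  note [measurable] = m m'
  show "(LINT x|lebesgue. (norm (weak_gradient u x))\<^sup>2) = nsq lborel G'"
    by (rule lebesgue_integral_eq_lborel; (measurable; fail)?) (use a(2) in \<open>eventually_elim, simp\<close>)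
  have "(LINT x|lebesgue. (u x)\<^sup>2) = (LBINT x. (u' x)\<^sup>2)"
    by (rule lebesgue_integral_eq_lborel; (measurable; fail)?) (use a(1) in \<open>eventually_elim, simp\<close>)
  then show "(LINT x|lebesgue. (u x)\<^sup>2) = nsq lborel u'" by simp
  have "(LINT x|lebesgue. v x * (u x)\<^sup>2) = (LBINT x. v' x * (u' x)\<^sup>2)"
    by (rule lebesgue_integral_eq_lborel; (measurable; fail)?) (use a(1,3) in \<open>eventually_elim, simp\<close>)
  then show "(LINT x|lebesgue. v x * (u x)\<^sup>2) = tri v' u' u'" by (simp add: tri_def power2_eq_square mult.assoc)
qed

lemma represents_nontrivial:
  assumes u: "represents u' G' u" and v: "represents v' H' v" and "nontrivial u v"
  shows "\<not> (nsq lborel u' = 0 \<and> nsq lborel v' = 0)"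
proof
  assume *: "nsq lborel u' = 0 \<and> nsq lborel v' = 0"
  have "L2 lborel u'" "L2 lborel v'" using u v by (auto simp: represents_def dest: wgradD)
  from this[THEN nsq_eq_0_iff] * have "AE x in lborel. u' x = 0" "AE x in lborel. v' x = 0" by auto
  moreover have "AE x in lborel. u x = u' x" "AE x in lborel. v x = v' x" using u v by (auto simp: represents_def)
  ultimately have "AE x in lborel. u x = 0 \<and> v x = 0" by eventually_elim simp
  with \<open>nontrivial u v\<close> show False by (simp add: nontrivial_def AE_lebesgue_iff)
qed

section \<open>The functionals and the constrained minimum\<close>

locale elliptic_system =
  fixes m1 m2 a1 a2 :: real and type :: "'a::euclidean_space itself"
  assumes pos: "m1 > 0" "m2 > 0" "a1 > 0" "a2 > 0" and dim5: "DIM('a) = 5"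
begin

text \<open>The weights are the square roots of the coefficients in the quadratic part of
  \<open>S_functional\<close>, so that part is exactly the squared norm of the packed pair.\<close>

sublocale h1_pairs "m1 * sqrt (a2 * m2)" "sqrt (a2 * m2)" "m2 * sqrt (a1 * m1 / 2)" "sqrt (a1 * m1 / 2)" type
  using pos dim5 by unfold_locales auto

abbreviation c :: real where "c \<equiv> a1 * a2 * m1 * m2"

lemma c_gt_0: "c > 0"
  using pos by simp

lemma squares: "(m1 * sqrt (a2 * m2))\<^sup>2 = a2 * m2 * m1\<^sup>2" "(sqrt (a2 * m2))\<^sup>2 = a2 * m2"
  "(m2 * sqrt (a1 * m1 / 2))\<^sup>2 = a1 * m1 / 2 * m2\<^sup>2" "(sqrt (a1 * m1 / 2))\<^sup>2 = a1 * m1 / 2"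
  using pos by (simp_all add: power_mult_distrib)

lemma
  assumes u: "represents u' G' u" and v: "represents v' H' v"
  shows S_eq: "S_functional m1 m2 a1 a2 u v = nsq lborel (mk u' G' v' H') - 2 * c * B (mk u' G' v' H')"
    and Q_eq: "Q_functional m1 m2 a1 a2 u v = 2 * nsq lborel (mk u' G' v' H') - 6 * c * B (mk u' G' v' H')"
    and Hs_represents: "Hs (mk u' G' v' H')"
proof -
  show Hs: "Hs (mk u' G' v' H')" using u v by (simp add: represents_def)
  show "S_functional m1 m2 a1 a2 u v = nsq lborel (mk u' G' v' H') - 2 * c * B (mk u' G' v' H')"
    unfolding S_functional_def represents_integrals[OF u v] represents_integrals(1,2)[OF v u] nsq_decompose[OF Hs] mk_components
      B_def squares by (simp add: algebra_simps)
  show "Q_functional m1 m2 a1 a2 u v = 2 * nsq lborel (mk u' G' v' H') - 6 * c * B (mk u' G' v' H')"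
    unfolding Q_functional_def represents_integrals[OF u v] represents_integrals(1,2)[OF v u] nsq_decompose[OF Hs] mk_components
      B_def squares by (simp add: algebra_simps)
qed

text \<open>For a pair of norm s, the constraint reads \<open>s\<^sup>2\<close> = 3 c B \<le> 3 c
  beta \<open>s\<^sup>3\<close>, hence s \<ge> 1/(3 c beta), while the constrained value of the
  functional is \<open>s\<^sup>2\<close>/3.\<close>

lemma M_set_lower_bound:
  fixes u v :: "'a \<Rightarrow> real"
  assumes "(u, v) \<in> M_set m1 m2 a1 a2"
  shows "S_functional m1 m2 a1 a2 u v \<ge> (1 / (3 * c * beta))\<^sup>2 / 3"
proof -
  have H: "u \<in> H1" "v \<in> H1" and nt: "nontrivial u v" and Q: "Q_functional m1 m2 a1 a2 u v = 0"
    using assms by (auto simp: M_set_def)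
  obtain u' G' where u: "represents u' G' u" using H1_represented[OF H(1)] by metis
  obtain v' H' where v: "represents v' H' v" using H1_represented[OF H(2)] by metis
  define F where "F = mk u' G' v' H'"
  have F: "Hs F" unfolding F_def by (rule Hs_represents[OF u v])
  define s where "s = sqrt (nsq lborel F)"
  have s2: "nsq lborel F = s\<^sup>2" by (simp add: s_def)
  have "nsq lborel F \<noteq> 0"
  proof
    assume 0: "nsq lborel F = 0"
    have "nsq lborel u' \<le> 0" "nsq lborel v' \<le> 0"
      using component_nsq_le(1,3)[OF F] unfolding 0 by (simp_all only: F_def mk_components mult_zero_right)
    with nsq_nonneg[of lborel u'] nsq_nonneg[of lborel v'] represents_nontrivial[OF u v nt] show False by linarith
  qed
  then have s: "s > 0" using nsq_nonneg[of lborel F] unfolding s_def by (intro real_sqrt_gt_zero) linarith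
  have Q': "2 * s\<^sup>2 = 6 * c * B F" using Q Q_eq[OF u v] s2 by (simp add: F_def)
  have "B F \<le> beta * s ^ 3" using B_le_beta[OF F] by (simp add: s_def)
  then have "6 * c * B F \<le> 6 * c * (beta * s ^ 3)" using c_gt_0 by (intro mult_left_mono) auto
  with Q' have "s\<^sup>2 * 1 \<le> s\<^sup>2 * (3 * c * beta * s)"
    by (simp add: power2_eq_square power3_eq_cube algebra_simps)
  then have "1 \<le> 3 * c * beta * s" by (rule mult_left_le_imp_le) (use s in simp)
  moreover have cb: "3 * c * beta > 0" using c_gt_0 beta_pos by simp
  ultimately have "1 / (3 * c * beta) \<le> s" by (simp add: divide_le_eq mult.commute)
  then have "(1 / (3 * c * beta))\<^sup>2 \<le> s\<^sup>2" using cb by (intro power_mono) auto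
  moreover have "S_functional m1 m2 a1 a2 u v = s\<^sup>2 / 3"
    using S_eq[OF u v] s2 Q' by (simp add: F_def)
  ultimately show ?thesis by simp
qed

text \<open>Along its own direction the functional is (1 + t)^2 A - 2c (1 + t)^3 B, whose derivative
  at 0 is 2A - 6cB, the value of \<open>Q_functional\<close>.\<close>

lemma critical_point_in_M_set:
  fixes u v :: "'a \<Rightarrow> real"
  assumes cp: "critical_point m1 m2 a1 a2 u v" and nt: "nontrivial u v"
  shows "(u, v) \<in> M_set m1 m2 a1 a2"
proof -
  have H: "u \<in> H1" "v \<in> H1"
    and D: "((\<lambda>t. S_functional m1 m2 a1 a2 (\<lambda>x. u x + t * u x) (\<lambda>x. v x + t * v x)) has_real_derivative 0) (at 0)"
    using cp by (auto simp: critical_point_def)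
  obtain u' G' where u: "represents u' G' u" using H1_represented[OF H(1)] by metis
  obtain v' H' where v: "represents v' H' v" using H1_represented[OF H(2)] by metis
  define F where "F = mk u' G' v' H'"
  have "S_functional m1 m2 a1 a2 (\<lambda>x. u x + t * u x) (\<lambda>x. v x + t * v x) = (1 + t)\<^sup>2 * nsq lborel F - 2 * c * ((1 + t) ^ 3 * B F)" for t
  proof -
    have eq: "mk (\<lambda>x. u' x + t * u' x) (\<lambda>x. G' x + t *\<^sub>R G' x) (\<lambda>x. v' x + t * v' x) (\<lambda>x. H' x + t *\<^sub>R H' x) = (\<lambda>x. (1 + t) *\<^sub>R F x)"
      by (auto simp: mk_def F_def algebra_simps)
    show ?thesis
      using S_eq[OF represents_linear[OF u u, of t] represents_linear[OF v v, of t]] unfolding eq B_scaleR nsq_scaleR .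
  qed
  with D have "((\<lambda>t. (1 + t)\<^sup>2 * nsq lborel F - 2 * c * ((1 + t) ^ 3 * B F)) has_real_derivative 0) (at 0)" by simp
  moreover have "((\<lambda>t. (1 + t)\<^sup>2 * nsq lborel F - 2 * c * ((1 + t) ^ 3 * B F)) has_real_derivative (2 * nsq lborel F - 6 * c * B F)) (at 0)"
    by (auto intro!: derivative_eq_intros)
  ultimately have "2 * nsq lborel F - 6 * c * B F = 0" by (rule DERIV_unique[symmetric])
  then have "Q_functional m1 m2 a1 a2 u v = 0" using Q_eq[OF u v] by (simp add: F_def)
  with H nt show ?thesis by (simp add: M_set_def)
qed

lemma represents_test_integrals:
  assumes w: "wgrad u G" and \<phi>: "\<phi> \<in> test_functions"
  shows "(LINT x|lebesgue. weak_gradient u x \<bullet> gradient \<phi> x) = ip lborel G (gradient \<phi>)"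
    "(LINT x|lebesgue. u x * \<phi> x) = (LBINT x. u x * \<phi> x)"
    "wgrad v H \<Longrightarrow> (LINT x|lebesgue. u x * v x * \<phi> x) = tri u v \<phi>"
proof -
  have r: "u \<in> borel_measurable lebesgue" "weak_gradient u \<in> borel_measurable lebesgue" "AE x in lborel. weak_gradient u x = G x"
    using wgrad_represents[OF w] by (auto simp: represents_def)
  have m: "u \<in> borel_measurable borel" "G \<in> borel_measurable borel" "gradient \<phi> \<in> borel_measurable borel" "\<phi> \<in> borel_measurable borel"
    using wgradD[OF w] gradient_L2[OF \<phi>] test_functions_measurable[OF \<phi>] by (auto simp: L2_def)
  note [measurable] = r(1,2) m m(3,4)[THEN borel_imp_lebesgue_measurable]
  show "(LINT x|lebesgue. weak_gradient u x \<bullet> gradient \<phi> x) = ip lborel G (gradient \<phi>)"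
    by (rule lebesgue_integral_eq_lborel; (measurable; fail)?) (use r(3) in \<open>eventually_elim, simp\<close>)
  show "(LINT x|lebesgue. u x * \<phi> x) = (LBINT x. u x * \<phi> x)"
    by (rule lebesgue_integral_eq_lborel; (measurable; fail)?)
  assume "wgrad v H"
  then have [measurable]: "v \<in> borel_measurable borel" by (auto simp: L2_def dest: wgradD)
  note [measurable] = borel_imp_lebesgue_measurable[OF this]
  show "(LINT x|lebesgue. u x * v x * \<phi> x) = tri u v \<phi>"
    unfolding tri_def by (rule lebesgue_integral_eq_lborel; (measurable; fail)?)
qed

theorem ground_state_exists:
  "\<exists>w \<xi> :: 'a \<Rightarrow> real. (w, \<xi>) \<in> M_set m1 m2 a1 a2 \<and>
    S_functional m1 m2 a1 a2 w \<xi> = (INF (u, v) \<in> (M_set m1 m2 a1 a2 :: (('a \<Rightarrow> real) \<times> ('a \<Rightarrow> real)) set). S_functional m1 m2 a1 a2 u v) \<and>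
    ground_state m1 m2 a1 a2 w \<xi>"
proof -
  obtain f where f: "Hs f" "nsq lborel f = 1" "B f = beta" and EL: "\<forall>P. Hs P \<longrightarrow> dB f P = 3 * beta * ip lborel f P"
    using maximizer_exists by (elim exE conjE) (rule that)
  \<comment> \<open>The one positive multiple of \<open>f\<close> on the constraint: 2 \<tau>^2 = 6
    c \<tau>^3 beta. The same factor removes the multiplier 3 beta from the Euler-Lagrange
    equation.\<close>
  define \<tau> where "\<tau> = 1 / (3 * c * beta)"
  have cb: "3 * c * beta > 0" using c_gt_0 beta_pos by simp
  have \<tau>: "\<tau> > 0" "3 * c * beta * \<tau> = 1"
  proof -
    have "1 / d > 0 \<and> d * (1 / d) = 1" if "d > 0" for d :: real using that by simp
    from this[OF cb] show "\<tau> > 0" "3 * c * beta * \<tau> = 1" unfolding \<tau>_def by blast+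
  qed
  define F where "F = (\<lambda>x. \<tau> *\<^sub>R f x)"
  have F: "Hs F" unfolding F_def by (rule Hs_scaleR[OF f(1)])
  have F2: "nsq lborel F = \<tau>\<^sup>2" unfolding F_def nsq_scaleR f by simp
  have F3: "B F = \<tau> ^ 3 * beta" unfolding F_def B_scaleR f ..
  have F3': "3 * c * B F = \<tau>\<^sup>2"
  proof -
    have "3 * c * B F = \<tau>\<^sup>2 * (3 * c * beta * \<tau>)" unfolding F3 by (simp add: power2_eq_square power3_eq_cube)
    then show ?thesis unfolding \<tau>(2) by simp
  qed
  have EL': "\<tau> * (c * dB F P) = \<tau> * ip lborel F P" if P: "Hs P" for P
  proof -
    have "U F = (\<lambda>x. \<tau> * U f x)" "V F = (\<lambda>x. \<tau> * V f x)" unfolding F_def scaleR_components by auto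
    then have "dB F P = \<tau>\<^sup>2 * dB f P"
      unfolding dB_def tri_def by (simp add: power2_eq_square algebra_simps flip: integral_mult_right_zero)
    also have "\<dots> = \<tau> * (3 * beta) * (\<tau> * ip lborel f P)" unfolding EL[rule_format, OF P] by (simp add: power2_eq_square)
    also have "\<tau> * ip lborel f P = ip lborel F P" by (simp add: F_def)
    finally have "c * dB F P = (3 * c * beta * \<tau>) * ip lborel F P" by simp
    then show ?thesis unfolding \<tau>(2) by simp
  qed
  have EL'': "c * dB F P = ip lborel F P" if "Hs P" for P using EL'[OF that] \<tau>(1) by simp
  define w where "w = U F"
  define \<xi> where "\<xi> = V F"
  have ww: "wgrad w (DU F)" and w\<xi>: "wgrad \<xi> (DV F)" using F by (auto simp: Hs_def w_def \<xi>_def)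
  note r = wgrad_represents[OF ww] wgrad_represents[OF w\<xi>]
  have mk: "mk w (DU F) \<xi> (DV F) = F" unfolding w_def \<xi>_def by (rule mk_decompose)
  have SF: "S_functional m1 m2 a1 a2 w \<xi> = (1 / (3 * c * beta))\<^sup>2 / 3"
    using S_eq[OF r] F3' unfolding mk F2 by (simp flip: \<tau>_def)
  have nt: "nontrivial w \<xi>"
    unfolding nontrivial_def
  proof
    assume "AE x in lebesgue. w x = 0 \<and> \<xi> x = 0"
    then have "AE x in lborel. w x = 0 \<and> \<xi> x = 0" by (simp add: AE_lebesgue_iff)
    then have "AE x in lborel. \<xi> x * w x * w x = 0" by eventually_elim simp
    then have "B F = 0" unfolding B_def tri_def w_def \<xi>_def by (rule integral_eq_zero_AE)
    with F3 \<tau>(1) beta_pos show False by simp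
  qed
  have H1: "w \<in> H1" "\<xi> \<in> H1" using r by (auto simp: represents_def)
  have Q: "Q_functional m1 m2 a1 a2 w \<xi> = 0"
    using Q_eq[OF r] F3' unfolding mk F2 by simp
  have inM: "(w, \<xi>) \<in> M_set m1 m2 a1 a2" using H1 nt Q by (simp add: M_set_def)
  have min: "S_functional m1 m2 a1 a2 w \<xi> \<le> S_functional m1 m2 a1 a2 u v" if "(u, v) \<in> M_set m1 m2 a1 a2" for u v :: "'a \<Rightarrow> real"
    unfolding SF by (rule M_set_lower_bound[OF that])
  have "(INF (u, v) \<in> (M_set m1 m2 a1 a2 :: (('a \<Rightarrow> real) \<times> ('a \<Rightarrow> real)) set). S_functional m1 m2 a1 a2 u v) = S_functional m1 m2 a1 a2 w \<xi>"
    by (rule cInf_eq_minimum) (use inM min in auto)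
  moreover have "weak_solution m1 m2 a1 a2 w \<xi>"
    unfolding weak_solution_def
  proof (intro conjI H1 ballI)
    fix \<phi> \<psi> :: "'a \<Rightarrow> real" assume \<phi>: "\<phi> \<in> test_functions" and \<psi>: "\<psi> \<in> test_functions"
    have w0: "wgrad (\<lambda>x::'a. 0) (\<lambda>x. 0)" by (simp add: wgrad_def)
    \<comment> \<open>Varying only the first component: both sides carry the weight a2 m2, and
      cancelling it leaves the first equation.\<close>
    have "c * dB F (mk \<phi> (gradient \<phi>) (\<lambda>x. 0) (\<lambda>x. 0)) = ip lborel F (mk \<phi> (gradient \<phi>) (\<lambda>x. 0) (\<lambda>x. 0))"
      by (rule EL'') (simp add: w0 wgrad_test_function[OF \<phi>])
    then have "a2 * m2 * (2 * a1 * m1 * tri w \<xi> \<phi>) = a2 * m2 * (ip lborel (DU F) (gradient \<phi>) + m1\<^sup>2 * (LBINT x. w x * \<phi> x))"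
      by (subst (asm) ip_decompose[OF F]) (simp_all add: w0 wgrad_test_function[OF \<phi>] dB_def tri_def w_def \<xi>_def squares algebra_simps)
    then have 1: "2 * a1 * m1 * tri w \<xi> \<phi> = ip lborel (DU F) (gradient \<phi>) + m1\<^sup>2 * (LBINT x. w x * \<phi> x)"
      using pos by simp
    \<comment> \<open>Varying only the second component: the common weight is a1 m1 / 2, and the
      halving supplies the factor 2 in the second equation.\<close>
    have "c * dB F (mk (\<lambda>x. 0) (\<lambda>x. 0) \<psi> (gradient \<psi>)) = ip lborel F (mk (\<lambda>x. 0) (\<lambda>x. 0) \<psi> (gradient \<psi>))"
      by (rule EL'') (simp add: w0 wgrad_test_function[OF \<psi>])
    then have "a1 * m1 / 2 * (2 * a2 * m2 * tri w w \<psi>) = a1 * m1 / 2 * (ip lborel (DV F) (gradient \<psi>) + m2\<^sup>2 * (LBINT x. \<xi> x * \<psi> x))"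
      by (subst (asm) ip_decompose[OF F]) (simp_all add: w0 wgrad_test_function[OF \<psi>] dB_def tri_def w_def \<xi>_def squares algebra_simps)
    then have 2: "2 * a2 * m2 * tri w w \<psi> = ip lborel (DV F) (gradient \<psi>) + m2\<^sup>2 * (LBINT x. \<xi> x * \<psi> x)"
      using pos by simp
    show "(LINT x|lebesgue. weak_gradient w x \<bullet> gradient \<phi> x) + m1\<^sup>2 * (LINT x|lebesgue. w x * \<phi> x)
          = 2 * a1 * m1 * (LINT x|lebesgue. w x * \<xi> x * \<phi> x)"
      unfolding represents_test_integrals(1,2)[OF ww \<phi>] represents_test_integrals(3)[OF ww \<phi> w\<xi>] using 1 by simp
    show "(LINT x|lebesgue. weak_gradient \<xi> x \<bullet> gradient \<psi> x) + m2\<^sup>2 * (LINT x|lebesgue. \<xi> x * \<psi> x)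
          = 2 * a2 * m2 * (LINT x|lebesgue. (w x)\<^sup>2 * \<psi> x)"
      unfolding represents_test_integrals(1,2)[OF w\<xi> \<psi>] power2_eq_square[of "w _"] represents_test_integrals(3)[OF ww \<psi> ww] using 2 by simp
  qed
  moreover have "S_functional m1 m2 a1 a2 w \<xi> \<le> S_functional m1 m2 a1 a2 u v"
    if "critical_point m1 m2 a1 a2 u v" "nontrivial u v" for u v :: "'a \<Rightarrow> real"
    by (rule min[OF critical_point_in_M_set[OF that]])
  ultimately have "ground_state m1 m2 a1 a2 w \<xi>" using nt by (simp add: ground_state_def)
  then show ?thesis
    using inM \<open>(INF (u, v) \<in> (M_set m1 m2 a1 a2 :: (('a \<Rightarrow> real) \<times> ('a \<Rightarrow> real)) set). S_functional m1 m2 a1 a2 u v) = S_functional m1 m2 a1 a2 w \<xi>\<close>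
    by (intro exI[of _ w] exI[of _ \<xi>]) simp
qed

end

theorem theorem2p2:
  fixes m1 m2 a1 a2 :: real
  assumes "m1 > 0" and "m2 > 0" and "a1 > 0" and "a2 > 0"
  shows "\<exists>(w :: real ^ 5 \<Rightarrow> real) (\<xi> :: real ^ 5 \<Rightarrow> real).
    (w, \<xi>) \<in> M_set m1 m2 a1 a2 \<and>
    S_functional m1 m2 a1 a2 w \<xi> =
      (INF (u, v) \<in> (M_set m1 m2 a1 a2 :: ((real ^ 5 \<Rightarrow> real) \<times> (real ^ 5 \<Rightarrow> real)) set).
         S_functional m1 m2 a1 a2 u v) \<and>
    ground_state m1 m2 a1 a2 w \<xi>"
proof -
  interpret elliptic_system m1 m2 a1 a2 "TYPE(real ^ 5)"
    by unfold_locales (use assms in auto)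
  show ?thesis by (rule ground_state_exists)
qed

end
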